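(* Let $R$ be a ring, let $G$ be a finitely generated group and let $\varphi\in S(G)$. Let $C_\bullet$ be a chain complex of free $RG$-modules finitely generated up to dimension $n$, with $C_k=0$ for $k<0$. Then $H_j(C_\bullet\otimes_{RG}\widehat{RG}^{\varphi})=0$ for all $j\le n$ if and only if $H_j\big(C_\bullet\otimes_{RG}\mathcal{D}(RG\subset\widehat{RG}^{\varphi})\big)=0$ for all $j\le n$.
   Context: Rings are associative and unital; modules are right modules. $S(G)=\mathrm{Hom}(G;\mathbb{R})\smallsetminus\{0\}$. The Novikov–Sikorav ring $\widehat{RG}^{\varphi}$ is the ring of formal sums $\sum_{g\in G}n_gg$, $n_g\in R$, such that $\{g:n_g\ne0\text{ and }\varphi(g)<s\}$ is finite for every $s\in\mathbb{R}$; it contains $RG$. The division closure $\mathcal{D}(S\subset A)$ of a subring $S$ in a ring $A$ is the smallest subring of $A$ containing $S$ in which every element invertible in $A$ is invertible. *)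

theory Defs
  imports "HOL-Algebra.Algebra"
begin

subsection \<open>Groups and characters\<close>

definition finitely_generated_group :: "('g, 'y) monoid_scheme \<Rightarrow> bool" where
  "finitely_generated_group G \<longleftrightarrow>
     group G \<and> (\<exists>S. finite S \<and> S \<subseteq> carrier G \<and> generate G S = carrier G)"

definition additive_reals :: "real monoid" where
  "additive_reals = \<lparr>carrier = UNIV, monoid.mult = (+), one = 0\<rparr>"

definition nonzero_characters :: "('g, 'y) monoid_scheme \<Rightarrow> ('g \<Rightarrow> real) set" where
  "nonzero_characters G = {\<phi> \<in> hom G additive_reals. \<exists>g\<in>carrier G. \<phi> g \<noteq> 0}"


subsection \<open>Group rings and Novikov--Sikorav rings\<close>

text \<open>A formal sum over \<^term>\<open>G\<close> is its coefficient function, made extensional on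
  \<^term>\<open>carrier G\<close>.  The coefficient of the product of \<open>a\<close> and \<open>b\<close> at \<open>g\<close> is the sum
  of \<open>a h\<close> times \<open>b k\<close> over all \<open>h\<close>, \<open>k\<close> with product \<open>g\<close>, restricted to the
  pairs with \<open>a h\<close> and \<open>b k\<close> both nonzero.  There are only finitely many of these for the carriers
  used below; this matters because \<^const>\<open>finsum\<close> has a default value on infinite index sets.\<close>

definition formal_sum_ring ::
  "('r, 'x) ring_scheme \<Rightarrow> ('g, 'y) monoid_scheme \<Rightarrow> ('g \<Rightarrow> 'r) set \<Rightarrow> ('g \<Rightarrow> 'r) ring" where
  "formal_sum_ring R G A =
     \<lparr>carrier = A,
      monoid.mult = (\<lambda>a b. \<lambda>g\<in>carrier G.
        (\<Oplus>\<^bsub>R\<^esub>h\<in>{h \<in> carrier G. a h \<noteq> \<zero>\<^bsub>R\<^esub> \<and> b (inv\<^bsub>G\<^esub> h \<otimes>\<^bsub>G\<^esub> g) \<noteq> \<zero>\<^bsub>R\<^esub>}.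
           a h \<otimes>\<^bsub>R\<^esub> b (inv\<^bsub>G\<^esub> h \<otimes>\<^bsub>G\<^esub> g))),
      monoid.one = (\<lambda>g\<in>carrier G. if g = \<one>\<^bsub>G\<^esub> then \<one>\<^bsub>R\<^esub> else \<zero>\<^bsub>R\<^esub>),
      ring.zero = (\<lambda>g\<in>carrier G. \<zero>\<^bsub>R\<^esub>),
      ring.add = (\<lambda>a b. \<lambda>g\<in>carrier G. a g \<oplus>\<^bsub>R\<^esub> b g)\<rparr>"

definition group_ring ::
  "('r, 'x) ring_scheme \<Rightarrow> ('g, 'y) monoid_scheme \<Rightarrow> ('g \<Rightarrow> 'r) ring" where
  "group_ring R G = formal_sum_ring R G
     {a \<in> carrier G \<rightarrow>\<^sub>E carrier R. finite {g \<in> carrier G. a g \<noteq> \<zero>\<^bsub>R\<^esub>}}"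

definition novikov_ring ::
  "('r, 'x) ring_scheme \<Rightarrow> ('g, 'y) monoid_scheme \<Rightarrow> ('g \<Rightarrow> real) \<Rightarrow> ('g \<Rightarrow> 'r) ring" where
  "novikov_ring R G \<phi> = formal_sum_ring R G
     {a \<in> carrier G \<rightarrow>\<^sub>E carrier R.
        \<forall>s. finite {g \<in> carrier G. a g \<noteq> \<zero>\<^bsub>R\<^esub> \<and> \<phi> g < s}}"


subsection \<open>Division closure\<close>

definition division_closed :: "'a set \<Rightarrow> ('a, 'x) ring_scheme \<Rightarrow> bool" where
  "division_closed T A \<longleftrightarrow> (\<forall>x\<in>T. x \<in> Units A \<longrightarrow> x \<in> Units (A\<lparr>carrier := T\<rparr>))"

definition division_closure :: "'a set \<Rightarrow> ('a, 'x) ring_scheme \<Rightarrow> 'a set" where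
  "division_closure S A = \<Inter>{T. subring T A \<and> S \<subseteq> T \<and> division_closed T A}"

definition division_closure_ring :: "'a set \<Rightarrow> 'a ring \<Rightarrow> 'a ring" where
  "division_closure_ring S A = A\<lparr>carrier := division_closure S A\<rparr>"


subsection \<open>Right modules over noncommutative rings\<close>

text \<open>The locale \<^locale>\<open>module\<close> requires commutative scalars, so only its record type is
  reused.  For a right module, \<open>a \<odot>\<^bsub>M\<^esub> x\<close> is the product of \<open>x\<close> by the scalar
  \<open>a\<close> on the right; hence the order of factors in \<open>smult_assoc\<close>.  For a left module it is the
  product by \<open>a\<close> on the left.\<close>

locale right_module = S?: ring S + M?: abelian_group M
  for S :: "('s, 'x) ring_scheme" and M :: "('s, 'm, 'y) module_scheme" (structure) +
  assumes smult_closed: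
      "\<lbrakk>a \<in> carrier S; x \<in> carrier M\<rbrakk> \<Longrightarrow> a \<odot>\<^bsub>M\<^esub> x \<in> carrier M"
    and smult_l_distr:
      "\<lbrakk>a \<in> carrier S; b \<in> carrier S; x \<in> carrier M\<rbrakk> \<Longrightarrow>
        (a \<oplus>\<^bsub>S\<^esub> b) \<odot>\<^bsub>M\<^esub> x = a \<odot>\<^bsub>M\<^esub> x \<oplus>\<^bsub>M\<^esub> b \<odot>\<^bsub>M\<^esub> x"
    and smult_r_distr:
      "\<lbrakk>a \<in> carrier S; x \<in> carrier M; y \<in> carrier M\<rbrakk> \<Longrightarrow>
        a \<odot>\<^bsub>M\<^esub> (x \<oplus>\<^bsub>M\<^esub> y) = a \<odot>\<^bsub>M\<^esub> x \<oplus>\<^bsub>M\<^esub> a \<odot>\<^bsub>M\<^esub> y"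
    and smult_assoc:
      "\<lbrakk>a \<in> carrier S; b \<in> carrier S; x \<in> carrier M\<rbrakk> \<Longrightarrow>
        (a \<otimes>\<^bsub>S\<^esub> b) \<odot>\<^bsub>M\<^esub> x = b \<odot>\<^bsub>M\<^esub> (a \<odot>\<^bsub>M\<^esub> x)"
    and smult_one:
      "x \<in> carrier M \<Longrightarrow> \<one>\<^bsub>S\<^esub> \<odot>\<^bsub>M\<^esub> x = x"

definition linear_hom ::
  "('s, 'x) ring_scheme \<Rightarrow> ('s, 'm, 'y) module_scheme \<Rightarrow> ('s, 'n, 'z) module_scheme \<Rightarrow> ('m \<Rightarrow> 'n) set"
  where
  "linear_hom S M N = {f \<in> hom (add_monoid M) (add_monoid N).
     \<forall>a\<in>carrier S. \<forall>x\<in>carrier M. f (a \<odot>\<^bsub>M\<^esub> x) = a \<odot>\<^bsub>N\<^esub> f x}"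

definition is_basis ::
  "('s, 'x) ring_scheme \<Rightarrow> ('s, 'm, 'y) module_scheme \<Rightarrow> 'm set \<Rightarrow> bool" where
  "is_basis S M B \<longleftrightarrow> B \<subseteq> carrier M \<and>
     (\<forall>m\<in>carrier M. \<exists>!c. c \<in> B \<rightarrow>\<^sub>E carrier S \<and> finite {x \<in> B. c x \<noteq> \<zero>\<^bsub>S\<^esub>} \<and>
        m = (\<Oplus>\<^bsub>M\<^esub>x\<in>{x \<in> B. c x \<noteq> \<zero>\<^bsub>S\<^esub>}. c x \<odot>\<^bsub>M\<^esub> x))"

definition free_module :: "('s, 'x) ring_scheme \<Rightarrow> ('s, 'm, 'y) module_scheme \<Rightarrow> bool" where
  "free_module S M \<longleftrightarrow> (\<exists>B. is_basis S M B)"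

definition finitely_generated_module ::
  "('s, 'x) ring_scheme \<Rightarrow> ('s, 'm, 'y) module_scheme \<Rightarrow> bool" where
  "finitely_generated_module S M \<longleftrightarrow> (\<exists>B. finite B \<and> B \<subseteq> carrier M \<and>
     (\<forall>m\<in>carrier M. \<exists>c\<in>B \<rightarrow> carrier S. m = (\<Oplus>\<^bsub>M\<^esub>x\<in>B. c x \<odot>\<^bsub>M\<^esub> x)))"


subsection \<open>Tensor products\<close>

text \<open>The tensor product over \<open>S\<close> of a right module \<open>M\<close> and a left module \<open>N\<close> is the
  abelian group presented by generators \<open>(x, y)\<close> and the usual balanced-biadditivity relations.
  \<^const>\<open>frag_of\<close> is the inclusion of generators in the free abelian group.\<close>

definition tensor_relations ::
  "('s, 'x) ring_scheme \<Rightarrow> ('s, 'm, 'y) module_scheme \<Rightarrow> ('s, 'n, 'z) module_scheme \<Rightarrow>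
     ('m \<times> 'n \<Rightarrow>\<^sub>0 int) set" where
  "tensor_relations S M N =
     {frag_of (x \<oplus>\<^bsub>M\<^esub> x', y) - frag_of (x, y) - frag_of (x', y) | x x' y.
        x \<in> carrier M \<and> x' \<in> carrier M \<and> y \<in> carrier N} \<union>
     {frag_of (x, y \<oplus>\<^bsub>N\<^esub> y') - frag_of (x, y) - frag_of (x, y') | x y y'.
        x \<in> carrier M \<and> y \<in> carrier N \<and> y' \<in> carrier N} \<union>
     {frag_of (a \<odot>\<^bsub>M\<^esub> x, y) - frag_of (x, a \<odot>\<^bsub>N\<^esub> y) | a x y.
        a \<in> carrier S \<and> x \<in> carrier M \<and> y \<in> carrier N}"

definition tensor_relation_subgroup ::
  "('s, 'x) ring_scheme \<Rightarrow> ('s, 'm, 'y) module_scheme \<Rightarrow> ('s, 'n, 'z) module_scheme \<Rightarrow>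
     ('m \<times> 'n \<Rightarrow>\<^sub>0 int) set" where
  "tensor_relation_subgroup S M N =
     generate (free_Abelian_group (carrier M \<times> carrier N)) (tensor_relations S M N)"

definition tensor_product ::
  "('s, 'x) ring_scheme \<Rightarrow> ('s, 'm, 'y) module_scheme \<Rightarrow> ('s, 'n, 'z) module_scheme \<Rightarrow>
     ('m \<times> 'n \<Rightarrow>\<^sub>0 int) set monoid" where
  "tensor_product S M N =
     free_Abelian_group (carrier M \<times> carrier N) Mod tensor_relation_subgroup S M N"

text \<open>The map induced by \<open>f : M \<rightarrow> M'\<close> and the identity of \<open>N\<close>: it sends the coset of
  \<open>u\<close> to the coset of the image of \<open>u\<close> under the homomorphism of free abelian groups given by
  \<open>(x, y) \<mapsto> (f x, y)\<close>.  The set product with the relation subgroup of the target turns the image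
  of a coset into a full coset.\<close>

definition tensor_map ::
  "('s, 'x) ring_scheme \<Rightarrow> ('s, 'm, 'y) module_scheme \<Rightarrow> ('s, 'k, 'w) module_scheme \<Rightarrow>
     ('s, 'n, 'z) module_scheme \<Rightarrow> ('m \<Rightarrow> 'k) \<Rightarrow>
     ('m \<times> 'n \<Rightarrow>\<^sub>0 int) set \<Rightarrow> ('k \<times> 'n \<Rightarrow>\<^sub>0 int) set" where
  "tensor_map S M M' N f U =
     tensor_relation_subgroup S M' N <#>\<^bsub>free_Abelian_group (carrier M' \<times> carrier N)\<^esub>
       (frag_extend (\<lambda>(x, y). frag_of (f x, y)) ` U)"

text \<open>A ring \<open>A\<close> as a left module over a subring, acting by multiplication in \<open>A\<close>.\<close>

definition left_regular :: "'a ring \<Rightarrow> ('a, 'a) module" where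
  "left_regular A =
     \<lparr>carrier = carrier A, monoid.mult = monoid.mult A, monoid.one = monoid.one A,
      ring.zero = ring.zero A, ring.add = ring.add A, smult = monoid.mult A\<rparr>"


subsection \<open>Chain complexes and homology\<close>

text \<open>In both definitions below \<open>d k\<close> goes from degree \<open>k\<close> to degree \<open>k - 1\<close>.\<close>

definition chain_complex ::
  "('s, 'x) ring_scheme \<Rightarrow> (int \<Rightarrow> ('s, 'm, 'y) module_scheme) \<Rightarrow> (int \<Rightarrow> 'm \<Rightarrow> 'm) \<Rightarrow> bool" where
  "chain_complex S C d \<longleftrightarrow>
     (\<forall>k. right_module S (C k)) \<and>
     (\<forall>k. d k \<in> linear_hom S (C k) (C (k - 1))) \<and>
     (\<forall>k. \<forall>x\<in>carrier (C k). d (k - 1) (d k x) = \<zero>\<^bsub>C (k - 2)\<^esub>)"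

definition homology ::
  "(int \<Rightarrow> ('t, 'y) monoid_scheme) \<Rightarrow> (int \<Rightarrow> 't \<Rightarrow> 't) \<Rightarrow> int \<Rightarrow> 't set monoid" where
  "homology T \<delta> j =
     (T j)\<lparr>carrier := kernel (T j) (T (j - 1)) (\<delta> j)\<rparr> Mod (\<delta> (j + 1) ` carrier (T (j + 1)))"

text \<open>The underlying abelian group of the homology of the chain complex \<open>C\<close> tensored over \<open>S\<close>
  with an overring \<open>A\<close>.\<close>

definition tensor_homology ::
  "('s, 'x) ring_scheme \<Rightarrow> (int \<Rightarrow> ('s, 'm, 'y) module_scheme) \<Rightarrow> (int \<Rightarrow> 'm \<Rightarrow> 'm) \<Rightarrow>
     's ring \<Rightarrow> int \<Rightarrow> ('m \<times> 's \<Rightarrow>\<^sub>0 int) set set monoid" where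
  "tensor_homology S C d A =
     homology (\<lambda>k. tensor_product S (C k) (left_regular A))
       (\<lambda>k. tensor_map S (C k) (C (k - 1)) (left_regular A) (d k))"

end

theory Submission
  imports Defs
begin

text \<open>Write \<open>S\<close> for the group ring, \<open>N\<close> for the Novikov--Sikorav ring and \<open>D\<close> for the division
closure of \<open>S\<close> in \<open>N\<close>.  For a subring \<open>T\<close> of \<open>N\<close> containing \<open>S\<close>, a choice of bases identifies the tensor
product of \<open>C\<close> with \<open>T\<close> with the complex of finitely supported vectors over \<open>T\<close> whose boundary maps
are the matrices of \<open>C\<close>, with entries in \<open>S\<close> (\<open>tensor_homology_trivial_iff\<close>).  The statement thus
compares exactness of one and the same matrix complex over \<open>N\<close> and over \<open>D\<close>.

A matrix complex that vanishes in negative degrees and is exact up to degree \<open>n\<close> has a contraction \<open>s\<close>,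
\<open>d s + s d = 1\<close>, in these degrees (\<open>contraction_exists\<close>); a contraction
persists over every larger ring and forces exactness there (\<open>contracting_imp_exact_at\<close>).  This gives the
step from \<open>D\<close> to \<open>N\<close>.

For the step from \<open>N\<close> to \<open>D\<close>, filter \<open>N\<close> by the infimum of \<open>\<phi>\<close> on the support.  Truncation shows that \<open>S\<close>
is dense, so a contraction \<open>s\<close> over \<open>N\<close> can be replaced by a matrix \<open>s'\<close> over \<open>S\<close> so close to \<open>s\<close>
that \<open>f = d s' + s' d\<close> is \<open>1 - e\<close> with all entries of \<open>e\<close> of positive filtration
(\<open>approximate_contraction\<close>); here the finiteness of the bases up to degree \<open>n\<close> makes the number of conditions
finite.  Over \<open>D\<close> such an \<open>f\<close> is bijective.  It is injective because \<open>y = e y\<close> pushes \<open>y\<close> arbitrarily deep into the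
filtration (\<open>one_minus_pos_injective\<close>).  It is surjective by Gaussian elimination, whose pivots \<open>1 - a\<close>
are inverted in \<open>N\<close> by the geometric series and hence in \<open>D\<close> by division closedness
(\<open>solve_one_minus_pos\<close>).  As \<open>f\<close> is a chain map, null-homotopic through \<open>s'\<close>, and bijective over \<open>D\<close>, every cycle
over \<open>D\<close> is a boundary over \<open>D\<close> (\<open>exact_at_division_closed\<close>).\<close>

section \<open>Finitely supported vectors and column matrices\<close>

text \<open>Vectors take the value zero, not an undefined one, outside of \<open>B\<close>, so that their support determines the terms of
a matrix product.  The set \<open>T\<close> restricts the entries, so that vectors over different subrings of one ring \<open>A\<close> are
added and multiplied by the same operations.\<close>

definition vec :: "('a, 'x) ring_scheme \<Rightarrow> 'a set \<Rightarrow> 'i set \<Rightarrow> ('i \<Rightarrow> 'a) set" where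
  "vec A T B = {x. range x \<subseteq> T \<and> finite {i. x i \<noteq> \<zero>\<^bsub>A\<^esub>} \<and> (\<forall>i. i \<notin> B \<longrightarrow> x i = \<zero>\<^bsub>A\<^esub>)}"

definition vadd :: "('a, 'x) ring_scheme \<Rightarrow> ('i \<Rightarrow> 'a) \<Rightarrow> ('i \<Rightarrow> 'a) \<Rightarrow> 'i \<Rightarrow> 'a" where
  "vadd A x y = (\<lambda>i. x i \<oplus>\<^bsub>A\<^esub> y i)"

definition vdiff :: "('a, 'x) ring_scheme \<Rightarrow> ('i \<Rightarrow> 'a) \<Rightarrow> ('i \<Rightarrow> 'a) \<Rightarrow> 'i \<Rightarrow> 'a" where
  "vdiff A x y = (\<lambda>i. x i \<ominus>\<^bsub>A\<^esub> y i)"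

definition unit_vec :: "('a, 'x) ring_scheme \<Rightarrow> 'i \<Rightarrow> 'i \<Rightarrow> 'a" where
  "unit_vec A b = (\<lambda>i. if i = b then \<one>\<^bsub>A\<^esub> else \<zero>\<^bsub>A\<^esub>)"

text \<open>The argument \<open>f\<close> is a matrix given by its columns.  Scalars act on columns from the right, so that
\<open>x \<mapsto> lin A f x\<close> is a map of right modules over a noncommutative \<open>A\<close>.\<close>

definition lin :: "('a, 'x) ring_scheme \<Rightarrow> ('j \<Rightarrow> 'i \<Rightarrow> 'a) \<Rightarrow> ('j \<Rightarrow> 'a) \<Rightarrow> 'i \<Rightarrow> 'a" where
  "lin A f x = (\<lambda>i. \<Oplus>\<^bsub>A\<^esub>b\<in>{b. x b \<noteq> \<zero>\<^bsub>A\<^esub>}. f b i \<otimes>\<^bsub>A\<^esub> x b)"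

lemma vecI:
  "\<lbrakk>\<And>i. x i \<in> T; finite {i. x i \<noteq> \<zero>\<^bsub>A\<^esub>}; \<And>i. i \<notin> B \<Longrightarrow> x i = \<zero>\<^bsub>A\<^esub>\<rbrakk> \<Longrightarrow> x \<in> vec A T B"
  by (auto simp: vec_def)

lemma vecD:
  assumes "x \<in> vec A T B"
  shows "x i \<in> T" and "finite {i. x i \<noteq> \<zero>\<^bsub>A\<^esub>}" and "i \<notin> B \<Longrightarrow> x i = \<zero>\<^bsub>A\<^esub>"
    and "x i \<noteq> \<zero>\<^bsub>A\<^esub> \<Longrightarrow> i \<in> B"
  using assms by (auto simp: vec_def)

lemma vec_mono: "\<lbrakk>x \<in> vec A T B; T \<subseteq> T'; B \<subseteq> B'\<rbrakk> \<Longrightarrow> x \<in> vec A T' B'"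
  by (auto simp: vec_def)

context ring
begin

lemma subring_closed_finsum:
  assumes "subring T R" "\<And>b. b \<in> K \<Longrightarrow> f b \<in> T"
  shows "(\<Oplus>b\<in>K. f b) \<in> T"
  using assms(2)
proof (induction K rule: infinite_finite_induct)
  case (insert x F)
  then have "f x \<in> T" "\<And>b. b \<in> F \<Longrightarrow> f b \<in> T" by auto
  with insert subringE[OF assms(1)] show ?case
    by (subst finsum_insert) auto
qed (use subringE[OF assms(1)] in auto)

lemma finsum_restrict:
  assumes "finite K" "L \<subseteq> K" "\<And>b. b \<in> K \<Longrightarrow> f b \<in> carrier R" "\<And>b. b \<in> K - L \<Longrightarrow> f b = \<zero>"
  shows "(\<Oplus>b\<in>K. f b) = (\<Oplus>b\<in>L. f b)"
  using assms by (intro add.finprod_mono_neutral_cong_right) auto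

lemma finsum_swap:
  assumes "finite K" "finite L" "\<And>i j. \<lbrakk>i \<in> K; j \<in> L\<rbrakk> \<Longrightarrow> f i j \<in> carrier R"
  shows "(\<Oplus>i\<in>K. \<Oplus>j\<in>L. f i j) = (\<Oplus>j\<in>L. \<Oplus>i\<in>K. f i j)"
  using assms(1) assms(3)
proof (induction K rule: finite_induct)
  case empty
  show ?case by (simp add: finsum_zero)
next
  case (insert k K)
  then have "(\<Oplus>i\<in>insert k K. \<Oplus>j\<in>L. f i j) = (\<Oplus>j\<in>L. f k j) \<oplus> (\<Oplus>i\<in>K. \<Oplus>j\<in>L. f i j)"
    by (subst finsum_insert) (auto intro!: finsum_closed)
  also have "\<dots> = (\<Oplus>j\<in>L. f k j) \<oplus> (\<Oplus>j\<in>L. \<Oplus>i\<in>K. f i j)"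
    using insert by simp
  also have "\<dots> = (\<Oplus>j\<in>L. f k j \<oplus> (\<Oplus>i\<in>K. f i j))"
    using insert by (intro finsum_addf[symmetric]) (auto intro!: finsum_closed)
  also have "\<dots> = (\<Oplus>j\<in>L. \<Oplus>i\<in>insert k K. f i j)"
    using insert by (intro finsum_cong') (auto intro!: finsum_closed)
  finally show ?case .
qed

lemma finsum_neg:
  assumes "\<And>b. b \<in> K \<Longrightarrow> f b \<in> carrier R"
  shows "(\<Oplus>b\<in>K. \<ominus> f b) = \<ominus> (\<Oplus>b\<in>K. f b)"
  using assms
proof (induction K rule: infinite_finite_induct)
  case (insert x F)
  then have "f x \<in> carrier R" "\<And>b. b \<in> F \<Longrightarrow> f b \<in> carrier R" by auto
  with insert show ?case
    by (simp add: Pi_def minus_add finsum_closed)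
qed auto

lemma finsum_diff:
  assumes "\<And>b. b \<in> K \<Longrightarrow> f b \<in> carrier R" "\<And>b. b \<in> K \<Longrightarrow> g b \<in> carrier R"
  shows "(\<Oplus>b\<in>K. f b \<ominus> g b) = (\<Oplus>b\<in>K. f b) \<ominus> (\<Oplus>b\<in>K. g b)"
  using assms by (simp add: a_minus_def finsum_addf finsum_neg[symmetric])

lemma lin_eq:
  assumes "finite K" "{b. x b \<noteq> \<zero>} \<subseteq> K"
    and "\<And>b. b \<in> K \<Longrightarrow> f b i \<in> carrier R" "\<And>b. b \<in> K \<Longrightarrow> x b \<in> carrier R"
  shows "lin R f x i = (\<Oplus>b\<in>K. f b i \<otimes> x b)"
  unfolding lin_def using assms by (intro finsum_restrict[symmetric]) auto

lemma vadd_vec: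
  assumes "subring T R" "x \<in> vec R T B" "y \<in> vec R T B"
  shows "vadd R x y \<in> vec R T B"
proof (rule vecI)
  have "{i. vadd R x y i \<noteq> \<zero>} \<subseteq> {i. x i \<noteq> \<zero>} \<union> {i. y i \<noteq> \<zero>}"
    by (auto simp: vadd_def)
  then show "finite {i. vadd R x y i \<noteq> \<zero>}"
    by (rule finite_subset) (use vecD(2) assms in blast)
qed (use subringE[OF assms(1)] vecD(1,3)[OF assms(2)] vecD(1,3)[OF assms(3)] in \<open>auto simp: vadd_def\<close>)

lemma vdiff_vec:
  assumes "subring T R" "x \<in> vec R T B" "y \<in> vec R T B"
  shows "vdiff R x y \<in> vec R T B"
proof (rule vecI)
  have "{i. vdiff R x y i \<noteq> \<zero>} \<subseteq> {i. x i \<noteq> \<zero>} \<union> {i. y i \<noteq> \<zero>}"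
    by (auto simp: vdiff_def a_minus_def)
  then show "finite {i. vdiff R x y i \<noteq> \<zero>}"
    by (rule finite_subset) (use vecD(2) assms in blast)
qed (use subringE[OF assms(1)] vecD(1,3)[OF assms(2)] vecD(1,3)[OF assms(3)] in \<open>auto simp: vdiff_def a_minus_def\<close>)

lemma zero_vec: "subring T R \<Longrightarrow> (\<lambda>_. \<zero>) \<in> vec R T B"
  using subringE(2) by (auto simp: vec_def)

lemma vadd_vdiff_cancel:
  assumes "x \<in> vec R (carrier R) B" "y \<in> vec R (carrier R) B'"
  shows "vadd R (vdiff R x y) y = x" and "vdiff R (vadd R x y) y = x"
  using vecD(1)[OF assms(1)] vecD(1)[OF assms(2)]
  by (auto simp: vadd_def vdiff_def a_minus_def a_assoc l_neg r_neg)

lemma unit_vec_vec: "\<lbrakk>subring T R; b \<in> B\<rbrakk> \<Longrightarrow> unit_vec R b \<in> vec R T B"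
proof (rule vecI)
  show "finite {i. unit_vec R b i \<noteq> \<zero>}"
    by (rule finite_subset[of _ "{b}"]) (auto simp: unit_vec_def)
qed (auto simp: unit_vec_def subringE)

lemma lin_vec:
  assumes T: "subring T R" and x: "x \<in> vec R T B" and f: "\<And>b. b \<in> B \<Longrightarrow> f b \<in> vec R T B'"
  shows "lin R f x \<in> vec R T B'"
proof (rule vecI)
  have TR: "T \<subseteq> carrier R" by (rule subringE(1)[OF T])
  fix i
  show "lin R f x i \<in> T" unfolding lin_def
    by (rule subring_closed_finsum[OF T]) (use T x f vecD in \<open>metis (mono_tags, lifting) mem_Collect_eq subringE(6)\<close>)
  have "lin R f x i = \<zero>" if "\<And>b. b \<in> B \<Longrightarrow> f b i = \<zero>"
  proof -
    have "\<And>b. x b \<noteq> \<zero> \<Longrightarrow> f b i \<otimes> x b = \<zero>"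
      using that vecD(1,4)[OF x] TR by (metis in_mono l_null)
    then show ?thesis unfolding lin_def by (intro add.finprod_one_eqI) auto
  qed
  note z = this
  show "lin R f x i = \<zero>" if "i \<notin> B'"
    by (rule z) (use f that in \<open>auto dest: vecD(3)\<close>)
next
  have TR: "T \<subseteq> carrier R" by (rule subringE(1)[OF T])
  have "{i. lin R f x i \<noteq> \<zero>} \<subseteq> (\<Union>b\<in>{b. x b \<noteq> \<zero>}. {i. f b i \<noteq> \<zero>})"
  proof
    fix i assume i: "i \<in> {i. lin R f x i \<noteq> \<zero>}"
    show "i \<in> (\<Union>b\<in>{b. x b \<noteq> \<zero>}. {i. f b i \<noteq> \<zero>})"
    proof (rule ccontr)
      assume "i \<notin> (\<Union>b\<in>{b. x b \<noteq> \<zero>}. {i. f b i \<noteq> \<zero>})"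
      then have "\<And>b. x b \<noteq> \<zero> \<Longrightarrow> f b i \<otimes> x b = \<zero>"
        using vecD(1)[OF x] TR by (metis (mono_tags, lifting) UN_I in_mono l_null mem_Collect_eq)
      then have "lin R f x i = \<zero>" unfolding lin_def by (intro add.finprod_one_eqI) auto
      with i show False by simp
    qed
  qed
  moreover have "finite (\<Union>b\<in>{b. x b \<noteq> \<zero>}. {i. f b i \<noteq> \<zero>})"
    using vecD(2,4)[OF x] f vecD(2) by (intro finite_UN_I) blast+
  ultimately show "finite {i. lin R f x i \<noteq> \<zero>}" by (rule finite_subset)
qed

abbreviation "cvec B \<equiv> vec R (carrier R) B"

lemma lin_eq':
  assumes "x \<in> cvec B" "\<And>b. b \<in> B \<Longrightarrow> f b \<in> cvec B'" "finite K" "{b. x b \<noteq> \<zero>} \<subseteq> K" "K \<subseteq> B"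
  shows "lin R f x i = (\<Oplus>b\<in>K. f b i \<otimes> x b)"
  using assms by (intro lin_eq) (auto dest: vecD(1))

lemma lin_vadd:
  assumes x: "x \<in> cvec B" and y: "y \<in> cvec B" and f: "\<And>b. b \<in> B \<Longrightarrow> f b \<in> cvec B'"
  shows "lin R f (vadd R x y) = vadd R (lin R f x) (lin R f y)"
proof
  fix i
  define K where "K = {b. x b \<noteq> \<zero>} \<union> {b. y b \<noteq> \<zero>}"
  have K: "finite K" "K \<subseteq> B" "{b. x b \<noteq> \<zero>} \<subseteq> K" "{b. y b \<noteq> \<zero>} \<subseteq> K" "{b. vadd R x y b \<noteq> \<zero>} \<subseteq> K"
    using vecD(2,4)[OF x] vecD(2,4)[OF y] by (auto simp: K_def vadd_def)
  have c: "\<And>b. b \<in> K \<Longrightarrow> f b i \<in> carrier R" "\<And>b. x b \<in> carrier R" "\<And>b. y b \<in> carrier R"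
    using f K(2) vecD(1)[OF x] vecD(1)[OF y] by (auto dest: vecD(1))
  have "lin R f (vadd R x y) i = (\<Oplus>b\<in>K. f b i \<otimes> vadd R x y b)"
    by (rule lin_eq'[OF vadd_vec[OF carrier_is_subring x y] f K(1,5,2)])
  also have "\<dots> = (\<Oplus>b\<in>K. f b i \<otimes> x b \<oplus> f b i \<otimes> y b)"
    using c by (intro finsum_cong') (auto simp: vadd_def r_distr)
  also have "\<dots> = (\<Oplus>b\<in>K. f b i \<otimes> x b) \<oplus> (\<Oplus>b\<in>K. f b i \<otimes> y b)"
    using c by (intro finsum_addf) auto
  also have "\<dots> = lin R f x i \<oplus> lin R f y i"
    by (simp add: lin_eq'[OF x f K(1,3,2)] lin_eq'[OF y f K(1,4,2)])
  finally show "lin R f (vadd R x y) i = vadd R (lin R f x) (lin R f y) i" by (simp add: vadd_def)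
qed

lemma lin_vdiff:
  assumes x: "x \<in> cvec B" and y: "y \<in> cvec B" and f: "\<And>b. b \<in> B \<Longrightarrow> f b \<in> cvec B'"
  shows "lin R f (vdiff R x y) = vdiff R (lin R f x) (lin R f y)"
proof -
  have c: "vdiff R x y \<in> cvec B" "lin R f x \<in> cvec B'" "lin R f y \<in> cvec B'" "lin R f (vdiff R x y) \<in> cvec B'"
    using x y f by (auto intro!: vdiff_vec lin_vec carrier_is_subring)
  have "lin R f x = vadd R (lin R f (vdiff R x y)) (lin R f y)"
    using lin_vadd[OF c(1) y f] vadd_vdiff_cancel(1)[OF x y] by simp
  then show ?thesis using vadd_vdiff_cancel(2)[OF c(4,3)] by simp
qed

lemma lin_matrix_vadd:
  assumes x: "x \<in> cvec B" and f: "\<And>b. b \<in> B \<Longrightarrow> f b \<in> cvec B'" and g: "\<And>b. b \<in> B \<Longrightarrow> g b \<in> cvec B'"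
  shows "lin R (\<lambda>b. vadd R (f b) (g b)) x = vadd R (lin R f x) (lin R g x)"
proof
  fix i
  have c: "\<And>b. x b \<noteq> \<zero> \<Longrightarrow> f b i \<in> carrier R \<and> g b i \<in> carrier R" "\<And>b. x b \<in> carrier R"
    using vecD(1)[OF f] vecD(1)[OF g] vecD(1,4)[OF x] by blast+
  have "lin R (\<lambda>b. vadd R (f b) (g b)) x i = (\<Oplus>b\<in>{b. x b \<noteq> \<zero>}. f b i \<otimes> x b \<oplus> g b i \<otimes> x b)"
    unfolding lin_def using c by (intro finsum_cong') (auto simp: vadd_def l_distr)
  also have "\<dots> = vadd R (lin R f x) (lin R g x) i"
    unfolding lin_def vadd_def using c by (intro finsum_addf) auto
  finally show "lin R (\<lambda>b. vadd R (f b) (g b)) x i = vadd R (lin R f x) (lin R g x) i" .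
qed

lemma lin_matrix_vdiff:
  assumes x: "x \<in> cvec B" and f: "\<And>b. b \<in> B \<Longrightarrow> f b \<in> cvec B'" and g: "\<And>b. b \<in> B \<Longrightarrow> g b \<in> cvec B'"
  shows "lin R (\<lambda>b. vdiff R (f b) (g b)) x = vdiff R (lin R f x) (lin R g x)"
proof
  fix i
  have c: "\<And>b. x b \<noteq> \<zero> \<Longrightarrow> f b i \<in> carrier R \<and> g b i \<in> carrier R" "\<And>b. x b \<in> carrier R"
    using vecD(1)[OF f] vecD(1)[OF g] vecD(1,4)[OF x] by blast+
  have "lin R (\<lambda>b. vdiff R (f b) (g b)) x i = (\<Oplus>b\<in>{b. x b \<noteq> \<zero>}. f b i \<otimes> x b \<ominus> g b i \<otimes> x b)"
    unfolding lin_def using c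
    by (intro finsum_cong') (auto simp: vdiff_def a_minus_def l_distr l_minus)
  also have "\<dots> = vdiff R (lin R f x) (lin R g x) i"
    unfolding lin_def vdiff_def using c by (intro finsum_diff) auto
  finally show "lin R (\<lambda>b. vdiff R (f b) (g b)) x i = vdiff R (lin R f x) (lin R g x) i" .
qed

lemma lin_lin:
  assumes x: "x \<in> cvec B" and g: "\<And>b. b \<in> B \<Longrightarrow> g b \<in> cvec B'" and f: "\<And>b. b \<in> B' \<Longrightarrow> f b \<in> cvec B''"
  shows "lin R f (lin R g x) = lin R (\<lambda>b. lin R f (g b)) x"
proof
  fix i
  define J where "J = {b. x b \<noteq> \<zero>}"
  define K where "K = (\<Union>b\<in>J. {c. g b c \<noteq> \<zero>})"
  have J: "finite J" "J \<subseteq> B" using vecD(2,4)[OF x] by (auto simp: J_def)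
  have K: "finite K" "K \<subseteq> B'"
    using J g by (auto simp: K_def dest: vecD)
  have gc: "\<And>b c. b \<in> J \<Longrightarrow> g b c \<in> carrier R" using J g by (auto dest: vecD)
  have fc: "\<And>c. c \<in> K \<Longrightarrow> f c i \<in> carrier R" using K f by (auto dest: vecD)
  have xc: "\<And>b. x b \<in> carrier R" using vecD(1)[OF x] by auto
  have gx: "lin R g x \<in> cvec B'" by (rule lin_vec[OF carrier_is_subring x g])
  have gxe: "lin R g x c = (\<Oplus>b\<in>J. g b c \<otimes> x b)" for c unfolding lin_def J_def ..
  have "lin R g x c = \<zero>" if "c \<notin> K" for c
    unfolding gxe using that xc by (intro add.finprod_one_eqI) (auto simp: K_def)
  then have KS: "{c. lin R g x c \<noteq> \<zero>} \<subseteq> K" by auto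
  have "lin R f (lin R g x) i = (\<Oplus>c\<in>K. f c i \<otimes> (\<Oplus>b\<in>J. g b c \<otimes> x b))"
    by (subst lin_eq'[OF gx f K(1) KS K(2)]) (simp_all only: gxe)
  also have "\<dots> = (\<Oplus>c\<in>K. \<Oplus>b\<in>J. f c i \<otimes> g b c \<otimes> x b)"
    using fc gc xc J(1) by (intro finsum_cong')
      (auto simp: finsum_rdistr Pi_def m_assoc intro!: finsum_cong')
  also have "\<dots> = (\<Oplus>b\<in>J. \<Oplus>c\<in>K. f c i \<otimes> g b c \<otimes> x b)"
    using fc gc xc J(1) K(1) by (intro finsum_swap) auto
  also have "\<dots> = (\<Oplus>b\<in>J. lin R f (g b) i \<otimes> x b)"
  proof (rule finsum_cong')
    fix b assume b: "b \<in> J"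
    have "lin R f (g b) i = (\<Oplus>c\<in>K. f c i \<otimes> g b c)"
      using b J by (intro lin_eq'[OF g f K(1) _ K(2)]) (auto simp: K_def)
    then show "(\<Oplus>c\<in>K. f c i \<otimes> g b c \<otimes> x b) = lin R f (g b) i \<otimes> x b"
      using b fc gc xc K(1) by (simp add: finsum_ldistr Pi_def)
  next
    show "(\<lambda>b. lin R f (g b) i \<otimes> x b) \<in> J \<rightarrow> carrier R"
    proof
      fix b assume "b \<in> J"
      then have "lin R f (g b) \<in> cvec B''"
        using J by (intro lin_vec[OF carrier_is_subring g f]) auto
      from vecD(1)[OF this] xc show "lin R f (g b) i \<otimes> x b \<in> carrier R" by simp
    qed
  qed auto
  finally show "lin R f (lin R g x) i = lin R (\<lambda>b. lin R f (g b)) x i"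
    by (simp add: lin_def J_def)
qed

lemma lin_unit_vec:
  assumes "b \<in> B" "\<And>b. b \<in> B \<Longrightarrow> f b \<in> cvec B'"
  shows "lin R f (unit_vec R b) = f b"
proof
  fix i
  have "lin R f (unit_vec R b) i = (\<Oplus>c\<in>{b}. f c i \<otimes> unit_vec R b c)"
    by (rule lin_eq'[OF unit_vec_vec[OF carrier_is_subring assms(1)] assms(2)])
      (use assms(1) in \<open>auto simp: unit_vec_def split: if_splits\<close>)
  moreover have "f b i \<in> carrier R" using vecD(1)[OF assms(2)[OF assms(1)]] .
  ultimately show "lin R f (unit_vec R b) i = f b i"
    by (simp add: unit_vec_def)
qed

lemma lin_unit_matrix:
  assumes x: "x \<in> cvec B"
  shows "lin R (unit_vec R) x = x"
proof
  fix i
  have xc: "\<And>b. x b \<in> carrier R" using vecD(1)[OF x] by auto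
  have K: "finite (insert i {b. x b \<noteq> \<zero>})" using vecD(2)[OF x] by auto
  have "lin R (unit_vec R) x i = (\<Oplus>c\<in>insert i {b. x b \<noteq> \<zero>}. unit_vec R c i \<otimes> x c)"
    by (rule lin_eq) (use K xc in \<open>auto simp: unit_vec_def\<close>)
  also have "\<dots> = (\<Oplus>c\<in>{i}. unit_vec R c i \<otimes> x c)"
    by (rule finsum_restrict) (use K xc in \<open>auto simp: unit_vec_def\<close>)
  finally show "lin R (unit_vec R) x i = x i" using xc by (simp add: unit_vec_def)
qed

lemma lin_cong: "(\<And>b. x b \<noteq> \<zero> \<Longrightarrow> f b = g b) \<Longrightarrow> (\<And>b i. x b \<noteq> \<zero> \<Longrightarrow> g b i \<otimes> x b \<in> carrier R) \<Longrightarrow> lin R f x = lin R g x"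
  unfolding lin_def by (intro ext finsum_cong') auto

lemma lin_cong':
  assumes "x \<in> cvec B" "\<And>b. b \<in> B \<Longrightarrow> f b = g b" "\<And>b. b \<in> B \<Longrightarrow> g b \<in> cvec B'"
  shows "lin R f x = lin R g x"
proof (rule lin_cong)
  fix b i assume "x b \<noteq> \<zero>"
  then have b: "b \<in> B" using vecD(4)[OF assms(1)] by blast
  then show "f b = g b" by (rule assms(2))
  show "g b i \<otimes> x b \<in> carrier R" using vecD(1)[OF assms(3)[OF b]] vecD(1)[OF assms(1)] by simp
qed

end

section \<open>Matrix complexes and contractions\<close>

text \<open>In degree \<open>k\<close> the columns of the matrix of the boundary map are the \<open>m k b\<close> for \<open>b \<in> B k\<close>.\<close>

definition exact_at :: "('a, 'x) ring_scheme \<Rightarrow> 'a set \<Rightarrow> (int \<Rightarrow> 'i set) \<Rightarrow> (int \<Rightarrow> 'i \<Rightarrow> 'i \<Rightarrow> 'a) \<Rightarrow> int \<Rightarrow> bool" where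
  "exact_at A T B m k \<longleftrightarrow> (\<forall>x\<in>vec A T (B k). lin A (m k) x = (\<lambda>_. \<zero>\<^bsub>A\<^esub>) \<longrightarrow>
     (\<exists>y\<in>vec A T (B (k + 1)). lin A (m (k + 1)) y = x))"

definition contracting :: "('a, 'x) ring_scheme \<Rightarrow> 'a set \<Rightarrow> (int \<Rightarrow> 'i set) \<Rightarrow> (int \<Rightarrow> 'i \<Rightarrow> 'i \<Rightarrow> 'a) \<Rightarrow>
    (int \<Rightarrow> 'i \<Rightarrow> 'i \<Rightarrow> 'a) \<Rightarrow> int \<Rightarrow> bool" where
  "contracting A T B m s k \<longleftrightarrow> (\<forall>b\<in>B k. s k b \<in> vec A T (B (k + 1)) \<and>
     vadd A (lin A (m (k + 1)) (s k b)) (lin A (s (k - 1)) (m k b)) = unit_vec A b)"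

text \<open>The entries of the boundary matrices lie in the subring \<open>S\<close>; exactness is later compared over
the rings between \<open>S\<close> and \<open>A\<close>.\<close>

locale matrix_complex = ring A for A :: "('a, 'x) ring_scheme" (structure) +
  fixes S :: "'a set" and B :: "int \<Rightarrow> 'i set" and m :: "int \<Rightarrow> 'i \<Rightarrow> 'i \<Rightarrow> 'a"
  assumes subring_S: "subring S A"
    and boundary_vec: "b \<in> B k \<Longrightarrow> m k b \<in> vec A S (B (k - 1))"
    and boundary_boundary: "b \<in> B k \<Longrightarrow> lin A (m (k - 1)) (m k b) = (\<lambda>_. \<zero>)"
    and empty_below: "k < 0 \<Longrightarrow> B k = {}"
begin

lemma boundary_vec_mono: "\<lbrakk>b \<in> B k; S \<subseteq> T\<rbrakk> \<Longrightarrow> m k b \<in> vec A T (B (k - 1))"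
  by (rule vec_mono[OF boundary_vec]) auto

lemma boundary_vec_Suc: "\<lbrakk>b \<in> B (k + 1); S \<subseteq> T\<rbrakk> \<Longrightarrow> m (k + 1) b \<in> vec A T (B k)"
  using boundary_vec_mono[of b "k + 1" T] by simp

lemma S_carrier: "S \<subseteq> carrier A" by (rule subringE(1)[OF subring_S])

lemma lin_boundary_boundary:
  assumes "x \<in> vec A (carrier A) (B k)"
  shows "lin A (m (k - 1)) (lin A (m k) x) = (\<lambda>_. \<zero>)"
proof -
  have "lin A (m (k - 1)) (lin A (m k) x) = lin A (\<lambda>b. lin A (m (k - 1)) (m k b)) x"
    by (rule lin_lin[OF assms]) (auto intro!: boundary_vec_mono S_carrier)
  also have "\<dots> = lin A (\<lambda>b _. \<zero>) x"
    by (rule lin_cong'[OF assms]) (auto simp: boundary_boundary intro: zero_vec carrier_is_subring)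
  also have "\<dots> = (\<lambda>_. \<zero>)"
    unfolding lin_def using vecD(1)[OF assms] by (intro ext add.finprod_one_eqI) auto
  finally show ?thesis .
qed

text \<open>The usual inductive step: \<open>e - s (d e)\<close> is a cycle for every basis vector \<open>e\<close> because \<open>s\<close> is contracting one
degree below, and a preimage of it under the boundary map is a legitimate value of the contraction at \<open>e\<close>.\<close>

lemma contraction_extend:
  assumes T: "subring T A" "S \<subseteq> T"
    and ex: "exact_at A T B m k"
    and s: "contracting A T B m s (k - 1)" "contracting A T B m s (k - 2)"
  shows "\<exists>t. contracting A T B m (s(k := t)) k"
proof -
  have TA: "T \<subseteq> carrier A" by (rule subringE(1)[OF T(1)])
  have sk: "\<And>b. b \<in> B (k - 1) \<Longrightarrow> s (k - 1) b \<in> vec A T (B k)"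
    using s(1) by (auto simp: contracting_def)
  have sk2: "\<And>b. b \<in> B (k - 2) \<Longrightarrow> s (k - 2) b \<in> vec A T (B (k - 1))"
    using s(2) by (auto simp: contracting_def)
  have car: "\<And>x B. x \<in> vec A T B \<Longrightarrow> x \<in> vec A (carrier A) B" using TA by (auto intro: vec_mono)
  have "\<exists>y\<in>vec A T (B (k + 1)). lin A (m (k + 1)) y = vdiff A (unit_vec A b) (lin A (s (k - 1)) (m k b))"
    if b: "b \<in> B k" for b
  proof -
    let ?c = "lin A (s (k - 1)) (m k b)"
    have mb: "m k b \<in> vec A T (B (k - 1))" by (rule boundary_vec_mono[OF b T(2)])
    have c: "?c \<in> vec A T (B k)" by (rule lin_vec[OF T(1) mb sk])
    have u: "unit_vec A b \<in> vec A T (B k)" by (rule unit_vec_vec[OF T(1) b])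
    have mk: "\<And>c. c \<in> B k \<Longrightarrow> m k c \<in> vec A (carrier A) (B (k - 1))"
      "\<And>c. c \<in> B (k - 1) \<Longrightarrow> m (k - 1) c \<in> vec A (carrier A) (B (k - 2))"
      using boundary_vec_mono[OF _ S_carrier, of _ k] boundary_vec_mono[OF _ S_carrier, of _ "k - 1"] by auto
    have eq: "lin A (m k) (s (k - 1) c) = vdiff A (unit_vec A c) (lin A (s (k - 2)) (m (k - 1) c))"
      if c: "c \<in> B (k - 1)" for c
    proof -
      have e: "vadd A (lin A (m k) (s (k - 1) c)) (lin A (s (k - 2)) (m (k - 1) c)) = unit_vec A c"
        using s(1) c by (simp add: contracting_def)
      have "lin A (m k) (s (k - 1) c) \<in> vec A (carrier A) (B (k - 1))"
        by (rule lin_vec[OF carrier_is_subring car[OF sk[OF c]] mk(1)])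
      moreover have "lin A (s (k - 2)) (m (k - 1) c) \<in> vec A (carrier A) (B (k - 1))"
        by (rule lin_vec[OF carrier_is_subring mk(2)[OF c] car[OF sk2]])
      ultimately show ?thesis unfolding e[symmetric] by (rule vadd_vdiff_cancel(2)[symmetric])
    qed
    have s2m: "lin A (s (k - 2)) (m (k - 1) c) \<in> vec A (carrier A) (B (k - 1))" if "c \<in> B (k - 1)" for c
      by (rule lin_vec[OF carrier_is_subring mk(2)[OF that] car[OF sk2]])
    have z: "lin A (s (k - 2)) (\<lambda>_. \<zero>) = (\<lambda>_. \<zero>)"
      by (simp add: lin_def)
    have "lin A (m k) ?c = lin A (\<lambda>c. lin A (m k) (s (k - 1) c)) (m k b)"
      by (rule lin_lin[OF mk(1)[OF b] car[OF sk] mk(1)])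
    also have "\<dots> = lin A (\<lambda>c. vdiff A (unit_vec A c) (lin A (s (k - 2)) (m (k - 1) c))) (m k b)"
      by (rule lin_cong'[OF mk(1)[OF b] eq])
        (auto intro!: vdiff_vec[OF carrier_is_subring] unit_vec_vec carrier_is_subring s2m)
    also have "\<dots> = vdiff A (lin A (unit_vec A) (m k b)) (lin A (\<lambda>c. lin A (s (k - 2)) (m (k - 1) c)) (m k b))"
      by (rule lin_matrix_vdiff[OF mk(1)[OF b] _ s2m]) (auto intro: unit_vec_vec carrier_is_subring)
    also have "lin A (\<lambda>c. lin A (s (k - 2)) (m (k - 1) c)) (m k b) = lin A (s (k - 2)) (lin A (m (k - 1)) (m k b))"
      by (rule lin_lin[OF mk(1)[OF b] mk(2) car[OF sk2], symmetric])
    also have "\<dots> = (\<lambda>_. \<zero>)" using boundary_boundary[OF b] z by simp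
    also have "lin A (unit_vec A) (m k b) = m k b" by (rule lin_unit_matrix[OF mk(1)[OF b]])
    finally have mc: "lin A (m k) ?c = m k b"
      using vecD(1)[OF mk(1)[OF b]] by (simp add: vdiff_def a_minus_def)
    have "lin A (m k) (vdiff A (unit_vec A b) ?c) = vdiff A (lin A (m k) (unit_vec A b)) (lin A (m k) ?c)"
      by (rule lin_vdiff[OF car[OF u] car[OF c] mk(1)])
    also have "\<dots> = (\<lambda>_. \<zero>)"
      using mc lin_unit_vec[OF b mk(1)] vecD(1)[OF mk(1)[OF b]] by (simp add: vdiff_def a_minus_def r_neg)
    finally show ?thesis
      using ex vdiff_vec[OF T(1) u c] unfolding exact_at_def by blast
  qed
  then obtain t where t: "\<And>b. b \<in> B k \<Longrightarrow> t b \<in> vec A T (B (k + 1))"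
    "\<And>b. b \<in> B k \<Longrightarrow> lin A (m (k + 1)) (t b) = vdiff A (unit_vec A b) (lin A (s (k - 1)) (m k b))"
    by metis
  have "contracting A T B m (s(k := t)) k"
    unfolding contracting_def
  proof (intro ballI conjI)
    fix b assume b: "b \<in> B k"
    have "lin A (s (k - 1)) (m k b) \<in> vec A (carrier A) (B k)"
      by (rule car[OF lin_vec[OF T(1) boundary_vec_mono[OF b T(2)] sk]])
    moreover have "unit_vec A b \<in> vec A (carrier A) (B k)" by (rule unit_vec_vec[OF carrier_is_subring b])
    ultimately show "vadd A (lin A (m (k + 1)) ((s(k := t)) k b)) (lin A ((s(k := t)) (k - 1)) (m k b)) = unit_vec A b"
      using t(2)[OF b] vadd_vdiff_cancel(1) by fastforce
  qed (use t(1) in auto)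
  then show ?thesis by blast
qed

text \<open>The induction starts in negative degrees, where there is nothing to contract.\<close>

lemma contraction_exists:
  assumes T: "subring T A" "S \<subseteq> T"
    and ex: "\<And>k. k \<le> int n \<Longrightarrow> exact_at A T B m k"
  shows "\<exists>s. \<forall>k\<le>int n. contracting A T B m s k"
proof -
  have "\<exists>s. \<forall>k<int p. contracting A T B m s k" if "p \<le> n + 1" for p
    using that
  proof (induction p)
    case 0
    show ?case by (simp add: contracting_def empty_below)
  next
    case (Suc p)
    then obtain s where s: "\<forall>k<int p. contracting A T B m s k" by auto
    have "exact_at A T B m (int p)" using Suc.prems ex by auto
    from contraction_extend[OF T this] s obtain t where t: "contracting A T B m (s(int p := t)) (int p)"
      by force
    have "contracting A T B m (s(int p := t)) k" if "k < int p" for k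
      using s that by (simp add: contracting_def)
    with t have "contracting A T B m (s(int p := t)) k" if "k < int (Suc p)" for k
      using that by (cases "k = int p") auto
    then show ?case by blast
  qed
  from this[of "n + 1"] obtain s where "\<forall>k<int (n + 1). contracting A T B m s k" by auto
  then show ?thesis by (intro exI[of _ s]) auto
qed

lemma contracting_imp_exact_at:
  assumes s: "contracting A T B m s k" "contracting A T B m s (k - 1)"
    and T: "T \<subseteq> T'" "subring T' A" "S \<subseteq> T'"
  shows "exact_at A T' B m k"
  unfolding exact_at_def
proof (intro ballI impI)
  fix x assume x: "x \<in> vec A T' (B k)" and mx: "lin A (m k) x = (\<lambda>_. \<zero>)"
  have car: "\<And>x B. x \<in> vec A T' B \<Longrightarrow> x \<in> vec A (carrier A) B" 
    using subringE(1)[OF T(2)] by (auto intro: vec_mono)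
  have sk: "\<And>b. b \<in> B k \<Longrightarrow> s k b \<in> vec A T' (B (k + 1))"
    using s(1) T(1) by (auto simp: contracting_def intro: vec_mono)
  have sk1: "\<And>b. b \<in> B (k - 1) \<Longrightarrow> s (k - 1) b \<in> vec A T' (B k)"
    using s(2) T(1) by (auto simp: contracting_def intro: vec_mono)
  note mk = boundary_vec_mono[OF _ S_carrier, of _ k] and mk1 = boundary_vec_Suc[OF _ S_carrier, of _ k]
  have y: "lin A (s k) x \<in> vec A T' (B (k + 1))" by (rule lin_vec[OF T(2) x sk])
  have "x = lin A (unit_vec A) x" by (rule lin_unit_matrix[OF car[OF x], symmetric])
  also have "\<dots> = lin A (\<lambda>b. vadd A (lin A (m (k + 1)) (s k b)) (lin A (s (k - 1)) (m k b))) x"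
    by (rule lin_cong'[OF car[OF x], symmetric])
      (use s(1) in \<open>auto simp: contracting_def intro: unit_vec_vec carrier_is_subring\<close>)
  also have "\<dots> = vadd A (lin A (\<lambda>b. lin A (m (k + 1)) (s k b)) x) (lin A (\<lambda>b. lin A (s (k - 1)) (m k b)) x)"
    by (rule lin_matrix_vadd[OF car[OF x]])
      (auto intro!: lin_vec[OF carrier_is_subring] car[OF sk] car[OF sk1] mk mk1)
  also have "lin A (\<lambda>b. lin A (m (k + 1)) (s k b)) x = lin A (m (k + 1)) (lin A (s k) x)"
    by (rule lin_lin[OF car[OF x] car[OF sk] mk1, symmetric])
  also have "lin A (\<lambda>b. lin A (s (k - 1)) (m k b)) x = lin A (s (k - 1)) (lin A (m k) x)"
    by (rule lin_lin[OF car[OF x] mk car[OF sk1], symmetric])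
  also have "\<dots> = (\<lambda>_. \<zero>)" by (simp add: mx) (simp add: lin_def)
  also have "vadd A (lin A (m (k + 1)) (lin A (s k) x)) (\<lambda>_. \<zero>) = lin A (m (k + 1)) (lin A (s k) x)"
    using vecD(1)[OF lin_vec[OF carrier_is_subring car[OF y] mk1]] by (simp add: vadd_def)
  finally show "\<exists>y\<in>vec A T' (B (k + 1)). lin A (m (k + 1)) y = x" using y by metis
qed

end

section \<open>Complete filtered rings\<close>

text \<open>A decreasing, exhaustive, separated and complete filtration.  Completeness is stated only for sequences whose
steps decay linearly, as those of a geometric series do; the bound at \<open>i = 0\<close> also places the limit relative to
the first term of the sequence.\<close>

locale complete_filtered_ring = ring A for A :: "('a, 'x) ring_scheme" (structure) +
  fixes F :: "real \<Rightarrow> 'a set"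
  assumes filt_subgroup: "subgroup (F s) (add_monoid A)"
    and filt_antimono: "s \<le> t \<Longrightarrow> F t \<subseteq> F s"
    and filt_mult: "\<lbrakk>a \<in> F s; b \<in> F t\<rbrakk> \<Longrightarrow> a \<otimes> b \<in> F (s + t)"
    and filt_one: "\<one> \<in> F 0"
    and filt_exhaustive: "a \<in> carrier A \<Longrightarrow> \<exists>s. a \<in> F s"
    and filt_separated: "(\<And>s. a \<in> F s) \<Longrightarrow> a = \<zero>"
    and filt_complete: "\<lbrakk>\<delta> > 0; \<And>i::nat. p i \<in> carrier A; \<And>i. p (Suc i) \<ominus> p i \<in> F (real i * \<delta>)\<rbrakk> \<Longrightarrow>
      \<exists>b\<in>carrier A. \<forall>i. b \<ominus> p i \<in> F (real i * \<delta>)"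
begin

lemma filt_carrier: "a \<in> F s \<Longrightarrow> a \<in> carrier A"
  using subgroup.subset[OF filt_subgroup] by auto

lemma filt_zero: "\<zero> \<in> F s"
  using subgroup.one_closed[OF filt_subgroup] by simp

lemma filt_add: "\<lbrakk>a \<in> F s; b \<in> F s\<rbrakk> \<Longrightarrow> a \<oplus> b \<in> F s"
  using subgroup.m_closed[OF filt_subgroup] by simp

lemma filt_minus: "a \<in> F s \<Longrightarrow> \<ominus> a \<in> F s"
  using subgroup.m_inv_closed[OF filt_subgroup] by (simp add: a_inv_def)

lemma filt_diff: "\<lbrakk>a \<in> F s; b \<in> F s\<rbrakk> \<Longrightarrow> a \<ominus> b \<in> F s"
  unfolding a_minus_def by (intro filt_add filt_minus)

lemma filt_finsum:
  assumes "\<And>b. b \<in> K \<Longrightarrow> f b \<in> F s"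
  shows "(\<Oplus>b\<in>K. f b) \<in> F s"
  using assms
proof (induction K rule: infinite_finite_induct)
  case (insert x K)
  then have "f x \<in> F s" "\<And>b. b \<in> K \<Longrightarrow> f b \<in> F s" by auto
  with insert show ?case
    by (subst finsum_insert) (auto intro: filt_add filt_carrier)
qed (auto intro: filt_zero)

lemma filt_multiple:
  assumes "\<delta> > 0" "\<And>i::nat. a \<in> F (s + real i * \<delta>)"
  shows "a = \<zero>"
proof (rule filt_separated)
  fix t
  obtain i :: nat where "t - s < real i * \<delta>" using reals_Archimedean3[OF assms(1)] by blast
  then have "t \<le> s + real i * \<delta>" by simp
  from filt_antimono[OF this] assms(2) show "a \<in> F t" by blast
qed

lemma filt_finite_bounded:
  assumes "finite Y" "Y \<subseteq> carrier A"
  shows "\<exists>s. Y \<subseteq> F s"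
  using assms
proof (induction Y rule: finite_induct)
  case (insert a Y)
  then obtain s where "Y \<subseteq> F s" by auto
  moreover obtain t where "a \<in> F t" using insert.prems filt_exhaustive[of a] by auto
  ultimately have "insert a Y \<subseteq> F (min s t)"
    using filt_antimono[of "min s t" s] filt_antimono[of "min s t" t] by auto
  then show ?case ..
qed auto

text \<open>The ideal of \<open>F 0\<close> consisting of the elements of strictly positive filtration.\<close>

definition pos :: "'a set" where
  "pos = (\<Union>\<delta>\<in>{0<..}. F \<delta>)"

lemma pos_finite_bounded:
  assumes "finite Y" "Y \<subseteq> pos"
  shows "\<exists>\<delta>>0. Y \<subseteq> F \<delta>"
  using assms
proof (induction Y rule: finite_induct)
  case empty
  show ?case by (auto intro: exI[of _ 1])
next
  case (insert a Y)
  then obtain s where "s > 0" "Y \<subseteq> F s" by auto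
  moreover obtain t where "t > 0" "a \<in> F t" using insert.prems by (auto simp: pos_def)
  ultimately have "min s t > 0 \<and> insert a Y \<subseteq> F (min s t)"
    using filt_antimono[of "min s t" s] filt_antimono[of "min s t" t] by auto
  then show ?case by blast
qed

lemma posI: "\<lbrakk>a \<in> F \<delta>; \<delta> > 0\<rbrakk> \<Longrightarrow> a \<in> pos"
  by (auto simp: pos_def)

lemma posE:
  assumes "a \<in> pos"
  obtains \<delta> where "\<delta> > 0" "a \<in> F \<delta>"
  using assms by (auto simp: pos_def)

lemma pos_carrier: "a \<in> pos \<Longrightarrow> a \<in> carrier A"
  by (elim posE filt_carrier)

lemma pos_add:
  assumes "a \<in> pos" "b \<in> pos"
  shows "a \<oplus> b \<in> pos"
proof -
  obtain \<delta> where "\<delta> > 0" "{a, b} \<subseteq> F \<delta>" using pos_finite_bounded[of "{a, b}"] assms by auto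
  then show ?thesis by (intro posI[of _ \<delta>] filt_add) simp_all
qed

lemma pos_mult_filt_zero:
  assumes "a \<in> pos" "b \<in> F 0"
  shows "a \<otimes> b \<in> pos"
proof -
  obtain \<delta> where "\<delta> > 0" "a \<in> F \<delta>" using assms(1) by (rule posE)
  with filt_mult[OF this(2) assms(2)] show ?thesis by (intro posI[of _ \<delta>]) simp_all
qed

lemma pos_filt_zero:
  assumes "a \<in> pos"
  shows "a \<in> F 0"
proof -
  obtain \<delta> where "\<delta> > 0" "a \<in> F \<delta>" using assms by (rule posE)
  with filt_antimono[of 0 \<delta>] show ?thesis by auto
qed

text \<open>The inverse is the limit \<open>b\<close> of the partial sums of the powers of \<open>a\<close>: the product of \<open>1 - a\<close> with the \<open>i\<close>-th partial sum
differs from \<open>1\<close> by the \<open>i\<close>-th power of \<open>a\<close>, so its product with \<open>b\<close> differs from \<open>1\<close> by an element of every step of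
the filtration.  That \<open>b\<close> lies in \<open>F 0\<close> keeps the entries positive during Gaussian elimination.\<close>

lemma geometric_series_inverse:
  assumes a: "a \<in> pos"
  shows "\<exists>b\<in>F 0. (\<one> \<ominus> a) \<otimes> b = \<one> \<and> b \<otimes> (\<one> \<ominus> a) = \<one>"
proof -
  obtain \<delta> where \<delta>: "\<delta> > 0" "a \<in> F \<delta>" using a by (auto simp: pos_def)
  have ac: "a \<in> carrier A" by (rule pos_carrier[OF a])
  have pw: "a [^] i \<in> F (real i * \<delta>)" for i :: nat
  proof (induction i)
    case (Suc i)
    from filt_mult[OF this \<delta>(2)] show ?case by (simp add: algebra_simps)
  qed (simp add: filt_one)
  define p where "p i = (\<Oplus>j\<in>{..<i}. a [^] j)" for i :: nat
  have pc: "p i \<in> carrier A" for i using ac by (auto simp: p_def intro!: finsum_closed)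
  have pS: "p (Suc i) = a [^] i \<oplus> p i" for i
    unfolding p_def using ac by (simp add: lessThan_Suc finsum_insert Pi_def)
  have dif: "p (Suc i) \<ominus> p i = a [^] i" for i
    using ac pc[of i] by (simp add: pS a_minus_def a_assoc r_neg)
  have "\<exists>b\<in>carrier A. \<forall>i. b \<ominus> p i \<in> F (real i * \<delta>)"
    using \<delta>(1) pc pw by (intro filt_complete) (simp_all add: dif)
  then obtain b where b: "b \<in> carrier A" "\<And>i. b \<ominus> p i \<in> F (real i * \<delta>)" by blast
  have u: "\<one> \<ominus> a \<in> carrier A" "\<one> \<ominus> a \<in> F 0"
    using ac pos_filt_zero[OF a] filt_one by (auto intro: filt_diff)
  have tel: "(\<one> \<ominus> a) \<otimes> p i = \<one> \<ominus> a [^] i \<and> p i \<otimes> (\<one> \<ominus> a) = \<one> \<ominus> a [^] i" for i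
  proof (induction i)
    case 0
    show ?case using u(1) by (simp add: p_def a_minus_def r_neg)
  next
    case (Suc i)
    have l: "(\<one> \<ominus> a) \<otimes> a [^] i = a [^] i \<ominus> a [^] Suc i" "a [^] i \<otimes> (\<one> \<ominus> a) = a [^] i \<ominus> a [^] Suc i"
      using ac nat_pow_Suc2[OF ac, of i] by (simp_all add: a_minus_def l_distr r_distr l_minus r_minus)
    have "a [^] i \<ominus> a [^] Suc i \<oplus> (\<one> \<ominus> a [^] i) = \<one> \<ominus> a [^] Suc i"
      using ac by (simp add: a_minus_def a_ac r_neg1 r_neg2 del: nat_pow_Suc)
    with l Suc ac u pc[of i] show ?case by (simp add: pS l_distr r_distr del: nat_pow_Suc)
  qed
  have "b \<ominus> p 0 \<in> F 0" using b(2)[of 0] by simp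
  then have b0: "b \<in> F 0" using b(1) by (simp add: p_def a_minus_def)
  have key: "x = \<one>" if "x \<in> carrier A" "\<And>i. x \<ominus> (\<one> \<ominus> a [^] i) \<in> F (real i * \<delta>)" for x
  proof -
    have "x \<ominus> \<one> \<in> F (0 + real i * \<delta>)" for i
    proof -
      have "x \<ominus> \<one> = (x \<ominus> (\<one> \<ominus> a [^] i)) \<ominus> a [^] i"
      proof -
        have "a [^] i \<oplus> (\<ominus> \<one> \<oplus> \<ominus> (a [^] i)) = \<ominus> \<one>"
          using ac a_lcomm[of "a [^] i" "\<ominus> \<one>" "\<ominus> (a [^] i)"] by (simp add: r_neg)
        then show ?thesis using that(1) ac by (simp add: a_minus_def minus_add a_ac)
      qed
      with filt_diff[OF that(2)[of i] pw[of i]] show ?thesis by simp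
    qed
    from filt_multiple[OF \<delta>(1) this] that(1) show ?thesis
      by (metis one_closed r_right_minus_eq)
  qed
  have diff_distr: "w \<otimes> (x \<ominus> y) = w \<otimes> x \<ominus> w \<otimes> y" "(x \<ominus> y) \<otimes> w = x \<otimes> w \<ominus> y \<otimes> w"
    if "w \<in> carrier A" "x \<in> carrier A" "y \<in> carrier A" for w x y
    using that by (simp_all add: a_minus_def l_distr r_distr l_minus r_minus)
  have "(\<one> \<ominus> a) \<otimes> b \<ominus> (\<one> \<ominus> a [^] i) \<in> F (real i * \<delta>)" for i
  proof -
    have "(\<one> \<ominus> a) \<otimes> b \<ominus> (\<one> \<ominus> a [^] i) = (\<one> \<ominus> a) \<otimes> (b \<ominus> p i)"
      using u(1) b(1) pc[of i] tel[of i] by (simp add: diff_distr)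
    with filt_mult[OF u(2) b(2)[of i]] show ?thesis by simp
  qed
  then have l: "(\<one> \<ominus> a) \<otimes> b = \<one>" using key u b(1) by simp
  have "b \<otimes> (\<one> \<ominus> a) \<ominus> (\<one> \<ominus> a [^] i) \<in> F (real i * \<delta>)" for i
  proof -
    have "b \<otimes> (\<one> \<ominus> a) \<ominus> (\<one> \<ominus> a [^] i) = (b \<ominus> p i) \<otimes> (\<one> \<ominus> a)"
      using u(1) b(1) pc[of i] tel[of i] by (simp add: diff_distr)
    with filt_mult[OF b(2)[of i] u(2)] show ?thesis by simp
  qed
  then have "b \<otimes> (\<one> \<ominus> a) = \<one>" using key u b(1) by simp
  with l b0 show ?thesis by blast
qed

text \<open>Gaussian elimination for the system \<open>(1 - e) y = x\<close>.  The pivot \<open>1 - e q q\<close> is a unit of \<open>A\<close> by the geometric series,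
and its inverse \<open>v\<close> lies in \<open>D\<close>.  Eliminating the unknown \<open>y q\<close> changes the remaining coefficients to
\<open>e j i + e q i v e j q\<close>, which are again positive elements of \<open>D\<close>, so that the same argument applies to the smaller system.
The matrix \<open>1 - e\<close> is thus inverted over \<open>D\<close> with inverses of single elements of \<open>D\<close>.\<close>

lemma solve_one_minus_pos:
  assumes D: "subring D A" and inv: "\<And>a. \<lbrakk>a \<in> D; a \<in> Units A\<rbrakk> \<Longrightarrow> inv a \<in> D"
    and B: "finite B"
    and e: "\<And>i j. \<lbrakk>i \<in> B; j \<in> B\<rbrakk> \<Longrightarrow> e j i \<in> D \<inter> pos"
    and x: "\<And>i. i \<in> B \<Longrightarrow> x i \<in> D"
  shows "\<exists>y. (\<forall>i\<in>B. y i \<in> D) \<and> (\<forall>i\<in>B. y i = x i \<oplus> (\<Oplus>j\<in>B. e j i \<otimes> y j))"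
  using B e x
proof (induction B arbitrary: e x rule: finite_induct)
  case empty
  show ?case by simp
next
  case (insert q B)
  note sub = subringE[OF D]
  have epp: "e q q \<in> D" "e q q \<in> pos" using insert.prems(1)[of q q] by auto
  obtain v where v: "v \<in> F 0" "(\<one> \<ominus> e q q) \<otimes> v = \<one>" "v \<otimes> (\<one> \<ominus> e q q) = \<one>"
    using geometric_series_inverse[OF epp(2)] by blast
  have "\<one> \<ominus> e q q \<in> D" using epp sub by (auto simp: a_minus_def)
  moreover have "\<one> \<ominus> e q q \<in> Units A"
    using v filt_carrier[OF v(1)] calculation sub(1) by (auto simp: Units_def)
  moreover have "inv (\<one> \<ominus> e q q) = v"
    using v filt_carrier[OF v(1)] calculation(1) sub(1) by (intro inv_unique'[symmetric]) auto
  ultimately have vD: "v \<in> D" using inv by metis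
  have eD: "\<And>i j. i \<in> insert q B \<Longrightarrow> j \<in> insert q B \<Longrightarrow> e j i \<in> D" using insert.prems(1) by auto
  have eP: "\<And>i j. i \<in> insert q B \<Longrightarrow> j \<in> insert q B \<Longrightarrow> e j i \<in> pos" using insert.prems(1) by auto
  \<comment> \<open>The coefficients and the right-hand sides of the system with the unknown \<open>y q\<close> eliminated.\<close>
  define e' where "e' j i = e j i \<oplus> e q i \<otimes> v \<otimes> e j q" for i j
  define x' where "x' i = x i \<oplus> e q i \<otimes> v \<otimes> x q" for i
  have "e' j i \<in> D \<inter> pos" if "i \<in> B" "j \<in> B" for i j
    using that eD[of i j] eD[of i q] eD[of q j] eP[of i j] eP[of i q] eP[of q j] vD sub(6,7) v(1)
    by (auto simp: e'_def intro!: pos_add pos_mult_filt_zero pos_filt_zero)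
  moreover have "x' i \<in> D" if "i \<in> B" for i
    using that insert.prems(2)[of i] insert.prems(2)[of q] eD[of i q] vD sub(6,7) by (auto simp: x'_def)
  ultimately obtain y where y: "\<And>i. i \<in> B \<Longrightarrow> y i \<in> D"
    "\<And>i. i \<in> B \<Longrightarrow> y i = x' i \<oplus> (\<Oplus>j\<in>B. e' j i \<otimes> y j)"
    using insert.IH[of e' x'] by blast
  define t where "t = (\<Oplus>j\<in>B. e j q \<otimes> y j)"
  define y' where "y' = y(q := v \<otimes> (x q \<oplus> t))"
  have car: "\<And>i. i \<in> B \<Longrightarrow> y i \<in> carrier A" "\<And>i j. i \<in> insert q B \<Longrightarrow> j \<in> insert q B \<Longrightarrow> e j i \<in> carrier A"
    "\<And>i. i \<in> insert q B \<Longrightarrow> x i \<in> carrier A" "v \<in> carrier A"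
    using y(1) eD insert.prems(2) vD sub(1) by blast+
  have eB: "\<And>i j. i \<in> B \<Longrightarrow> j \<in> B \<Longrightarrow> e j i \<in> carrier A" "\<And>i. i \<in> B \<Longrightarrow> e i q \<in> carrier A"
    "\<And>i. i \<in> B \<Longrightarrow> e q i \<in> carrier A" "e q q \<in> carrier A" and xq: "x q \<in> carrier A"
    using car by auto
  have tD: "t \<in> D" unfolding t_def using eD y(1) sub(6) by (intro subring_closed_finsum[OF D]) auto
  then have tc: "t \<in> carrier A" using sub(1) by auto
  have sum: "(\<Oplus>j\<in>insert q B. e j i \<otimes> y' j) = e q i \<otimes> y' q \<oplus> (\<Oplus>j\<in>B. e j i \<otimes> y j)" if "i \<in> insert q B" for i
  proof -
    have "(\<Oplus>j\<in>B. e j i \<otimes> y' j) = (\<Oplus>j\<in>B. e j i \<otimes> y j)"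
      using car that insert.hyps by (intro finsum_cong') (auto simp: y'_def)
    then show ?thesis using car that insert.hyps tc
      by (subst finsum_insert) (auto simp: y'_def)
  qed
  show ?case
  proof (intro exI[of _ y'] conjI ballI)
    fix i assume "i \<in> insert q B"
    then show "y' i \<in> D"
      using y(1) vD tD insert.prems(2)[of q] sub(6,7) by (auto simp: y'_def)
  next
    fix i assume i: "i \<in> insert q B"
    show "y' i = x i \<oplus> (\<Oplus>j\<in>insert q B. e j i \<otimes> y' j)"
    proof (cases "i = q")
      case True
      have yq: "y' q \<in> carrier A" "y' q = v \<otimes> (x q \<oplus> t)" using car tc by (auto simp: y'_def)
      have "(\<one> \<ominus> e q q) \<otimes> y' q = (\<one> \<ominus> e q q) \<otimes> v \<otimes> (x q \<oplus> t)"
        unfolding yq(2) using car(4) eB(4) xq tc by (intro m_assoc[symmetric]) auto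
      also have "\<dots> = x q \<oplus> t" using v(2) xq tc by simp
      finally have "y' q \<ominus> e q q \<otimes> y' q = x q \<oplus> t"
        using yq(1) eB(4) by (simp add: a_minus_def l_distr l_minus)
      then have "y' q = x q \<oplus> t \<oplus> e q q \<otimes> y' q"
        using yq(1) eB(4) by (metis add.inv_solve_right m_closed xq tc a_closed a_minus_def)
      then show ?thesis using True sum[OF i] yq(1) eB(4) xq tc
        by (simp add: t_def[symmetric] a_ac)
    next
      case False
      then have iB: "i \<in> B" using i by simp
      have "y' i = x' i \<oplus> (\<Oplus>j\<in>B. e' j i \<otimes> y j)" using y(2)[OF iB] False by (simp add: y'_def)
      also have "(\<Oplus>j\<in>B. e' j i \<otimes> y j) = (\<Oplus>j\<in>B. e j i \<otimes> y j \<oplus> e q i \<otimes> v \<otimes> (e j q \<otimes> y j))"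
        using car(1,4) eB iB by (intro finsum_cong') (auto simp: e'_def l_distr m_assoc)
      also have "\<dots> = (\<Oplus>j\<in>B. e j i \<otimes> y j) \<oplus> (\<Oplus>j\<in>B. e q i \<otimes> v \<otimes> (e j q \<otimes> y j))"
        using car(1,4) eB iB by (intro finsum_addf) auto
      also have "(\<Oplus>j\<in>B. e q i \<otimes> v \<otimes> (e j q \<otimes> y j)) = e q i \<otimes> v \<otimes> t"
        unfolding t_def using car(1,4) eB iB insert.hyps(1) by (intro finsum_rdistr[symmetric]) auto
      also have "x' i \<oplus> ((\<Oplus>j\<in>B. e j i \<otimes> y j) \<oplus> e q i \<otimes> v \<otimes> t) =
        x i \<oplus> (e q i \<otimes> (v \<otimes> (x q \<oplus> t)) \<oplus> (\<Oplus>j\<in>B. e j i \<otimes> y j))"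
      proof -
        have "(\<Oplus>j\<in>B. e j i \<otimes> y j) \<in> carrier A" using car(1) eB iB by (intro finsum_closed) auto
        then show ?thesis
          using car(3)[OF i] car(4) eB iB xq tc by (simp add: x'_def r_distr m_assoc a_ac)
      qed
      also have "\<dots> = x i \<oplus> (\<Oplus>j\<in>insert q B. e j i \<otimes> y' j)"
        using sum[OF i] by (simp add: y'_def)
      finally show ?thesis .
    qed
  qed
qed

text \<open>If \<open>e\<close> has filtration at least \<open>\<delta> > 0\<close> then \<open>y = e y\<close> raises the filtration of \<open>y\<close> by \<open>\<delta>\<close>, again and again.\<close>

lemma one_minus_pos_injective:
  assumes B: "finite B"
    and e: "\<And>i j. \<lbrakk>i \<in> B; j \<in> B\<rbrakk> \<Longrightarrow> e j i \<in> pos"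
    and y: "\<And>i. i \<in> B \<Longrightarrow> y i \<in> carrier A"
    and eq: "\<And>i. i \<in> B \<Longrightarrow> y i = (\<Oplus>j\<in>B. e j i \<otimes> y j)"
    and i: "i \<in> B"
  shows "y i = \<zero>"
proof -
  have "\<exists>\<delta>>0. (\<lambda>(i, j). e j i) ` (B \<times> B) \<subseteq> F \<delta>" using B e by (intro pos_finite_bounded) auto
  then obtain \<delta> where \<delta>: "\<delta> > 0" "\<And>i j. \<lbrakk>i \<in> B; j \<in> B\<rbrakk> \<Longrightarrow> e j i \<in> F \<delta>" by auto
  have "\<exists>s. y ` B \<subseteq> F s" using B y by (intro filt_finite_bounded) auto
  then obtain s where s: "y ` B \<subseteq> F s" ..
  have "\<forall>i\<in>B. y i \<in> F (s + real k * \<delta>)" for k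
  proof (induction k)
    case 0
    show ?case using s by auto
  next
    case (Suc k)
    have "(\<Oplus>j\<in>B. e j i \<otimes> y j) \<in> F (\<delta> + (s + real k * \<delta>))" if "i \<in> B" for i
      using that \<delta>(2) Suc by (intro filt_finsum filt_mult) auto
    then show ?case using eq by (simp add: algebra_simps)
  qed
  with filt_multiple[OF \<delta>(1)] i show ?thesis by blast
qed

end

section \<open>Approximating a contraction over a dense subring\<close>

locale filtered_matrix_complex =
  complete_filtered_ring A F + matrix_complex A S B m
  for A :: "('a, 'x) ring_scheme" (structure) and F S
    and B :: "int \<Rightarrow> 'i set" and m +
  assumes dense: "a \<in> carrier A \<Longrightarrow> \<exists>a'\<in>S. a \<ominus> a' \<in> F t"
begin

lemma truncate_vec:
  assumes "x \<in> vec A (carrier A) K"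
  shows "\<exists>x'\<in>vec A S K. (\<forall>i. x i \<ominus> x' i \<in> F t) \<and> {i. x' i \<noteq> \<zero>} \<subseteq> {i. x i \<noteq> \<zero>}"
proof -
  have "\<exists>a\<in>S. x i \<ominus> a \<in> F t \<and> (x i = \<zero> \<longrightarrow> a = \<zero>)" for i
  proof (cases "x i = \<zero>")
    case True
    then show ?thesis using subringE(2)[OF subring_S] by (auto simp: a_minus_def intro: filt_zero bexI[of _ \<zero>])
  next
    case False
    then show ?thesis using dense vecD(1)[OF assms] by blast
  qed
  then obtain x' where x': "\<And>i. x' i \<in> S" "\<And>i. x i \<ominus> x' i \<in> F t" "\<And>i. x i = \<zero> \<Longrightarrow> x' i = \<zero>" by metis
  then have sup: "{i. x' i \<noteq> \<zero>} \<subseteq> {i. x i \<noteq> \<zero>}" by auto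
  moreover have "x' \<in> vec A S K"
    using x' finite_subset[OF sup vecD(2)[OF assms]] vecD(3)[OF assms] by (intro vecI) auto
  ultimately show ?thesis using x' by blast
qed

text \<open>With \<open>r = s - s'\<close> the error \<open>1 - (d s' + s' d)\<close> is \<open>d r + r d\<close>.  Only finitely many entries of \<open>d\<close> meet
\<open>r\<close>: those in columns indexed by the finite bases up to degree \<open>n\<close>, and those in the finitely many columns in
the supports of the values of \<open>s\<close>, which matter for the possibly infinite basis in degree \<open>n + 1\<close>.  They all lie in some
\<open>F \<sigma>\<close>, so it suffices that the entries of \<open>r\<close> lie in \<open>F (1 - \<sigma>)\<close>.\<close>

lemma approximate_contraction:
  assumes fin: "\<And>k. k \<le> n \<Longrightarrow> finite (B k)"
    and s: "\<And>k. k \<le> n \<Longrightarrow> contracting A (carrier A) B m s k"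
  shows "\<exists>s'. \<forall>k\<le>n. \<forall>b\<in>B k. s' k b \<in> vec A S (B (k + 1)) \<and>
    (\<forall>i. unit_vec A b i \<ominus> vadd A (lin A (m (k + 1)) (s' k b)) (lin A (s' (k - 1)) (m k b)) i \<in> pos)"
proof -
  have sv: "\<And>k b. k \<le> n \<Longrightarrow> b \<in> B k \<Longrightarrow> s k b \<in> vec A (carrier A) (B (k + 1))"
    and sd: "\<And>k b. k \<le> n \<Longrightarrow> b \<in> B k \<Longrightarrow>
      vadd A (lin A (m (k + 1)) (s k b)) (lin A (s (k - 1)) (m k b)) = unit_vec A b"
    using s by (auto simp: contracting_def)
  have mv: "m k b \<in> vec A (carrier A) (B (k - 1))" if "b \<in> B k" for k b
    by (rule boundary_vec_mono[OF that S_carrier])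
  have mv1: "m (k + 1) b \<in> vec A (carrier A) (B k)" if "b \<in> B (k + 1)" for k b
    by (rule boundary_vec_Suc[OF that S_carrier])
  \<comment> \<open>The entries of the boundary matrices that occur in \<open>d r\<close> and \<open>r d\<close>.\<close>
  define E where "E = (\<Union>k\<in>{0..n}. \<Union>b\<in>B k. range (m k b) \<union> (\<Union>c\<in>{c. s k b c \<noteq> \<zero>}. range (m (k + 1) c)))"
  have fr: "finite (range x)" if "x \<in> vec A (carrier A) K" for x and K :: "'i set"
  proof -
    have "range x \<subseteq> insert \<zero> (x ` {i. x i \<noteq> \<zero>})" by auto
    then show ?thesis by (rule finite_subset) (use vecD(2)[OF that] in simp)
  qed
  have "finite E"
    unfolding E_def
  proof (intro finite_UN_I finite_UnI)
    fix k b c assume "k \<in> {0..n}" "b \<in> B k" "c \<in> {c. s k b c \<noteq> \<zero>}"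
    then have "c \<in> B (k + 1)" using vecD(4)[OF sv] by auto
    then show "finite (range (m (k + 1) c))" by (rule fr[OF mv])
  qed (use fin fr[OF mv] vecD(2)[OF sv] in auto)
  moreover have "E \<subseteq> carrier A"
    unfolding E_def
  proof (intro UN_least Un_least)
    fix k b c assume "k \<in> {0..n}" "b \<in> B k" "c \<in> {c. s k b c \<noteq> \<zero>}"
    then have "c \<in> B (k + 1)" using vecD(4)[OF sv] by auto
    then show "range (m (k + 1) c) \<subseteq> carrier A" using vecD(1)[OF mv] by auto
  qed (use vecD(1)[OF mv] in auto)
  ultimately obtain \<sigma> where \<sigma>: "E \<subseteq> F \<sigma>" using filt_finite_bounded by blast
  have E1: "m k b i \<in> F \<sigma>" if "k \<le> n" "b \<in> B k" for k b i
  proof -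
    have "k \<ge> 0" using that(2) empty_below[of k] by (cases "k < 0") auto
    then show ?thesis using that \<sigma> unfolding E_def by force
  qed
  have E2: "m (k + 1) c i \<in> F \<sigma>" if "k \<le> n" "b \<in> B k" "s k b c \<noteq> \<zero>" for k b c i
  proof -
    have "k \<ge> 0" using that(2) empty_below[of k] by (cases "k < 0") auto
    then show ?thesis using that \<sigma> unfolding E_def by force
  qed
  have "\<forall>k b. \<exists>x. k \<le> n \<longrightarrow> b \<in> B k \<longrightarrow> x \<in> vec A S (B (k + 1)) \<and> (\<forall>i. s k b i \<ominus> x i \<in> F (1 - \<sigma>)) \<and>
     {i. x i \<noteq> \<zero>} \<subseteq> {i. s k b i \<noteq> \<zero>}"
    using truncate_vec[OF sv, of _ _ "1 - \<sigma>"] by blast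
  then obtain s' where s': "\<And>k b. k \<le> n \<Longrightarrow> b \<in> B k \<Longrightarrow> s' k b \<in> vec A S (B (k + 1))"
      "\<And>k b i. k \<le> n \<Longrightarrow> b \<in> B k \<Longrightarrow> s k b i \<ominus> s' k b i \<in> F (1 - \<sigma>)"
      "\<And>k b. k \<le> n \<Longrightarrow> b \<in> B k \<Longrightarrow> {i. s' k b i \<noteq> \<zero>} \<subseteq> {i. s k b i \<noteq> \<zero>}"
    by metis
  have sv': "s' k b \<in> vec A (carrier A) (B (k + 1))" if "k \<le> n" "b \<in> B k" for k b
    using s'(1)[OF that] S_carrier by (auto intro: vec_mono)
  have "unit_vec A b i \<ominus> vadd A (lin A (m (k + 1)) (s' k b)) (lin A (s' (k - 1)) (m k b)) i \<in> pos"
    if kb: "k \<le> n" "b \<in> B k" for k b i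
  proof -
    define r where "r = vdiff A (s k b) (s' k b)"
    define r1 where "r1 c = vdiff A (s (k - 1) c) (s' (k - 1) c)" for c
    have k1: "k - 1 \<le> n" using kb by simp
    have sv1: "s (k - 1) c \<in> vec A (carrier A) (B k)" "s' (k - 1) c \<in> vec A (carrier A) (B k)"
      if "c \<in> B (k - 1)" for c
      using sv[OF k1 that] sv'[OF k1 that] by simp_all
    have r: "r \<in> vec A (carrier A) (B (k + 1))"
      unfolding r_def by (rule vdiff_vec[OF carrier_is_subring sv[OF kb] sv'[OF kb]])
    have rF: "r c \<in> F (1 - \<sigma>)" for c using s'(2)[OF kb] by (simp add: r_def vdiff_def)
    have rs: "s k b c \<noteq> \<zero>" if "r c \<noteq> \<zero>" for c
    proof
      assume z: "s k b c = \<zero>"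
      then have "s' k b c = \<zero>" using s'(3)[OF kb] by auto
      with z that show False by (simp add: r_def vdiff_def a_minus_def)
    qed
    have "lin A (m (k + 1)) r i \<in> F (\<sigma> + (1 - \<sigma>))"
      unfolding lin_def by (intro filt_finsum filt_mult rF) (use E2[OF kb] rs in auto)
    moreover have "lin A r1 (m k b) i \<in> F ((1 - \<sigma>) + \<sigma>)"
      unfolding lin_def
      by (intro filt_finsum filt_mult E1[OF kb])
        (use s'(2)[OF k1] vecD(4)[OF mv[OF kb(2)]] in \<open>auto simp: r1_def vdiff_def\<close>)
    ultimately have P: "lin A (m (k + 1)) r i \<oplus> lin A r1 (m k b) i \<in> pos"
      using filt_add unfolding pos_def by (intro UN_I[of 1]) auto
    have eq1: "lin A (m (k + 1)) r = vdiff A (lin A (m (k + 1)) (s k b)) (lin A (m (k + 1)) (s' k b))"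
      unfolding r_def by (rule lin_vdiff[OF sv[OF kb] sv'[OF kb] mv1])
    have eq2: "lin A r1 (m k b) = vdiff A (lin A (s (k - 1)) (m k b)) (lin A (s' (k - 1)) (m k b))"
      unfolding r1_def by (rule lin_matrix_vdiff[OF mv[OF kb(2)] sv1])
    have c1: "lin A (m (k + 1)) (s k b) \<in> vec A (carrier A) (B k)"
      by (rule lin_vec[OF carrier_is_subring sv[OF kb] mv1])
    have c2: "lin A (m (k + 1)) (s' k b) \<in> vec A (carrier A) (B k)"
      by (rule lin_vec[OF carrier_is_subring sv'[OF kb] mv1])
    have c3: "lin A (s (k - 1)) (m k b) \<in> vec A (carrier A) (B k)"
      by (rule lin_vec[OF carrier_is_subring mv[OF kb(2)] sv1(1)])
    have c4: "lin A (s' (k - 1)) (m k b) \<in> vec A (carrier A) (B k)"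
      by (rule lin_vec[OF carrier_is_subring mv[OF kb(2)] sv1(2)])
    show ?thesis
      using P vecD(1)[OF c1, of i] vecD(1)[OF c2, of i] vecD(1)[OF c3, of i] vecD(1)[OF c4, of i]
      unfolding sd[OF kb, symmetric] eq1 eq2
      by (simp add: vadd_def vdiff_def a_minus_def minus_add a_ac)
  qed
  with s'(1) show ?thesis by blast
qed

text \<open>The map \<open>f = d s' + s' d\<close> commutes with \<open>d\<close> and is bijective over \<open>D\<close>.  Given a cycle \<open>x\<close>, write \<open>x = f w\<close>.
Then \<open>f (d w) = d (f w) = 0\<close>, so \<open>d w = 0\<close> by injectivity, and \<open>x = d (s' w) + s' (d w) = d (s' w)\<close>.\<close>

theorem exact_at_division_closed:
  assumes D: "subring D A" "S \<subseteq> D" and inv: "\<And>a. \<lbrakk>a \<in> D; a \<in> Units A\<rbrakk> \<Longrightarrow> inv a \<in> D"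
    and fin: "\<And>k. k \<le> int n \<Longrightarrow> finite (B k)"
    and ex: "\<And>k. k \<le> int n \<Longrightarrow> exact_at A (carrier A) B m k"
    and k: "k \<le> int n"
  shows "exact_at A D B m k"
proof -
  obtain s where "\<And>k. k \<le> int n \<Longrightarrow> contracting A (carrier A) B m s k"
    using contraction_exists[OF carrier_is_subring S_carrier ex] by blast
  from approximate_contraction[OF fin this] obtain s where s':
    "\<forall>k\<le>int n. \<forall>b\<in>B k. s k b \<in> vec A S (B (k + 1)) \<and>
      (\<forall>i. unit_vec A b i \<ominus> vadd A (lin A (m (k + 1)) (s k b)) (lin A (s (k - 1)) (m k b)) i \<in> pos)"
    by (rule exE)
  then have
    s: "\<And>k b. k \<le> int n \<Longrightarrow> b \<in> B k \<Longrightarrow> s k b \<in> vec A S (B (k + 1))"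
    and pos: "\<And>k b i. k \<le> int n \<Longrightarrow> b \<in> B k \<Longrightarrow>
      unit_vec A b i \<ominus> vadd A (lin A (m (k + 1)) (s k b)) (lin A (s (k - 1)) (m k b)) i \<in> pos"
    by simp_all
  define f where "f k b = vadd A (lin A (m (k + 1)) (s k b)) (lin A (s (k - 1)) (m k b))" for k b
  define e where "e k b = vdiff A (unit_vec A b) (f k b)" for k b
  have DA: "D \<subseteq> carrier A" by (rule subringE(1)[OF D(1)])
  have car: "\<And>x K. x \<in> vec A D K \<Longrightarrow> x \<in> vec A (carrier A) K" using DA by (auto intro: vec_mono)
  have sD: "s k b \<in> vec A D (B (k + 1))" if "k \<le> int n" "b \<in> B k" for k b
    using s[OF that] D(2) by (auto intro: vec_mono)
  have sD1: "s (k - 1) b \<in> vec A D (B k)" if "k \<le> int n" "b \<in> B (k - 1)" for k b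
    using sD[of "k - 1" b] that by simp
  note mD = boundary_vec_mono[OF _ D(2)] and mD1 = boundary_vec_Suc[OF _ D(2)]
  have l1: "lin A (m (k + 1)) (s k b) \<in> vec A D (B k)" if "k \<le> int n" "b \<in> B k" for k b
    by (rule lin_vec[OF D(1) sD[OF that] mD1])
  have l2: "lin A (s (k - 1)) (m k b) \<in> vec A D (B k)" if "k \<le> int n" "b \<in> B k" for k b
    by (rule lin_vec[OF D(1) mD[OF that(2)] sD1[OF that(1)]])
  have f: "f k b \<in> vec A D (B k)" if "k \<le> int n" "b \<in> B k" for k b
    unfolding f_def by (rule vadd_vec[OF D(1) l1[OF that] l2[OF that]])
  have u: "unit_vec A b \<in> vec A D (B k)" if "b \<in> B k" for k b by (rule unit_vec_vec[OF D(1) that])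
  have e: "e k b \<in> vec A D (B k)" if "k \<le> int n" "b \<in> B k" for k b
    unfolding e_def by (rule vdiff_vec[OF D(1) u[OF that(2)] f[OF that]])
  have eP: "e k b i \<in> pos" if "k \<le> int n" "b \<in> B k" for k b i
    using pos[OF that] by (simp add: e_def f_def vdiff_def)
  have f_apply: "lin A (f k) x = vadd A (lin A (m (k + 1)) (lin A (s k) x)) (lin A (s (k - 1)) (lin A (m k) x))"
    if kx: "k \<le> int n" "x \<in> vec A D (B k)" for k x
  proof -
    have "lin A (f k) x = vadd A (lin A (\<lambda>b. lin A (m (k + 1)) (s k b)) x) (lin A (\<lambda>b. lin A (s (k - 1)) (m k b)) x)"
      unfolding f_def by (rule lin_matrix_vadd[OF car[OF kx(2)] car[OF l1[OF kx(1)]] car[OF l2[OF kx(1)]]])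
    also have "lin A (\<lambda>b. lin A (m (k + 1)) (s k b)) x = lin A (m (k + 1)) (lin A (s k) x)"
      by (rule lin_lin[OF car[OF kx(2)] car[OF sD[OF kx(1)]] car[OF mD1], symmetric])
    also have "lin A (\<lambda>b. lin A (s (k - 1)) (m k b)) x = lin A (s (k - 1)) (lin A (m k) x)"
      by (rule lin_lin[OF car[OF kx(2)] car[OF mD] car[OF sD1[OF kx(1)]], symmetric])
    finally show ?thesis .
  qed
  have f_e: "lin A (f k) x = vdiff A x (lin A (e k) x)" if kx: "k \<le> int n" "x \<in> vec A D (B k)" for k x
  proof -
    have "lin A (e k) x = vdiff A (lin A (unit_vec A) x) (lin A (f k) x)"
      unfolding e_def by (rule lin_matrix_vdiff[OF car[OF kx(2)] car[OF u] car[OF f[OF kx(1)]]])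
    then have 1: "lin A (e k) x = vdiff A x (lin A (f k) x)"
      by (simp add: lin_unit_matrix[OF car[OF kx(2)]])
    have "lin A (f k) x \<in> vec A D (B k)" by (rule lin_vec[OF D(1) kx(2) f[OF kx(1)]])
    from vecD(1)[OF car[OF this]] vecD(1)[OF car[OF kx(2)]] show ?thesis unfolding 1 by (auto simp: vdiff_def a_minus_def minus_add a_ac r_neg2)
  qed
  have lin_sum: "lin A (e k) x i = (\<Oplus>j\<in>B k. e k j i \<otimes> x j)" if "k \<le> int n" "x \<in> vec A D (B k)" for k x i
    by (rule lin_eq'[OF car[OF that(2)] car[OF e[OF that(1)]] fin[OF that(1)]])
      (use vecD(4)[OF that(2)] in auto)
  have f_inj: "x = (\<lambda>_. \<zero>)" if kx: "k \<le> int n" "x \<in> vec A D (B k)" "lin A (f k) x = (\<lambda>_. \<zero>)" for k x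
  proof
    fix i
    have xc: "x i \<in> carrier A" for i using vecD(1)[OF car[OF kx(2)]] .
    have ec: "lin A (e k) x i \<in> carrier A" for i
      by (rule vecD(1)[OF lin_vec[OF carrier_is_subring car[OF kx(2)] car[OF e[OF kx(1)]]]])
    have diff: "x i \<ominus> lin A (e k) x i = \<zero>" for i
      using fun_cong[OF f_e[OF kx(1,2)], of i] kx(3) by (simp add: vdiff_def)
    have "x i = lin A (e k) x i" for i
      using diff[of i] xc[of i] ec[of i] by simp
    then have eq: "x i = (\<Oplus>j\<in>B k. e k j i \<otimes> x j)" for i
      using lin_sum[OF kx(1,2), of i] by simp
    have "x i = \<zero>" if "i \<in> B k"
      by (rule one_minus_pos_injective[where y = x and e = "e k", OF fin[OF kx(1)] eP[OF kx(1)] xc eq that])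
    then show "x i = \<zero>" using vecD(3)[OF kx(2)] by blast
  qed
  have f_surj: "\<exists>w\<in>vec A D (B k). lin A (f k) w = x" if kx: "k \<le> int n" "x \<in> vec A D (B k)" for k x
  proof -
    have "\<exists>y. (\<forall>i\<in>B k. y i \<in> D) \<and> (\<forall>i\<in>B k. y i = x i \<oplus> (\<Oplus>j\<in>B k. e k j i \<otimes> y j))"
      using e[OF kx(1)] eP[OF kx(1)] vecD(1)[OF kx(2)]
      by (intro solve_one_minus_pos[where e = "e k" and x = x, OF D(1) inv fin[OF kx(1)]]) (auto dest: vecD(1))
    then obtain y where y: "\<And>i. i \<in> B k \<Longrightarrow> y i \<in> D"
      "\<And>i. i \<in> B k \<Longrightarrow> y i = x i \<oplus> (\<Oplus>j\<in>B k. e k j i \<otimes> y j)" by blast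
    define w where "w i = (if i \<in> B k then y i else \<zero>)" for i
    have w: "w \<in> vec A D (B k)"
    proof (rule vecI)
      show "finite {i. w i \<noteq> \<zero>}"
        by (rule finite_subset[OF _ fin[OF kx(1)]]) (auto simp: w_def)
    qed (use y(1) subringE(2)[OF D(1)] in \<open>auto simp: w_def\<close>)
    have wc: "w i \<in> carrier A" "x i \<in> carrier A" for i
      using vecD(1)[OF car[OF w]] vecD(1)[OF car[OF kx(2)]] .
    have ew: "lin A (e k) w \<in> vec A (carrier A) (B k)"
      by (rule lin_vec[OF carrier_is_subring car[OF w] car[OF e[OF kx(1)]]])
    have wx: "w i = x i \<oplus> lin A (e k) w i" for i
    proof (cases "i \<in> B k")
      case True
      have "(\<Oplus>j\<in>B k. e k j i \<otimes> y j) = (\<Oplus>j\<in>B k. e k j i \<otimes> w j)"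
        using wc(1) vecD(1)[OF car[OF e[OF kx(1)]]] by (intro finsum_cong') (auto simp: w_def)
      then show ?thesis using y(2)[OF True] True lin_sum[OF kx(1) w] by (simp add: w_def)
    next
      case False
      then show ?thesis using vecD(3)[OF w] vecD(3)[OF kx(2)] vecD(3)[OF ew] by simp
    qed
    have "lin A (f k) w = vdiff A (vadd A x (lin A (e k) w)) (lin A (e k) w)"
      unfolding f_e[OF kx(1) w] using wx by (auto simp: vadd_def vdiff_def)
    then have "lin A (f k) w = x" using vadd_vdiff_cancel(2)[OF car[OF kx(2)] ew] by simp
    with w show ?thesis by blast
  qed
  have zero: "lin A g (\<lambda>_. \<zero>) = (\<lambda>_. \<zero>)" for g :: "'i \<Rightarrow> 'i \<Rightarrow> 'a"
    by (simp add: lin_def)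
  show ?thesis
    unfolding exact_at_def
  proof (intro ballI impI)
    fix x assume x: "x \<in> vec A D (B k)" and mx: "lin A (m k) x = (\<lambda>_. \<zero>)"
    obtain w where w: "w \<in> vec A D (B k)" "lin A (f k) w = x" using f_surj[OF k x] by blast
    let ?u = "lin A (m k) w"
    have k1: "k - 1 \<le> int n" using k by simp
    have uD: "?u \<in> vec A D (B (k - 1))" by (rule lin_vec[OF D(1) w(1) mD])
    have sw: "lin A (s k) w \<in> vec A D (B (k + 1))" by (rule lin_vec[OF D(1) w(1) sD[OF k]])
    have su: "lin A (s (k - 1)) ?u \<in> vec A D (B k)" by (rule lin_vec[OF D(1) uD sD1[OF k]])
    have msw: "lin A (m (k + 1)) (lin A (s k) w) \<in> vec A D (B k)" by (rule lin_vec[OF D(1) sw mD1])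
    have msu: "lin A (m k) (lin A (s (k - 1)) ?u) \<in> vec A D (B (k - 1))" by (rule lin_vec[OF D(1) su mD])
    have "lin A (f (k - 1)) ?u = lin A (m k) (lin A (s (k - 1)) ?u)"
      using f_apply[OF k1 uD] lin_boundary_boundary[OF car[OF w(1)]] vecD(1)[OF car[OF msu]] zero
      by (simp add: vadd_def)
    also have "\<dots> = lin A (m k) x"
    proof -
      have "lin A (m k) x = vadd A (lin A (m k) (lin A (m (k + 1)) (lin A (s k) w))) (lin A (m k) (lin A (s (k - 1)) ?u))"
        unfolding w(2)[symmetric] f_apply[OF k w(1)]
        by (rule lin_vadd[OF car[OF msw] car[OF su] car[OF mD]])
      also have "lin A (m k) (lin A (m (k + 1)) (lin A (s k) w)) = (\<lambda>_. \<zero>)"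
        using lin_boundary_boundary[OF car[OF sw]] by simp
      finally show ?thesis using vecD(1)[OF car[OF msu]] by (simp add: vadd_def)
    qed
    finally have "?u = (\<lambda>_. \<zero>)" using f_inj[OF k1 uD] mx by simp
    then have "x = lin A (m (k + 1)) (lin A (s k) w)"
      using w(2) f_apply[OF k w(1)] zero vecD(1)[OF car[OF msw]] by (simp add: vadd_def)
    with sw show "\<exists>y\<in>vec A D (B (k + 1)). lin A (m (k + 1)) y = x" by blast
  qed
qed

end

section \<open>The division closure\<close>

lemma (in ring) subring_division_closure:
  assumes "S \<subseteq> carrier R"
  shows "subring (division_closure S R) R" and "S \<subseteq> division_closure S R"
proof -
  have "carrier R \<in> {T. subring T R \<and> S \<subseteq> T \<and> division_closed T R}"
    using assms carrier_is_subring by (simp add: division_closed_def)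
  then show "subring (division_closure S R) R"
    unfolding division_closure_def by (intro subring_Inter) auto
  show "S \<subseteq> division_closure S R" unfolding division_closure_def by auto
qed

text \<open>Inverses are unique in the big ring, so the inverse found in each division-closed subring is the same element.\<close>

lemma (in ring) inv_in_division_closure:
  assumes a: "a \<in> division_closure S R" "a \<in> Units R"
  shows "inv a \<in> division_closure S R"
  unfolding division_closure_def
proof
  fix T assume "T \<in> {T. subring T R \<and> S \<subseteq> T \<and> division_closed T R}"
  then have T: "subring T R" "S \<subseteq> T" "division_closed T R" by auto
  then have "a \<in> T" using a(1) by (auto simp: division_closure_def)
  then have "a \<in> Units (R\<lparr>carrier := T\<rparr>)" using T(3) a(2) by (auto simp: division_closed_def)
  then obtain b where b: "b \<in> T" "a \<otimes> b = \<one>" "b \<otimes> a = \<one>" by (auto simp: Units_def)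
  then have "inv a = b"
    using subringE(1)[OF T(1)] \<open>a \<in> T\<close> by (intro inv_unique'[symmetric]) auto
  with b(1) show "inv a \<in> T" by simp
qed

section \<open>The Novikov ring as a complete filtered ring\<close>

locale group_character = R: ring R + G: group G
  for R :: "('r, 'x) ring_scheme" and G :: "('g, 'y) monoid_scheme" +
  fixes \<phi> :: "'g \<Rightarrow> real"
  assumes character: "\<phi> \<in> hom G additive_reals"
begin

abbreviation N where "N \<equiv> novikov_ring R G \<phi>"

lemma char_mult: "\<lbrakk>g \<in> carrier G; h \<in> carrier G\<rbrakk> \<Longrightarrow> \<phi> (g \<otimes>\<^bsub>G\<^esub> h) = \<phi> g + \<phi> h"
  using hom_mult[OF character] by (simp add: additive_reals_def)

lemma char_one: "\<phi> \<one>\<^bsub>G\<^esub> = 0"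
  using char_mult[of "\<one>\<^bsub>G\<^esub>" "\<one>\<^bsub>G\<^esub>"] by simp

lemma char_inv: "g \<in> carrier G \<Longrightarrow> \<phi> (inv\<^bsub>G\<^esub> g) = - \<phi> g"
  using char_mult[of "inv\<^bsub>G\<^esub> g" g] by (simp add: char_one)

lemma char_inv_mult: "\<lbrakk>g \<in> carrier G; h \<in> carrier G\<rbrakk> \<Longrightarrow> \<phi> (inv\<^bsub>G\<^esub> h \<otimes>\<^bsub>G\<^esub> g) = \<phi> g - \<phi> h"
  by (simp add: char_mult char_inv)

lemma novikov_carrier: "a \<in> carrier N \<longleftrightarrow> a \<in> carrier G \<rightarrow>\<^sub>E carrier R \<and>
    (\<forall>s. finite {g \<in> carrier G. a g \<noteq> \<zero>\<^bsub>R\<^esub> \<and> \<phi> g < s})"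
  by (simp add: novikov_ring_def formal_sum_ring_def)

lemma novikov_coeff: "\<lbrakk>a \<in> carrier N; g \<in> carrier G\<rbrakk> \<Longrightarrow> a g \<in> carrier R"
  by (auto simp: novikov_carrier)

lemma novikov_finite: "a \<in> carrier N \<Longrightarrow> finite {g \<in> carrier G. a g \<noteq> \<zero>\<^bsub>R\<^esub> \<and> \<phi> g < s}"
  by (auto simp: novikov_carrier)

lemma novikov_eqI:
  assumes "a \<in> carrier N" "b \<in> carrier N" "\<And>g. g \<in> carrier G \<Longrightarrow> a g = b g"
  shows "a = b"
  using assms by (intro PiE_ext[of a "carrier G" "\<lambda>_. carrier R" b]) (auto simp: novikov_carrier)

lemma novikov_add: "g \<in> carrier G \<Longrightarrow> (a \<oplus>\<^bsub>N\<^esub> b) g = a g \<oplus>\<^bsub>R\<^esub> b g"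
  and novikov_zero: "g \<in> carrier G \<Longrightarrow> \<zero>\<^bsub>N\<^esub> g = \<zero>\<^bsub>R\<^esub>"
  and novikov_one: "g \<in> carrier G \<Longrightarrow> \<one>\<^bsub>N\<^esub> g = (if g = \<one>\<^bsub>G\<^esub> then \<one>\<^bsub>R\<^esub> else \<zero>\<^bsub>R\<^esub>)"
  and novikov_mult: "g \<in> carrier G \<Longrightarrow> (a \<otimes>\<^bsub>N\<^esub> b) g =
    (\<Oplus>\<^bsub>R\<^esub>h\<in>{h \<in> carrier G. a h \<noteq> \<zero>\<^bsub>R\<^esub> \<and> b (inv\<^bsub>G\<^esub> h \<otimes>\<^bsub>G\<^esub> g) \<noteq> \<zero>\<^bsub>R\<^esub>}.
       a h \<otimes>\<^bsub>R\<^esub> b (inv\<^bsub>G\<^esub> h \<otimes>\<^bsub>G\<^esub> g))"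
  by (simp_all add: novikov_ring_def formal_sum_ring_def)

text \<open>The finitely many support elements with \<open>\<phi> g < 0\<close>, together with the bound \<open>0\<close> for the others, give a lower bound of
\<open>\<phi>\<close> on the support.  This is what makes all convolution sums finite.\<close>

lemma novikov_bounded:
  assumes "a \<in> carrier N"
  obtains s where "\<And>g. \<lbrakk>g \<in> carrier G; a g \<noteq> \<zero>\<^bsub>R\<^esub>\<rbrakk> \<Longrightarrow> s \<le> \<phi> g"
proof -
  let ?V = "insert 0 (\<phi> ` {g \<in> carrier G. a g \<noteq> \<zero>\<^bsub>R\<^esub> \<and> \<phi> g < 0})"
  have "Min ?V \<le> \<phi> g" if "g \<in> carrier G" "a g \<noteq> \<zero>\<^bsub>R\<^esub>" for g
    using that novikov_finite[OF assms, of 0] by (cases "\<phi> g < 0") (auto intro: Min.coboundedI simp: Min_le_iff)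
  then show ?thesis using that by blast
qed

lemma convolution_finite:
  assumes a: "a \<in> carrier N" and b: "b \<in> carrier N" and g: "g \<in> carrier G"
  shows "finite {h \<in> carrier G. a h \<noteq> \<zero>\<^bsub>R\<^esub> \<and> b (inv\<^bsub>G\<^esub> h \<otimes>\<^bsub>G\<^esub> g) \<noteq> \<zero>\<^bsub>R\<^esub>}"
proof -
  obtain s where s: "\<And>g. \<lbrakk>g \<in> carrier G; b g \<noteq> \<zero>\<^bsub>R\<^esub>\<rbrakk> \<Longrightarrow> s \<le> \<phi> g"
    using novikov_bounded[OF b] by blast
  have "\<phi> h < \<phi> g - s + 1" if "h \<in> carrier G" "b (inv\<^bsub>G\<^esub> h \<otimes>\<^bsub>G\<^esub> g) \<noteq> \<zero>\<^bsub>R\<^esub>" for h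
    using s[of "inv\<^bsub>G\<^esub> h \<otimes>\<^bsub>G\<^esub> g"] that g by (simp add: char_inv_mult)
  then show ?thesis
    by (intro finite_subset[OF _ novikov_finite[OF a, of "\<phi> g - s + 1"]]) auto
qed

text \<open>The sum defining the coefficient of a product may be taken over any finite set containing the relevant
pairs, which allows sums with different supports to be compared.\<close>

lemma novikov_mult_sum:
  assumes a: "a \<in> carrier N" and b: "b \<in> carrier N" and g: "g \<in> carrier G"
    and H: "finite H" "H \<subseteq> carrier G"
      "\<And>h. \<lbrakk>h \<in> carrier G; a h \<noteq> \<zero>\<^bsub>R\<^esub>; b (inv\<^bsub>G\<^esub> h \<otimes>\<^bsub>G\<^esub> g) \<noteq> \<zero>\<^bsub>R\<^esub>\<rbrakk> \<Longrightarrow> h \<in> H"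
  shows "(a \<otimes>\<^bsub>N\<^esub> b) g = (\<Oplus>\<^bsub>R\<^esub>h\<in>H. a h \<otimes>\<^bsub>R\<^esub> b (inv\<^bsub>G\<^esub> h \<otimes>\<^bsub>G\<^esub> g))"
  unfolding novikov_mult[OF g]
proof (rule R.finsum_restrict[symmetric, OF H(1)])
  fix h assume "h \<in> H"
  then show "a h \<otimes>\<^bsub>R\<^esub> b (inv\<^bsub>G\<^esub> h \<otimes>\<^bsub>G\<^esub> g) \<in> carrier R"
    using H(2) g novikov_coeff[OF a] novikov_coeff[OF b] by auto
next
  fix h assume h: "h \<in> H - {h \<in> carrier G. a h \<noteq> \<zero>\<^bsub>R\<^esub> \<and> b (inv\<^bsub>G\<^esub> h \<otimes>\<^bsub>G\<^esub> g) \<noteq> \<zero>\<^bsub>R\<^esub>}"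
  then have hG: "h \<in> carrier G" using H(2) by auto
  then have "a h \<in> carrier R" "b (inv\<^bsub>G\<^esub> h \<otimes>\<^bsub>G\<^esub> g) \<in> carrier R"
    using g novikov_coeff[OF a] novikov_coeff[OF b] by auto
  then show "a h \<otimes>\<^bsub>R\<^esub> b (inv\<^bsub>G\<^esub> h \<otimes>\<^bsub>G\<^esub> g) = \<zero>\<^bsub>R\<^esub>" using h hG by auto
qed (use H(3) in auto)

lemma novikov_mult_support:
  assumes a: "a \<in> carrier N" and b: "b \<in> carrier N" and g: "g \<in> carrier G"
    and nz: "(a \<otimes>\<^bsub>N\<^esub> b) g \<noteq> \<zero>\<^bsub>R\<^esub>"
  obtains h where "h \<in> carrier G" "a h \<noteq> \<zero>\<^bsub>R\<^esub>" "b (inv\<^bsub>G\<^esub> h \<otimes>\<^bsub>G\<^esub> g) \<noteq> \<zero>\<^bsub>R\<^esub>"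
proof (rule ccontr)
  assume "\<not> thesis"
  then have "{h \<in> carrier G. a h \<noteq> \<zero>\<^bsub>R\<^esub> \<and> b (inv\<^bsub>G\<^esub> h \<otimes>\<^bsub>G\<^esub> g) \<noteq> \<zero>\<^bsub>R\<^esub>} = {}"
    using that by blast
  then have "(a \<otimes>\<^bsub>N\<^esub> b) g = \<zero>\<^bsub>R\<^esub>" unfolding novikov_mult[OF g] by (simp only: R.finsum_empty)
  with nz show False by simp
qed

lemma novikov_mult_closed:
  assumes a: "a \<in> carrier N" and b: "b \<in> carrier N"
  shows "a \<otimes>\<^bsub>N\<^esub> b \<in> carrier N"
  unfolding novikov_carrier
proof (intro conjI allI PiE_I)
  fix g assume g: "g \<in> carrier G"
  show "(a \<otimes>\<^bsub>N\<^esub> b) g \<in> carrier R"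
    unfolding novikov_mult[OF g] using g novikov_coeff[OF a] novikov_coeff[OF b]
    by (intro R.finsum_closed) auto
next
  fix g assume "g \<notin> carrier G"
  then show "(a \<otimes>\<^bsub>N\<^esub> b) g = undefined" by (simp add: novikov_ring_def formal_sum_ring_def)
next
  fix s
  obtain sa where sa: "\<And>g. \<lbrakk>g \<in> carrier G; a g \<noteq> \<zero>\<^bsub>R\<^esub>\<rbrakk> \<Longrightarrow> sa \<le> \<phi> g" using novikov_bounded[OF a] by blast
  obtain sb where sb: "\<And>g. \<lbrakk>g \<in> carrier G; b g \<noteq> \<zero>\<^bsub>R\<^esub>\<rbrakk> \<Longrightarrow> sb \<le> \<phi> g" using novikov_bounded[OF b] by blast
  let ?U = "{h \<in> carrier G. a h \<noteq> \<zero>\<^bsub>R\<^esub> \<and> \<phi> h < s - sb}"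
  let ?V = "{h \<in> carrier G. b h \<noteq> \<zero>\<^bsub>R\<^esub> \<and> \<phi> h < s - sa}"
  have "{g \<in> carrier G. (a \<otimes>\<^bsub>N\<^esub> b) g \<noteq> \<zero>\<^bsub>R\<^esub> \<and> \<phi> g < s} \<subseteq> (\<lambda>(h, k). h \<otimes>\<^bsub>G\<^esub> k) ` (?U \<times> ?V)"
  proof
    fix g assume "g \<in> {g \<in> carrier G. (a \<otimes>\<^bsub>N\<^esub> b) g \<noteq> \<zero>\<^bsub>R\<^esub> \<and> \<phi> g < s}"
    then have g: "g \<in> carrier G" "(a \<otimes>\<^bsub>N\<^esub> b) g \<noteq> \<zero>\<^bsub>R\<^esub>" "\<phi> g < s" by auto
    obtain h where h: "h \<in> carrier G" "a h \<noteq> \<zero>\<^bsub>R\<^esub>" "b (inv\<^bsub>G\<^esub> h \<otimes>\<^bsub>G\<^esub> g) \<noteq> \<zero>\<^bsub>R\<^esub>"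
      using novikov_mult_support[OF a b g(1,2)] .
    have k: "inv\<^bsub>G\<^esub> h \<otimes>\<^bsub>G\<^esub> g \<in> carrier G" using g h by simp
    have "\<phi> h < s - sb" "\<phi> (inv\<^bsub>G\<^esub> h \<otimes>\<^bsub>G\<^esub> g) < s - sa"
      using sa[OF h(1,2)] sb[OF k h(3)] g h by (simp_all add: char_inv_mult)
    then have "(h, inv\<^bsub>G\<^esub> h \<otimes>\<^bsub>G\<^esub> g) \<in> ?U \<times> ?V" using h k by auto
    moreover have "g = h \<otimes>\<^bsub>G\<^esub> (inv\<^bsub>G\<^esub> h \<otimes>\<^bsub>G\<^esub> g)" using g h by (simp add: G.m_assoc[symmetric])
    ultimately show "g \<in> (\<lambda>(h, k). h \<otimes>\<^bsub>G\<^esub> k) ` (?U \<times> ?V)" by force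
  qed
  then show "finite {g \<in> carrier G. (a \<otimes>\<^bsub>N\<^esub> b) g \<noteq> \<zero>\<^bsub>R\<^esub> \<and> \<phi> g < s}"
    by (rule finite_subset) (intro finite_imageI finite_cartesian_product novikov_finite a b)
qed

text \<open>Membership of sums and negatives follows from their supports alone.\<close>

lemma novikov_subset_closed:
  assumes "c \<in> carrier G \<rightarrow>\<^sub>E carrier R" "a \<in> carrier N" "b \<in> carrier N"
    and "\<And>g. \<lbrakk>g \<in> carrier G; c g \<noteq> \<zero>\<^bsub>R\<^esub>\<rbrakk> \<Longrightarrow> a g \<noteq> \<zero>\<^bsub>R\<^esub> \<or> b g \<noteq> \<zero>\<^bsub>R\<^esub>"
  shows "c \<in> carrier N"
  unfolding novikov_carrier
proof (intro conjI allI assms(1))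
  fix s
  have "{g \<in> carrier G. c g \<noteq> \<zero>\<^bsub>R\<^esub> \<and> \<phi> g < s} \<subseteq>
    {g \<in> carrier G. a g \<noteq> \<zero>\<^bsub>R\<^esub> \<and> \<phi> g < s} \<union> {g \<in> carrier G. b g \<noteq> \<zero>\<^bsub>R\<^esub> \<and> \<phi> g < s}"
    using assms(4) by auto
  then show "finite {g \<in> carrier G. c g \<noteq> \<zero>\<^bsub>R\<^esub> \<and> \<phi> g < s}"
    by (rule finite_subset) (intro finite_UnI novikov_finite assms)
qed

lemma novikov_add_closed:
  assumes a: "a \<in> carrier N" and b: "b \<in> carrier N"
  shows "a \<oplus>\<^bsub>N\<^esub> b \<in> carrier N"
proof (rule novikov_subset_closed[OF _ a b])
  show "a \<oplus>\<^bsub>N\<^esub> b \<in> carrier G \<rightarrow>\<^sub>E carrier R"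
    using novikov_coeff[OF a] novikov_coeff[OF b] by (auto simp: novikov_ring_def formal_sum_ring_def)
qed (auto simp: novikov_add)

lemma novikov_zero_closed: "\<zero>\<^bsub>N\<^esub> \<in> carrier N"
  by (auto simp: novikov_ring_def formal_sum_ring_def)

lemma novikov_one_closed: "\<one>\<^bsub>N\<^esub> \<in> carrier N"
proof -
  have "finite {g \<in> carrier G. \<one>\<^bsub>N\<^esub> g \<noteq> \<zero>\<^bsub>R\<^esub> \<and> \<phi> g < s}" for s
    by (rule finite_subset[of _ "{\<one>\<^bsub>G\<^esub>}"]) (auto simp: novikov_one split: if_splits)
  then show ?thesis unfolding novikov_carrier
    by (auto simp: novikov_ring_def formal_sum_ring_def)
qed

definition neg_coeffs :: "('g \<Rightarrow> 'r) \<Rightarrow> 'g \<Rightarrow> 'r" where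
  "neg_coeffs a = (\<lambda>g\<in>carrier G. \<ominus>\<^bsub>R\<^esub> a g)"

lemma neg_coeffs_closed: "a \<in> carrier N \<Longrightarrow> neg_coeffs a \<in> carrier N"
  by (rule novikov_subset_closed[of _ a a])
    (auto simp: neg_coeffs_def dest: novikov_coeff)

lemma neg_coeffs_add: "a \<in> carrier N \<Longrightarrow> neg_coeffs a \<oplus>\<^bsub>N\<^esub> a = \<zero>\<^bsub>N\<^esub>"
  using novikov_zero_closed neg_coeffs_closed[of a]
  by (intro novikov_eqI novikov_add_closed)
    (auto simp: novikov_add novikov_zero novikov_coeff neg_coeffs_def R.l_neg)

text \<open>Both sides are the sum of \<open>a h\<close>, \<open>b k\<close>, \<open>c l\<close> over the triples with product \<open>g\<close>.  If all three factors are
nonzero, the lower bounds of \<open>\<phi>\<close> on the supports bound \<open>\<phi> h\<close> and \<open>\<phi> k\<close> from above, so that \<open>h\<close> and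
\<open>k\<close> range over finite sets \<open>U\<close> and \<open>V\<close>.  The sums are over \<open>h \<in> U\<close> and \<open>w = h k\<close>.\<close>

lemma novikov_assoc:
  assumes a: "a \<in> carrier N" and b: "b \<in> carrier N" and c: "c \<in> carrier N"
  shows "(a \<otimes>\<^bsub>N\<^esub> b) \<otimes>\<^bsub>N\<^esub> c = a \<otimes>\<^bsub>N\<^esub> (b \<otimes>\<^bsub>N\<^esub> c)"
proof (rule novikov_eqI)
  show "(a \<otimes>\<^bsub>N\<^esub> b) \<otimes>\<^bsub>N\<^esub> c \<in> carrier N" "a \<otimes>\<^bsub>N\<^esub> (b \<otimes>\<^bsub>N\<^esub> c) \<in> carrier N"
    using a b c by (auto intro: novikov_mult_closed)
  fix g assume g: "g \<in> carrier G"
  have ab: "a \<otimes>\<^bsub>N\<^esub> b \<in> carrier N" and bc: "b \<otimes>\<^bsub>N\<^esub> c \<in> carrier N"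
    using a b c by (auto intro: novikov_mult_closed)
  obtain sa where sa: "\<And>g. \<lbrakk>g \<in> carrier G; a g \<noteq> \<zero>\<^bsub>R\<^esub>\<rbrakk> \<Longrightarrow> sa \<le> \<phi> g" using novikov_bounded[OF a] by blast
  obtain sb where sb: "\<And>g. \<lbrakk>g \<in> carrier G; b g \<noteq> \<zero>\<^bsub>R\<^esub>\<rbrakk> \<Longrightarrow> sb \<le> \<phi> g" using novikov_bounded[OF b] by blast
  obtain sc where sc: "\<And>g. \<lbrakk>g \<in> carrier G; c g \<noteq> \<zero>\<^bsub>R\<^esub>\<rbrakk> \<Longrightarrow> sc \<le> \<phi> g" using novikov_bounded[OF c] by blast
  define U where "U = {h \<in> carrier G. a h \<noteq> \<zero>\<^bsub>R\<^esub> \<and> \<phi> h < \<phi> g - sb - sc + 1}"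
  define V where "V = {k \<in> carrier G. b k \<noteq> \<zero>\<^bsub>R\<^esub> \<and> \<phi> k < \<phi> g - sa - sc + 1}"
  define W where "W = (\<lambda>(h, k). h \<otimes>\<^bsub>G\<^esub> k) ` (U \<times> V)"
  have U: "finite U" "U \<subseteq> carrier G" and V: "finite V" "V \<subseteq> carrier G"
    unfolding U_def V_def by (auto intro: novikov_finite a b)
  have W: "finite W" "W \<subseteq> carrier G"
    using U V by (auto simp: W_def)
  have coeff: "\<And>h. h \<in> carrier G \<Longrightarrow> a h \<in> carrier R" "\<And>h. h \<in> carrier G \<Longrightarrow> b h \<in> carrier R"
    "\<And>h. h \<in> carrier G \<Longrightarrow> c h \<in> carrier R"
    using novikov_coeff a b c by auto
  have inW: "w \<in> W" and inU: "h \<in> U"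
    if w: "w \<in> carrier G" "h \<in> carrier G" "a h \<noteq> \<zero>\<^bsub>R\<^esub>" "b (inv\<^bsub>G\<^esub> h \<otimes>\<^bsub>G\<^esub> w) \<noteq> \<zero>\<^bsub>R\<^esub>"
      "c (inv\<^bsub>G\<^esub> w \<otimes>\<^bsub>G\<^esub> g) \<noteq> \<zero>\<^bsub>R\<^esub>" for w h
  proof -
    have "sa \<le> \<phi> h" "sb \<le> \<phi> w - \<phi> h" "sc \<le> \<phi> g - \<phi> w"
      using sa[OF w(2,3)] sb[OF _ w(4)] sc[OF _ w(5)] w g by (simp_all add: char_inv_mult)
    then have "\<phi> h < \<phi> g - sb - sc + 1" "\<phi> (inv\<^bsub>G\<^esub> h \<otimes>\<^bsub>G\<^esub> w) < \<phi> g - sa - sc + 1"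
      using w by (simp_all add: char_inv_mult)
    then have *: "h \<in> U" "inv\<^bsub>G\<^esub> h \<otimes>\<^bsub>G\<^esub> w \<in> V" using w by (auto simp: U_def V_def)
    moreover have "w = h \<otimes>\<^bsub>G\<^esub> (inv\<^bsub>G\<^esub> h \<otimes>\<^bsub>G\<^esub> w)" using w by (simp add: G.m_assoc[symmetric])
    ultimately show "w \<in> W" "h \<in> U" unfolding W_def by force+
  qed
  have "((a \<otimes>\<^bsub>N\<^esub> b) \<otimes>\<^bsub>N\<^esub> c) g = (\<Oplus>\<^bsub>R\<^esub>w\<in>W. (a \<otimes>\<^bsub>N\<^esub> b) w \<otimes>\<^bsub>R\<^esub> c (inv\<^bsub>G\<^esub> w \<otimes>\<^bsub>G\<^esub> g))"
  proof (rule novikov_mult_sum[OF ab c g W])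
    fix w assume w: "w \<in> carrier G" "(a \<otimes>\<^bsub>N\<^esub> b) w \<noteq> \<zero>\<^bsub>R\<^esub>" "c (inv\<^bsub>G\<^esub> w \<otimes>\<^bsub>G\<^esub> g) \<noteq> \<zero>\<^bsub>R\<^esub>"
    obtain h where "h \<in> carrier G" "a h \<noteq> \<zero>\<^bsub>R\<^esub>" "b (inv\<^bsub>G\<^esub> h \<otimes>\<^bsub>G\<^esub> w) \<noteq> \<zero>\<^bsub>R\<^esub>"
      using novikov_mult_support[OF a b w(1,2)] .
    from inW[OF w(1) this w(3)] show "w \<in> W" .
  qed
  also have "\<dots> = (\<Oplus>\<^bsub>R\<^esub>w\<in>W. \<Oplus>\<^bsub>R\<^esub>h\<in>U. a h \<otimes>\<^bsub>R\<^esub> b (inv\<^bsub>G\<^esub> h \<otimes>\<^bsub>G\<^esub> w) \<otimes>\<^bsub>R\<^esub> c (inv\<^bsub>G\<^esub> w \<otimes>\<^bsub>G\<^esub> g))"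
  proof (rule R.finsum_cong')
    show "(\<lambda>w. \<Oplus>\<^bsub>R\<^esub>h\<in>U. a h \<otimes>\<^bsub>R\<^esub> b (inv\<^bsub>G\<^esub> h \<otimes>\<^bsub>G\<^esub> w) \<otimes>\<^bsub>R\<^esub> c (inv\<^bsub>G\<^esub> w \<otimes>\<^bsub>G\<^esub> g)) \<in> W \<rightarrow> carrier R"
      using U W g coeff by (auto intro!: R.finsum_closed simp: subset_eq)
    fix w assume w: "w \<in> W"
    then have wG: "w \<in> carrier G" using W by auto
    have cc: "c (inv\<^bsub>G\<^esub> w \<otimes>\<^bsub>G\<^esub> g) \<in> carrier R" using coeff wG g by auto
    have t: "a h \<otimes>\<^bsub>R\<^esub> b (inv\<^bsub>G\<^esub> h \<otimes>\<^bsub>G\<^esub> w) \<in> carrier R" if "h \<in> U" for h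
      using that U wG coeff by (auto simp: subset_eq)
    show "(a \<otimes>\<^bsub>N\<^esub> b) w \<otimes>\<^bsub>R\<^esub> c (inv\<^bsub>G\<^esub> w \<otimes>\<^bsub>G\<^esub> g) =
      (\<Oplus>\<^bsub>R\<^esub>h\<in>U. a h \<otimes>\<^bsub>R\<^esub> b (inv\<^bsub>G\<^esub> h \<otimes>\<^bsub>G\<^esub> w) \<otimes>\<^bsub>R\<^esub> c (inv\<^bsub>G\<^esub> w \<otimes>\<^bsub>G\<^esub> g))"
    proof (cases "c (inv\<^bsub>G\<^esub> w \<otimes>\<^bsub>G\<^esub> g) = \<zero>\<^bsub>R\<^esub>")
      case True
      then have "(\<Oplus>\<^bsub>R\<^esub>h\<in>U. a h \<otimes>\<^bsub>R\<^esub> b (inv\<^bsub>G\<^esub> h \<otimes>\<^bsub>G\<^esub> w) \<otimes>\<^bsub>R\<^esub> c (inv\<^bsub>G\<^esub> w \<otimes>\<^bsub>G\<^esub> g)) = \<zero>\<^bsub>R\<^esub>"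
        using t by (intro R.add.finprod_one_eqI) auto
      then show ?thesis using True novikov_coeff[OF ab wG] by simp
    next
      case False
      have "(a \<otimes>\<^bsub>N\<^esub> b) w = (\<Oplus>\<^bsub>R\<^esub>h\<in>U. a h \<otimes>\<^bsub>R\<^esub> b (inv\<^bsub>G\<^esub> h \<otimes>\<^bsub>G\<^esub> w))"
        by (rule novikov_mult_sum[OF a b wG U]) (use inU[OF wG _ _ _ False] in blast)
      then show ?thesis using t cc U(1) by (simp add: R.finsum_ldistr Pi_def)
    qed
  qed simp
  also have "\<dots> = (\<Oplus>\<^bsub>R\<^esub>h\<in>U. \<Oplus>\<^bsub>R\<^esub>w\<in>W. a h \<otimes>\<^bsub>R\<^esub> b (inv\<^bsub>G\<^esub> h \<otimes>\<^bsub>G\<^esub> w) \<otimes>\<^bsub>R\<^esub> c (inv\<^bsub>G\<^esub> w \<otimes>\<^bsub>G\<^esub> g))"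
    using U W g coeff by (intro R.finsum_swap) (auto simp: subset_eq)
  also have "\<dots> = (\<Oplus>\<^bsub>R\<^esub>h\<in>U. a h \<otimes>\<^bsub>R\<^esub> (b \<otimes>\<^bsub>N\<^esub> c) (inv\<^bsub>G\<^esub> h \<otimes>\<^bsub>G\<^esub> g))"
  proof (rule R.finsum_cong')
    show "(\<lambda>h. a h \<otimes>\<^bsub>R\<^esub> (b \<otimes>\<^bsub>N\<^esub> c) (inv\<^bsub>G\<^esub> h \<otimes>\<^bsub>G\<^esub> g)) \<in> U \<rightarrow> carrier R"
      using U g coeff novikov_coeff[OF bc] by (auto simp: subset_eq)
    fix h assume h: "h \<in> U"
    then have hG: "h \<in> carrier G" and ah: "a h \<noteq> \<zero>\<^bsub>R\<^esub>" using U by (auto simp: U_def)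
    let ?f = "\<lambda>w. inv\<^bsub>G\<^esub> h \<otimes>\<^bsub>G\<^esub> w"
    have cancel: "inv\<^bsub>G\<^esub> (?f w) \<otimes>\<^bsub>G\<^esub> ?f g = inv\<^bsub>G\<^esub> w \<otimes>\<^bsub>G\<^esub> g" if "w \<in> carrier G" for w
      using that hG g by (simp add: G.inv_mult_group G.m_assoc) (simp add: G.m_assoc[symmetric])
    have inj: "inj_on ?f W" using W hG by (auto simp: inj_on_def subset_eq)
    have "(b \<otimes>\<^bsub>N\<^esub> c) (?f g) = (\<Oplus>\<^bsub>R\<^esub>k\<in>?f ` W. b k \<otimes>\<^bsub>R\<^esub> c (inv\<^bsub>G\<^esub> k \<otimes>\<^bsub>G\<^esub> ?f g))"
    proof (rule novikov_mult_sum[OF b c])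
      fix k assume k: "k \<in> carrier G" "b k \<noteq> \<zero>\<^bsub>R\<^esub>" "c (inv\<^bsub>G\<^esub> k \<otimes>\<^bsub>G\<^esub> ?f g) \<noteq> \<zero>\<^bsub>R\<^esub>"
      have kf: "k = ?f (h \<otimes>\<^bsub>G\<^esub> k)" using k hG by (simp add: G.m_assoc[symmetric])
      have "h \<otimes>\<^bsub>G\<^esub> k \<in> W"
      proof (rule inW[of _ h])
        show "c (inv\<^bsub>G\<^esub> (h \<otimes>\<^bsub>G\<^esub> k) \<otimes>\<^bsub>G\<^esub> g) \<noteq> \<zero>\<^bsub>R\<^esub>"
          using k(3) cancel[of "h \<otimes>\<^bsub>G\<^esub> k"] kf k(1) hG by simp
      qed (use k hG ah kf in auto)
      with kf show "k \<in> ?f ` W" by blast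
    qed (use W hG g in auto)
    also have "\<dots> = (\<Oplus>\<^bsub>R\<^esub>w\<in>W. b (?f w) \<otimes>\<^bsub>R\<^esub> c (inv\<^bsub>G\<^esub> (?f w) \<otimes>\<^bsub>G\<^esub> ?f g))"
      using inj W hG g coeff by (intro R.finsum_reindex) (auto simp: subset_eq)
    also have "\<dots> = (\<Oplus>\<^bsub>R\<^esub>w\<in>W. b (?f w) \<otimes>\<^bsub>R\<^esub> c (inv\<^bsub>G\<^esub> w \<otimes>\<^bsub>G\<^esub> g))"
      using W hG g coeff cancel by (intro R.finsum_cong') (auto simp: subset_eq)
    finally have "(b \<otimes>\<^bsub>N\<^esub> c) (?f g) = (\<Oplus>\<^bsub>R\<^esub>w\<in>W. b (?f w) \<otimes>\<^bsub>R\<^esub> c (inv\<^bsub>G\<^esub> w \<otimes>\<^bsub>G\<^esub> g))" .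
    moreover have "b (?f w) \<in> carrier R" "c (inv\<^bsub>G\<^esub> w \<otimes>\<^bsub>G\<^esub> g) \<in> carrier R" if "w \<in> W" for w
      using that W hG g coeff by auto
    ultimately have "a h \<otimes>\<^bsub>R\<^esub> (b \<otimes>\<^bsub>N\<^esub> c) (?f g) =
        (\<Oplus>\<^bsub>R\<^esub>w\<in>W. a h \<otimes>\<^bsub>R\<^esub> (b (?f w) \<otimes>\<^bsub>R\<^esub> c (inv\<^bsub>G\<^esub> w \<otimes>\<^bsub>G\<^esub> g)))"
      using coeff(1)[OF hG] W(1) by (simp add: R.finsum_rdistr Pi_def)
    also have "\<dots> = (\<Oplus>\<^bsub>R\<^esub>w\<in>W. a h \<otimes>\<^bsub>R\<^esub> b (?f w) \<otimes>\<^bsub>R\<^esub> c (inv\<^bsub>G\<^esub> w \<otimes>\<^bsub>G\<^esub> g))"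
      using W hG g coeff by (intro R.finsum_cong') (auto simp: subset_eq R.m_assoc)
    finally show "(\<Oplus>\<^bsub>R\<^esub>w\<in>W. a h \<otimes>\<^bsub>R\<^esub> b (?f w) \<otimes>\<^bsub>R\<^esub> c (inv\<^bsub>G\<^esub> w \<otimes>\<^bsub>G\<^esub> g)) =
      a h \<otimes>\<^bsub>R\<^esub> (b \<otimes>\<^bsub>N\<^esub> c) (?f g)" ..
  qed simp
  also have "\<dots> = (a \<otimes>\<^bsub>N\<^esub> (b \<otimes>\<^bsub>N\<^esub> c)) g"
  proof (rule novikov_mult_sum[OF a bc g U, symmetric])
    fix h assume h: "h \<in> carrier G" "a h \<noteq> \<zero>\<^bsub>R\<^esub>" "(b \<otimes>\<^bsub>N\<^esub> c) (inv\<^bsub>G\<^esub> h \<otimes>\<^bsub>G\<^esub> g) \<noteq> \<zero>\<^bsub>R\<^esub>"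
    have "inv\<^bsub>G\<^esub> h \<otimes>\<^bsub>G\<^esub> g \<in> carrier G" using h g by simp
    then obtain k where k: "k \<in> carrier G" "b k \<noteq> \<zero>\<^bsub>R\<^esub>" "c (inv\<^bsub>G\<^esub> k \<otimes>\<^bsub>G\<^esub> (inv\<^bsub>G\<^esub> h \<otimes>\<^bsub>G\<^esub> g)) \<noteq> \<zero>\<^bsub>R\<^esub>"
      using novikov_mult_support[OF b c _ h(3)] by blast
    show "h \<in> U"
    proof (rule inU[of "h \<otimes>\<^bsub>G\<^esub> k" h])
      show "b (inv\<^bsub>G\<^esub> h \<otimes>\<^bsub>G\<^esub> (h \<otimes>\<^bsub>G\<^esub> k)) \<noteq> \<zero>\<^bsub>R\<^esub>" using h k by (simp add: G.m_assoc[symmetric])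
      show "c (inv\<^bsub>G\<^esub> (h \<otimes>\<^bsub>G\<^esub> k) \<otimes>\<^bsub>G\<^esub> g) \<noteq> \<zero>\<^bsub>R\<^esub>" using h k g by (simp add: G.inv_mult_group G.m_assoc)
    qed (use h k in auto)
  qed
  finally show "((a \<otimes>\<^bsub>N\<^esub> b) \<otimes>\<^bsub>N\<^esub> c) g = (a \<otimes>\<^bsub>N\<^esub> (b \<otimes>\<^bsub>N\<^esub> c)) g" .
qed

lemma novikov_abelian_group: "abelian_group N"
proof (rule abelian_groupI)
  fix a b c assume a: "a \<in> carrier N" and b: "b \<in> carrier N" and c: "c \<in> carrier N"
  show "a \<oplus>\<^bsub>N\<^esub> b \<oplus>\<^bsub>N\<^esub> c = a \<oplus>\<^bsub>N\<^esub> (b \<oplus>\<^bsub>N\<^esub> c)"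
    using a b c by (intro novikov_eqI novikov_add_closed) (auto simp: novikov_add novikov_coeff R.a_assoc)
next
  fix a b assume a: "a \<in> carrier N" and b: "b \<in> carrier N"
  show "a \<oplus>\<^bsub>N\<^esub> b = b \<oplus>\<^bsub>N\<^esub> a"
    using a b by (intro novikov_eqI novikov_add_closed) (auto simp: novikov_add novikov_coeff R.a_comm)
next
  fix a assume a: "a \<in> carrier N"
  show "\<zero>\<^bsub>N\<^esub> \<oplus>\<^bsub>N\<^esub> a = a"
    using a novikov_zero_closed
    by (intro novikov_eqI novikov_add_closed) (auto simp: novikov_add novikov_zero novikov_coeff)
  show "\<exists>b\<in>carrier N. b \<oplus>\<^bsub>N\<^esub> a = \<zero>\<^bsub>N\<^esub>"
    using neg_coeffs_closed[OF a] neg_coeffs_add[OF a] by blast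
qed (auto intro: novikov_add_closed novikov_zero_closed)

lemma novikov_monoid: "Group.monoid N"
proof (rule Group.monoidI)
  fix a assume a: "a \<in> carrier N"
  show "\<one>\<^bsub>N\<^esub> \<otimes>\<^bsub>N\<^esub> a = a"
  proof (rule novikov_eqI[OF novikov_mult_closed[OF novikov_one_closed a] a])
    fix g assume g: "g \<in> carrier G"
    have "(\<one>\<^bsub>N\<^esub> \<otimes>\<^bsub>N\<^esub> a) g = (\<Oplus>\<^bsub>R\<^esub>h\<in>{\<one>\<^bsub>G\<^esub>}. \<one>\<^bsub>N\<^esub> h \<otimes>\<^bsub>R\<^esub> a (inv\<^bsub>G\<^esub> h \<otimes>\<^bsub>G\<^esub> g))"
      by (rule novikov_mult_sum[OF novikov_one_closed a g]) (auto simp: novikov_one split: if_splits)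
    then show "(\<one>\<^bsub>N\<^esub> \<otimes>\<^bsub>N\<^esub> a) g = a g" using g novikov_coeff[OF a g] by (simp add: novikov_one)
  qed
  show "a \<otimes>\<^bsub>N\<^esub> \<one>\<^bsub>N\<^esub> = a"
  proof (rule novikov_eqI[OF novikov_mult_closed[OF a novikov_one_closed] a])
    fix g assume g: "g \<in> carrier G"
    have "(a \<otimes>\<^bsub>N\<^esub> \<one>\<^bsub>N\<^esub>) g = (\<Oplus>\<^bsub>R\<^esub>h\<in>{g}. a h \<otimes>\<^bsub>R\<^esub> \<one>\<^bsub>N\<^esub> (inv\<^bsub>G\<^esub> h \<otimes>\<^bsub>G\<^esub> g))"
    proof (rule novikov_mult_sum[OF a novikov_one_closed g])
      fix h assume h: "h \<in> carrier G" "\<one>\<^bsub>N\<^esub> (inv\<^bsub>G\<^esub> h \<otimes>\<^bsub>G\<^esub> g) \<noteq> \<zero>\<^bsub>R\<^esub>"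
      then have "inv\<^bsub>G\<^esub> h \<otimes>\<^bsub>G\<^esub> g = \<one>\<^bsub>G\<^esub>" using g by (simp add: novikov_one split: if_splits)
      then show "h \<in> {g}" using h g by (metis G.inv_closed G.inv_equality G.inv_inv singletonI)
    qed (use g in auto)
    then show "(a \<otimes>\<^bsub>N\<^esub> \<one>\<^bsub>N\<^esub>) g = a g" using g novikov_coeff[OF a g] by (simp add: novikov_one)
  qed
qed (auto intro: novikov_mult_closed novikov_one_closed novikov_assoc)

sublocale nov: ring N
proof (rule ringI[OF novikov_abelian_group novikov_monoid])
  fix a b c assume a: "a \<in> carrier N" and b: "b \<in> carrier N" and c: "c \<in> carrier N"
  note cl = novikov_add_closed novikov_mult_closed
  show "(a \<oplus>\<^bsub>N\<^esub> b) \<otimes>\<^bsub>N\<^esub> c = a \<otimes>\<^bsub>N\<^esub> c \<oplus>\<^bsub>N\<^esub> b \<otimes>\<^bsub>N\<^esub> c"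
  proof (rule novikov_eqI)
    fix g assume g: "g \<in> carrier G"
    define H where "H = {h \<in> carrier G. a h \<noteq> \<zero>\<^bsub>R\<^esub> \<and> c (inv\<^bsub>G\<^esub> h \<otimes>\<^bsub>G\<^esub> g) \<noteq> \<zero>\<^bsub>R\<^esub>} \<union>
      {h \<in> carrier G. b h \<noteq> \<zero>\<^bsub>R\<^esub> \<and> c (inv\<^bsub>G\<^esub> h \<otimes>\<^bsub>G\<^esub> g) \<noteq> \<zero>\<^bsub>R\<^esub>}"
    have H: "finite H" "H \<subseteq> carrier G"
      unfolding H_def using convolution_finite[OF a c g] convolution_finite[OF b c g] by auto
    have k: "a h \<in> carrier R" "b h \<in> carrier R" "c (inv\<^bsub>G\<^esub> h \<otimes>\<^bsub>G\<^esub> g) \<in> carrier R" if "h \<in> H" for h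
      using that H g a b c by (auto simp: subset_eq intro: novikov_coeff)
    have "((a \<oplus>\<^bsub>N\<^esub> b) \<otimes>\<^bsub>N\<^esub> c) g = (\<Oplus>\<^bsub>R\<^esub>h\<in>H. (a \<oplus>\<^bsub>N\<^esub> b) h \<otimes>\<^bsub>R\<^esub> c (inv\<^bsub>G\<^esub> h \<otimes>\<^bsub>G\<^esub> g))"
      by (rule novikov_mult_sum[OF cl(1)[OF a b] c g H]) (auto simp: H_def novikov_add)
    also have "\<dots> = (\<Oplus>\<^bsub>R\<^esub>h\<in>H. a h \<otimes>\<^bsub>R\<^esub> c (inv\<^bsub>G\<^esub> h \<otimes>\<^bsub>G\<^esub> g) \<oplus>\<^bsub>R\<^esub> b h \<otimes>\<^bsub>R\<^esub> c (inv\<^bsub>G\<^esub> h \<otimes>\<^bsub>G\<^esub> g))"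
      using H(2) k by (intro R.finsum_cong') (auto simp: novikov_add subset_eq R.l_distr)
    also have "\<dots> = (\<Oplus>\<^bsub>R\<^esub>h\<in>H. a h \<otimes>\<^bsub>R\<^esub> c (inv\<^bsub>G\<^esub> h \<otimes>\<^bsub>G\<^esub> g)) \<oplus>\<^bsub>R\<^esub> (\<Oplus>\<^bsub>R\<^esub>h\<in>H. b h \<otimes>\<^bsub>R\<^esub> c (inv\<^bsub>G\<^esub> h \<otimes>\<^bsub>G\<^esub> g))"
      using k by (intro R.finsum_addf) auto
    also have "(\<Oplus>\<^bsub>R\<^esub>h\<in>H. a h \<otimes>\<^bsub>R\<^esub> c (inv\<^bsub>G\<^esub> h \<otimes>\<^bsub>G\<^esub> g)) = (a \<otimes>\<^bsub>N\<^esub> c) g"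
      by (rule novikov_mult_sum[OF a c g H, symmetric]) (auto simp: H_def)
    also have "(\<Oplus>\<^bsub>R\<^esub>h\<in>H. b h \<otimes>\<^bsub>R\<^esub> c (inv\<^bsub>G\<^esub> h \<otimes>\<^bsub>G\<^esub> g)) = (b \<otimes>\<^bsub>N\<^esub> c) g"
      by (rule novikov_mult_sum[OF b c g H, symmetric]) (auto simp: H_def)
    finally show "((a \<oplus>\<^bsub>N\<^esub> b) \<otimes>\<^bsub>N\<^esub> c) g = (a \<otimes>\<^bsub>N\<^esub> c \<oplus>\<^bsub>N\<^esub> b \<otimes>\<^bsub>N\<^esub> c) g"
      using g by (simp add: novikov_add)
  qed (use a b c in \<open>auto intro: cl\<close>)
  show "c \<otimes>\<^bsub>N\<^esub> (a \<oplus>\<^bsub>N\<^esub> b) = c \<otimes>\<^bsub>N\<^esub> a \<oplus>\<^bsub>N\<^esub> c \<otimes>\<^bsub>N\<^esub> b"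
  proof (rule novikov_eqI)
    fix g assume g: "g \<in> carrier G"
    define H where "H = {h \<in> carrier G. c h \<noteq> \<zero>\<^bsub>R\<^esub> \<and> a (inv\<^bsub>G\<^esub> h \<otimes>\<^bsub>G\<^esub> g) \<noteq> \<zero>\<^bsub>R\<^esub>} \<union>
      {h \<in> carrier G. c h \<noteq> \<zero>\<^bsub>R\<^esub> \<and> b (inv\<^bsub>G\<^esub> h \<otimes>\<^bsub>G\<^esub> g) \<noteq> \<zero>\<^bsub>R\<^esub>}"
    have H: "finite H" "H \<subseteq> carrier G"
      unfolding H_def using convolution_finite[OF c a g] convolution_finite[OF c b g] by auto
    have k: "c h \<in> carrier R" "a (inv\<^bsub>G\<^esub> h \<otimes>\<^bsub>G\<^esub> g) \<in> carrier R" "b (inv\<^bsub>G\<^esub> h \<otimes>\<^bsub>G\<^esub> g) \<in> carrier R"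
      if "h \<in> H" for h
      using that H g a b c by (auto simp: subset_eq intro: novikov_coeff)
    have "(c \<otimes>\<^bsub>N\<^esub> (a \<oplus>\<^bsub>N\<^esub> b)) g = (\<Oplus>\<^bsub>R\<^esub>h\<in>H. c h \<otimes>\<^bsub>R\<^esub> (a \<oplus>\<^bsub>N\<^esub> b) (inv\<^bsub>G\<^esub> h \<otimes>\<^bsub>G\<^esub> g))"
      using g by (intro novikov_mult_sum[OF c cl(1)[OF a b] g H]) (auto simp: H_def novikov_add)
    also have "\<dots> = (\<Oplus>\<^bsub>R\<^esub>h\<in>H. c h \<otimes>\<^bsub>R\<^esub> a (inv\<^bsub>G\<^esub> h \<otimes>\<^bsub>G\<^esub> g) \<oplus>\<^bsub>R\<^esub> c h \<otimes>\<^bsub>R\<^esub> b (inv\<^bsub>G\<^esub> h \<otimes>\<^bsub>G\<^esub> g))"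
      using H(2) k g by (intro R.finsum_cong') (auto simp: novikov_add subset_eq R.r_distr)
    also have "\<dots> = (\<Oplus>\<^bsub>R\<^esub>h\<in>H. c h \<otimes>\<^bsub>R\<^esub> a (inv\<^bsub>G\<^esub> h \<otimes>\<^bsub>G\<^esub> g)) \<oplus>\<^bsub>R\<^esub> (\<Oplus>\<^bsub>R\<^esub>h\<in>H. c h \<otimes>\<^bsub>R\<^esub> b (inv\<^bsub>G\<^esub> h \<otimes>\<^bsub>G\<^esub> g))"
      using k by (intro R.finsum_addf) auto
    also have "(\<Oplus>\<^bsub>R\<^esub>h\<in>H. c h \<otimes>\<^bsub>R\<^esub> a (inv\<^bsub>G\<^esub> h \<otimes>\<^bsub>G\<^esub> g)) = (c \<otimes>\<^bsub>N\<^esub> a) g"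
      by (rule novikov_mult_sum[OF c a g H, symmetric]) (auto simp: H_def)
    also have "(\<Oplus>\<^bsub>R\<^esub>h\<in>H. c h \<otimes>\<^bsub>R\<^esub> b (inv\<^bsub>G\<^esub> h \<otimes>\<^bsub>G\<^esub> g)) = (c \<otimes>\<^bsub>N\<^esub> b) g"
      by (rule novikov_mult_sum[OF c b g H, symmetric]) (auto simp: H_def)
    finally show "(c \<otimes>\<^bsub>N\<^esub> (a \<oplus>\<^bsub>N\<^esub> b)) g = (c \<otimes>\<^bsub>N\<^esub> a \<oplus>\<^bsub>N\<^esub> c \<otimes>\<^bsub>N\<^esub> b) g"
      using g by (simp add: novikov_add)
  qed (use a b c in \<open>auto intro: cl\<close>)
qed

lemma novikov_minus: "\<lbrakk>a \<in> carrier N; g \<in> carrier G\<rbrakk> \<Longrightarrow> (\<ominus>\<^bsub>N\<^esub> a) g = \<ominus>\<^bsub>R\<^esub> a g"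
proof -
  assume a: "a \<in> carrier N" and g: "g \<in> carrier G"
  have "\<ominus>\<^bsub>N\<^esub> a = neg_coeffs a"
    using a neg_coeffs_closed[OF a] neg_coeffs_add[OF a] by (intro nov.minus_equality)
  then show ?thesis using g by (simp add: neg_coeffs_def)
qed

lemma novikov_diff: "\<lbrakk>a \<in> carrier N; b \<in> carrier N; g \<in> carrier G\<rbrakk> \<Longrightarrow> (a \<ominus>\<^bsub>N\<^esub> b) g = a g \<ominus>\<^bsub>R\<^esub> b g"
  by (simp add: a_minus_def novikov_add novikov_minus)

definition nov_filt :: "real \<Rightarrow> ('g \<Rightarrow> 'r) set" where
  "nov_filt s = {a \<in> carrier N. \<forall>g\<in>carrier G. a g \<noteq> \<zero>\<^bsub>R\<^esub> \<longrightarrow> s \<le> \<phi> g}"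

lemma nov_filtI: "\<lbrakk>a \<in> carrier N; \<And>g. \<lbrakk>g \<in> carrier G; \<phi> g < s\<rbrakk> \<Longrightarrow> a g = \<zero>\<^bsub>R\<^esub>\<rbrakk> \<Longrightarrow> a \<in> nov_filt s"
  unfolding nov_filt_def by force

lemma nov_filtD: "\<lbrakk>a \<in> nov_filt s; g \<in> carrier G; \<phi> g < s\<rbrakk> \<Longrightarrow> a g = \<zero>\<^bsub>R\<^esub>"
  unfolding nov_filt_def by force

lemma nov_filt_carrier: "a \<in> nov_filt s \<Longrightarrow> a \<in> carrier N"
  by (simp add: nov_filt_def)

lemma diff_in_nov_filt:
  assumes "a \<in> carrier N" "b \<in> carrier N" "\<And>g. \<lbrakk>g \<in> carrier G; \<phi> g < s\<rbrakk> \<Longrightarrow> a g = b g"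
  shows "a \<ominus>\<^bsub>N\<^esub> b \<in> nov_filt s"
proof (rule nov_filtI)
  fix g assume g: "g \<in> carrier G" "\<phi> g < s"
  show "(a \<ominus>\<^bsub>N\<^esub> b) g = \<zero>\<^bsub>R\<^esub>"
    unfolding novikov_diff[OF assms(1,2) g(1)] assms(3)[OF g]
    using novikov_coeff[OF assms(2) g(1)] by (simp add: a_minus_def R.r_neg)
qed (use assms in simp)

text \<open>Below level \<open>i \<delta>\<close> the coefficients of \<open>p j\<close> do not depend on \<open>j \<ge> i\<close>.  The limit takes the eventual value at
each \<open>g\<close>; below any level it agrees with a single \<open>p i\<close>, so its support has the required finiteness.\<close>

lemma novikov_complete:
  assumes "\<delta> > 0" and p: "\<And>i::nat. p i \<in> carrier N"
    and step: "\<And>i. p (Suc i) \<ominus>\<^bsub>N\<^esub> p i \<in> nov_filt (real i * \<delta>)"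
  shows "\<exists>b\<in>carrier N. \<forall>i. b \<ominus>\<^bsub>N\<^esub> p i \<in> nov_filt (real i * \<delta>)"
proof -
  have stable: "p j g = p i g" if "g \<in> carrier G" "\<phi> g < real i * \<delta>" "i \<le> j" for i j g
    using that(3)
  proof (induction j rule: dec_induct)
    case (step j)
    have "\<phi> g < real j * \<delta>"
      using that(2) step.hyps(1) \<open>\<delta> > 0\<close> by (meson less_le_trans mult_right_mono of_nat_le_iff less_imp_le)
    from nov_filtD[OF assms(3) that(1) this] have "p (Suc j) g \<ominus>\<^bsub>R\<^esub> p j g = \<zero>\<^bsub>R\<^esub>"
      using novikov_diff[OF p p that(1)] by simp
    then show ?case using step.IH novikov_coeff[OF p that(1)] by simp
  qed simp
  \<comment> \<open>From the index \<open>K g\<close> on, the coefficient at \<open>g\<close> is constant.\<close>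
  define K where "K g = (LEAST i::nat. \<phi> g < real i * \<delta>)" for g
  have K: "\<phi> g < real (K g) * \<delta>" "\<And>i. \<phi> g < real i * \<delta> \<Longrightarrow> K g \<le> i" for g
    unfolding K_def using reals_Archimedean3[OF \<open>\<delta> > 0\<close>] by (auto intro: LeastI_ex Least_le)
  define b where "b = (\<lambda>g\<in>carrier G. p (K g) g)"
  have bp: "b g = p i g" if "g \<in> carrier G" "\<phi> g < real i * \<delta>" for g i
    using stable[OF that(1) K(1) K(2)[OF that(2)]] that(1) by (simp add: b_def)
  have "b \<in> carrier N"
    unfolding novikov_carrier
  proof (intro conjI allI)
    show "b \<in> carrier G \<rightarrow>\<^sub>E carrier R" using novikov_coeff[OF p] by (auto simp: b_def)
    fix s
    obtain i :: nat where "s < real i * \<delta>" using reals_Archimedean3[OF \<open>\<delta> > 0\<close>] by blast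
    then have "{g \<in> carrier G. b g \<noteq> \<zero>\<^bsub>R\<^esub> \<and> \<phi> g < s} \<subseteq> {g \<in> carrier G. p i g \<noteq> \<zero>\<^bsub>R\<^esub> \<and> \<phi> g < s}"
      using bp[of _ i] by fastforce
    then show "finite {g \<in> carrier G. b g \<noteq> \<zero>\<^bsub>R\<^esub> \<and> \<phi> g < s}"
      using novikov_finite[OF p] by (rule finite_subset)
  qed
  moreover from this have "b \<ominus>\<^bsub>N\<^esub> p i \<in> nov_filt (real i * \<delta>)" for i
    using p bp by (intro diff_in_nov_filt) auto
  ultimately show ?thesis by blast
qed

sublocale nov: complete_filtered_ring N nov_filt
proof (intro complete_filtered_ring.intro complete_filtered_ring_axioms.intro nov.ring_axioms)
  fix s t :: real
  show "subgroup (nov_filt s) (add_monoid N)"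
  proof (rule nov.add.subgroupI)
    show "nov_filt s \<subseteq> carrier N" by (auto intro: nov_filt_carrier)
    have "\<zero>\<^bsub>N\<^esub> \<in> nov_filt s" by (intro nov_filtI) (auto simp: novikov_zero)
    then show "nov_filt s \<noteq> {}" by blast
  next
    fix a assume a: "a \<in> nov_filt s"
    show "\<ominus>\<^bsub>N\<^esub> a \<in> nov_filt s"
      using nov_filt_carrier[OF a] nov_filtD[OF a] by (intro nov_filtI) (auto simp: novikov_minus)
  next
    fix a b assume a: "a \<in> nov_filt s" and b: "b \<in> nov_filt s"
    show "a \<oplus>\<^bsub>N\<^esub> b \<in> nov_filt s"
      using nov_filt_carrier[OF a] nov_filtD[OF a] nov_filt_carrier[OF b] nov_filtD[OF b]
      by (intro nov_filtI) (auto simp: novikov_add)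
  qed
  show "s \<le> t \<Longrightarrow> nov_filt t \<subseteq> nov_filt s" by (auto simp: nov_filt_def)
next
  fix a b s t assume a: "a \<in> nov_filt s" and b: "b \<in> nov_filt t"
  note ac = nov_filt_carrier[OF a] and bc = nov_filt_carrier[OF b]
  show "a \<otimes>\<^bsub>N\<^esub> b \<in> nov_filt (s + t)"
    unfolding nov_filt_def
  proof (intro CollectI conjI ballI impI novikov_mult_closed ac bc)
    fix g assume g: "g \<in> carrier G" "(a \<otimes>\<^bsub>N\<^esub> b) g \<noteq> \<zero>\<^bsub>R\<^esub>"
    obtain h where h: "h \<in> carrier G" "a h \<noteq> \<zero>\<^bsub>R\<^esub>" "b (inv\<^bsub>G\<^esub> h \<otimes>\<^bsub>G\<^esub> g) \<noteq> \<zero>\<^bsub>R\<^esub>"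
      using novikov_mult_support[OF ac bc g] .
    have "s \<le> \<phi> h" "t \<le> \<phi> (inv\<^bsub>G\<^esub> h \<otimes>\<^bsub>G\<^esub> g)"
      using a b h g by (auto simp: nov_filt_def)
    then show "s + t \<le> \<phi> g" using h g by (simp add: char_inv_mult)
  qed
next
  show "\<one>\<^bsub>N\<^esub> \<in> nov_filt 0"
    using novikov_one_closed by (auto simp: nov_filt_def novikov_one char_one split: if_splits)
next
  fix a assume a: "a \<in> carrier N"
  obtain s where "\<And>g. \<lbrakk>g \<in> carrier G; a g \<noteq> \<zero>\<^bsub>R\<^esub>\<rbrakk> \<Longrightarrow> s \<le> \<phi> g" using novikov_bounded[OF a] by blast
  then show "\<exists>s. a \<in> nov_filt s" using a by (intro exI[of _ s]) (auto simp: nov_filt_def)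
next
  fix a assume a: "\<And>s. a \<in> nov_filt s"
  show "a = \<zero>\<^bsub>N\<^esub>"
  proof (rule novikov_eqI[OF nov_filt_carrier[OF a] novikov_zero_closed])
    fix g assume g: "g \<in> carrier G"
    show "a g = \<zero>\<^bsub>N\<^esub> g" using nov_filtD[OF a[of "\<phi> g + 1"] g] novikov_zero[OF g] by simp
  qed
next
  fix \<delta> :: real and p :: "nat \<Rightarrow> _"
  assume "\<delta> > 0" "\<And>i::nat. p i \<in> carrier N" "\<And>i. p (Suc i) \<ominus>\<^bsub>N\<^esub> p i \<in> nov_filt (real i * \<delta>)"
  then show "\<exists>b\<in>carrier N. \<forall>i. b \<ominus>\<^bsub>N\<^esub> p i \<in> nov_filt (real i * \<delta>)" by (rule novikov_complete)
qed

lemma group_ring_carrier: "a \<in> carrier (group_ring R G) \<longleftrightarrow> a \<in> carrier G \<rightarrow>\<^sub>E carrier R \<and>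
    finite {g \<in> carrier G. a g \<noteq> \<zero>\<^bsub>R\<^esub>}"
  by (simp add: group_ring_def formal_sum_ring_def)

lemma group_ring_novikov: "group_ring R G = N\<lparr>carrier := carrier (group_ring R G)\<rparr>"
  by (simp add: group_ring_def novikov_ring_def formal_sum_ring_def)

lemma group_ring_subset: "carrier (group_ring R G) \<subseteq> carrier N"
proof
  fix a assume a: "a \<in> carrier (group_ring R G)"
  have "finite {g \<in> carrier G. a g \<noteq> \<zero>\<^bsub>R\<^esub> \<and> \<phi> g < s}" for s
    by (rule finite_subset[of _ "{g \<in> carrier G. a g \<noteq> \<zero>\<^bsub>R\<^esub>}"]) (use a in \<open>auto simp: group_ring_carrier\<close>)
  with a show "a \<in> carrier N" by (auto simp: group_ring_carrier novikov_carrier)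
qed

text \<open>Only closure under additive inverses needs an argument: the negatives taken in the two rings coincide.\<close>

lemma group_ring_subring:
  assumes "ring (group_ring R G)"
  shows "subring (carrier (group_ring R G)) N"
proof -
  interpret S: ring "group_ring R G" by fact
  have mult: "a \<otimes>\<^bsub>group_ring R G\<^esub> b = a \<otimes>\<^bsub>N\<^esub> b" and add: "a \<oplus>\<^bsub>group_ring R G\<^esub> b = a \<oplus>\<^bsub>N\<^esub> b"
    and one: "\<one>\<^bsub>group_ring R G\<^esub> = \<one>\<^bsub>N\<^esub>" and zero: "\<zero>\<^bsub>group_ring R G\<^esub> = \<zero>\<^bsub>N\<^esub>" for a b
    by (simp_all add: group_ring_def novikov_ring_def formal_sum_ring_def)
  show ?thesis
  proof (rule nov.subringI[OF group_ring_subset])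
    fix a assume a: "a \<in> carrier (group_ring R G)"
    have "\<ominus>\<^bsub>group_ring R G\<^esub> a \<oplus>\<^bsub>N\<^esub> a = \<zero>\<^bsub>N\<^esub>"
      using S.l_neg[OF a] by (simp add: add zero)
    then have "\<ominus>\<^bsub>N\<^esub> a = \<ominus>\<^bsub>group_ring R G\<^esub> a"
      using a S.a_inv_closed[OF a] group_ring_subset by (intro nov.minus_equality) auto
    then show "\<ominus>\<^bsub>N\<^esub> a \<in> carrier (group_ring R G)" using S.a_inv_closed[OF a] by simp
  qed (use S.m_closed S.a_closed S.one_closed in \<open>auto simp: mult add one\<close>)
qed

text \<open>Truncation at level \<open>t\<close> leaves a finite support, by the very definition of the Novikov ring.\<close>

lemma group_ring_dense:
  assumes a: "a \<in> carrier N"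
  shows "\<exists>a'\<in>carrier (group_ring R G). a \<ominus>\<^bsub>N\<^esub> a' \<in> nov_filt t"
proof
  define a' where "a' = (\<lambda>g\<in>carrier G. if \<phi> g < t then a g else \<zero>\<^bsub>R\<^esub>)"
  have "finite {g \<in> carrier G. a' g \<noteq> \<zero>\<^bsub>R\<^esub>}"
    by (rule finite_subset[OF _ novikov_finite[OF a, of t]]) (auto simp: a'_def split: if_splits)
  then show a': "a' \<in> carrier (group_ring R G)"
    using novikov_coeff[OF a] unfolding group_ring_carrier by (auto simp: a'_def)
  then have "a' \<in> carrier N" using group_ring_subset by auto
  with a show "a \<ominus>\<^bsub>N\<^esub> a' \<in> nov_filt t" by (rule diff_in_nov_filt) (simp add: a'_def)
qed

end

section \<open>Homology of a complex of abelian groups\<close>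

lemma trivial_homology_iff:
  fixes T :: "int \<Rightarrow> ('t, 'y) monoid_scheme" and \<delta> :: "int \<Rightarrow> 't \<Rightarrow> 't"
  assumes T: "\<And>k. comm_group (T k)" and hom: "\<And>k. \<delta> k \<in> hom (T k) (T (k - 1))"
    and dd: "\<And>k x. x \<in> carrier (T k) \<Longrightarrow> \<delta> (k - 1) (\<delta> k x) = \<one>\<^bsub>T (k - 2)\<^esub>"
  shows "trivial_group (homology T \<delta> j) \<longleftrightarrow>
    (\<forall>x\<in>carrier (T j). \<delta> j x = \<one>\<^bsub>T (j - 1)\<^esub> \<longrightarrow> x \<in> \<delta> (j + 1) ` carrier (T (j + 1)))"
proof -
  interpret Tj: comm_group "T j" by (rule T)
  have gh: "group_hom (T k) (T (k - 1)) (\<delta> k)" for k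
    using T[of k] T[of "k - 1"] hom[of k] by (simp add: group_hom_def group_hom_axioms_def comm_group_def)
  define K where "K = kernel (T j) (T (j - 1)) (\<delta> j)"
  define H where "H = \<delta> (j + 1) ` carrier (T (j + 1))"
  have K: "subgroup K (T j)" unfolding K_def by (rule group_hom.subgroup_kernel[OF gh])
  have H: "subgroup H (T j)" using group_hom.img_is_subgroup[OF gh, of "j + 1"] by (simp add: H_def)
  have HK: "H \<subseteq> K"
    using dd[of _ "j + 1"] subgroup.subset[OF H] by (auto simp: H_def K_def kernel_def)
  interpret Q: comm_group "(T j)\<lparr>carrier := K\<rparr>" 
    by (rule group.group_comm_groupI[OF subgroup.subgroup_is_group[OF K Tj.group_axioms]])
      (use subgroup.subset[OF K] Tj.m_comm in auto)
  have HQ: "subgroup H ((T j)\<lparr>carrier := K\<rparr>)" by (rule Tj.subgroup_incl[OF H K HK])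
  have hom_eq: "homology T \<delta> j = (T j)\<lparr>carrier := K\<rparr> Mod H" by (simp add: homology_def K_def H_def)
  interpret F: comm_group "(T j)\<lparr>carrier := K\<rparr> Mod H" by (rule Q.abelian_FactGroup[OF HQ])
  have "trivial_group (homology T \<delta> j) \<longleftrightarrow> (\<forall>x\<in>K. H #>\<^bsub>(T j)\<lparr>carrier := K\<rparr>\<^esub> x = H)"
    unfolding hom_eq F.trivial_group_subset by (auto simp: carrier_FactGroup)
  also have "\<dots> \<longleftrightarrow> (\<forall>x\<in>K. x \<in> H)"
    using Q.coset_join1[OF _ _ HQ] Q.coset_join2[OF _ HQ] by auto
  finally show ?thesis by (auto simp: K_def H_def kernel_def)
qed

section \<open>Coordinates of a free module\<close>

definition vec_group :: "('a, 'x) ring_scheme \<Rightarrow> 'a set \<Rightarrow> 'i set \<Rightarrow> ('i \<Rightarrow> 'a) monoid" where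
  "vec_group A T B = \<lparr>carrier = vec A T B, monoid.mult = vadd A, one = (\<lambda>_. \<zero>\<^bsub>A\<^esub>)\<rparr>"

lemma (in ring) vec_group_comm_group:
  assumes T: "subring T R"
  shows "comm_group (vec_group R T B)"
proof (rule comm_groupI)
  have TR: "T \<subseteq> carrier R" by (rule subringE(1)[OF T])
  have c: "x i \<in> carrier R" if "x \<in> vec R T B" for x :: "'c \<Rightarrow> 'a" and i
    using vecD(1)[OF that] TR by auto
  fix x y z :: "'c \<Rightarrow> 'a"
  assume x: "x \<in> carrier (vec_group R T B)"
  show "\<exists>y\<in>carrier (vec_group R T B). y \<otimes>\<^bsub>vec_group R T B\<^esub> x = \<one>\<^bsub>vec_group R T B\<^esub>"
  proof
    show "vdiff R (\<lambda>_. \<zero>) x \<in> carrier (vec_group R T B)"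
      using vdiff_vec[OF T zero_vec[OF T]] x by (simp add: vec_group_def)
    show "vdiff R (\<lambda>_. \<zero>) x \<otimes>\<^bsub>vec_group R T B\<^esub> x = \<one>\<^bsub>vec_group R T B\<^esub>"
      using x c[of x] by (auto simp: vec_group_def vdiff_def vadd_def a_minus_def l_neg)
  qed
  assume y: "y \<in> carrier (vec_group R T B)"
  show "x \<otimes>\<^bsub>vec_group R T B\<^esub> y \<in> carrier (vec_group R T B)"
    using vadd_vec[OF T] x y by (simp add: vec_group_def)
  show "x \<otimes>\<^bsub>vec_group R T B\<^esub> y = y \<otimes>\<^bsub>vec_group R T B\<^esub> x"
    using x y c[of x] c[of y] by (auto simp: vec_group_def vadd_def a_comm)
  assume z: "z \<in> carrier (vec_group R T B)"
  show "x \<otimes>\<^bsub>vec_group R T B\<^esub> y \<otimes>\<^bsub>vec_group R T B\<^esub> z = x \<otimes>\<^bsub>vec_group R T B\<^esub> (y \<otimes>\<^bsub>vec_group R T B\<^esub> z)"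
    using x y z c[of x] c[of y] c[of z] by (auto simp: vec_group_def vadd_def a_assoc)
next
  fix x assume "x \<in> carrier (vec_group R T B)"
  then have "x i \<in> carrier R" for i using vecD(1)[of x R T B i] subringE(1)[OF T] by (auto simp: vec_group_def)
  then show "\<one>\<^bsub>vec_group R T B\<^esub> \<otimes>\<^bsub>vec_group R T B\<^esub> x = x"
    by (auto simp: vec_group_def vadd_def)
qed (use zero_vec[OF T] in \<open>simp add: vec_group_def\<close>)

text \<open>A free right module over a subring \<open>S\<close> of \<open>N\<close>, with a chosen basis.  The scalar ring is kept as a carrier
inside \<open>N\<close> because coordinates are multiplied by elements of \<open>N\<close> later on.\<close>

locale based_module = ring N
  for N :: "'a ring" (structure) +
  fixes S :: "'a set" and M :: "('a, 'm, 'z) module_scheme" and B :: "'m set"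
  assumes subring_S: "subring S N"
    and module: "right_module (N\<lparr>carrier := S\<rparr>) M"
    and basis: "is_basis (N\<lparr>carrier := S\<rparr>) M B"
begin

sublocale M: abelian_group M
  using module by (rule right_module.axioms(2))

lemma S_carrier: "a \<in> S \<Longrightarrow> a \<in> carrier N"
  using subringE(1)[OF subring_S] by auto

lemma smult_closed: "\<lbrakk>a \<in> S; x \<in> carrier M\<rbrakk> \<Longrightarrow> a \<odot>\<^bsub>M\<^esub> x \<in> carrier M"
  and smult_add: "\<lbrakk>a \<in> S; b \<in> S; x \<in> carrier M\<rbrakk> \<Longrightarrow> (a \<oplus> b) \<odot>\<^bsub>M\<^esub> x = a \<odot>\<^bsub>M\<^esub> x \<oplus>\<^bsub>M\<^esub> b \<odot>\<^bsub>M\<^esub> x"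
  and add_smult: "\<lbrakk>a \<in> S; x \<in> carrier M; y \<in> carrier M\<rbrakk> \<Longrightarrow> a \<odot>\<^bsub>M\<^esub> (x \<oplus>\<^bsub>M\<^esub> y) = a \<odot>\<^bsub>M\<^esub> x \<oplus>\<^bsub>M\<^esub> a \<odot>\<^bsub>M\<^esub> y"
  and smult_mult: "\<lbrakk>a \<in> S; b \<in> S; x \<in> carrier M\<rbrakk> \<Longrightarrow> (a \<otimes> b) \<odot>\<^bsub>M\<^esub> x = b \<odot>\<^bsub>M\<^esub> (a \<odot>\<^bsub>M\<^esub> x)"
  and one_smult: "x \<in> carrier M \<Longrightarrow> \<one> \<odot>\<^bsub>M\<^esub> x = x"
  using right_module.smult_closed[OF module, of a x] right_module.smult_l_distr[OF module, of a b x]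
    right_module.smult_r_distr[OF module, of a x y] right_module.smult_assoc[OF module, of a b x]
    right_module.smult_one[OF module, of x]
  by simp_all

lemma zero_smult: "x \<in> carrier M \<Longrightarrow> \<zero> \<odot>\<^bsub>M\<^esub> x = \<zero>\<^bsub>M\<^esub>"
  using smult_add[of \<zero> \<zero> x] smult_closed[of \<zero> x] subringE(2)[OF subring_S] by simp

lemma smult_zero: "a \<in> S \<Longrightarrow> a \<odot>\<^bsub>M\<^esub> \<zero>\<^bsub>M\<^esub> = \<zero>\<^bsub>M\<^esub>"
  using add_smult[of a "\<zero>\<^bsub>M\<^esub>" "\<zero>\<^bsub>M\<^esub>"] smult_closed[of a "\<zero>\<^bsub>M\<^esub>"] by simp

lemma smult_finsum:
  assumes "a \<in> S" "\<And>b. b \<in> K \<Longrightarrow> f b \<in> carrier M"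
  shows "a \<odot>\<^bsub>M\<^esub> (\<Oplus>\<^bsub>M\<^esub>b\<in>K. f b) = (\<Oplus>\<^bsub>M\<^esub>b\<in>K. a \<odot>\<^bsub>M\<^esub> f b)"
  using assms(2)
proof (induction K rule: infinite_finite_induct)
  case (insert x K)
  then have "f x \<in> carrier M" "\<And>b. b \<in> K \<Longrightarrow> f b \<in> carrier M" by auto
  with insert assms(1) show ?case
    by (simp add: M.finsum_insert Pi_def add_smult smult_closed M.finsum_closed)
qed (use smult_zero[OF assms(1)] in auto)

lemma basis_carrier: "B \<subseteq> carrier M"
  using basis by (simp add: is_basis_def)

definition comb :: "('m \<Rightarrow> 'a) \<Rightarrow> 'm" where
  "comb c = (\<Oplus>\<^bsub>M\<^esub>b\<in>{b. c b \<noteq> \<zero>}. c b \<odot>\<^bsub>M\<^esub> b)"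

lemma comb_eq:
  assumes "c \<in> vec N S B" "finite K" "{b. c b \<noteq> \<zero>} \<subseteq> K" "K \<subseteq> B"
  shows "comb c = (\<Oplus>\<^bsub>M\<^esub>b\<in>K. c b \<odot>\<^bsub>M\<^esub> b)"
  unfolding comb_def
  using assms vecD(1)[OF assms(1)] basis_carrier
  by (intro M.add.finprod_mono_neutral_cong_left) (auto intro!: smult_closed zero_smult)

lemma comb_closed: "c \<in> vec N S B \<Longrightarrow> comb c \<in> carrier M"
  unfolding comb_def using basis_carrier vecD(1,4)[of c N S B]
  by (intro M.finsum_closed) (auto intro!: smult_closed)

lemma ex1_comb:
  assumes "x \<in> carrier M"
  shows "\<exists>!c. c \<in> vec N S B \<and> comb c = x"
proof -
  let ?P = "\<lambda>c. c \<in> B \<rightarrow>\<^sub>E S \<and> finite {x \<in> B. c x \<noteq> \<zero>} \<and> x = (\<Oplus>\<^bsub>M\<^esub>x\<in>{x \<in> B. c x \<noteq> \<zero>}. c x \<odot>\<^bsub>M\<^esub> x)"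
  have ex1: "\<exists>!c. ?P c" using basis assms by (simp add: is_basis_def)
  then obtain c where c: "?P c" by blast
  define c' where "c' b = (if b \<in> B then c b else \<zero>)" for b
  have sup: "{b. c' b \<noteq> \<zero>} = {b \<in> B. c b \<noteq> \<zero>}" by (auto simp: c'_def)
  have "c' \<in> vec N S B"
    using c subringE(2)[OF subring_S] by (intro vecI) (auto simp: c'_def sup[unfolded c'_def] PiE_iff)
  moreover have "comb c' = x"
  proof -
    have "comb c' = (\<Oplus>\<^bsub>M\<^esub>x\<in>{x \<in> B. c x \<noteq> \<zero>}. c x \<odot>\<^bsub>M\<^esub> x)"
      unfolding comb_def sup using c basis_carrier
      by (intro M.finsum_cong') (auto simp: c'_def intro!: smult_closed)
    then show ?thesis using c by simp
  qed
  moreover have "e = e'" if e: "e \<in> vec N S B" "comb e = x" "e' \<in> vec N S B" "comb e' = x" for e e'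
  proof -
    have P: "?P (restrict f B)" if f: "f \<in> vec N S B" "comb f = x" for f
    proof (intro conjI)
      have s: "{b \<in> B. restrict f B b \<noteq> \<zero>} = {b. f b \<noteq> \<zero>}" using vecD(4)[OF f(1)] by auto
      show "finite {b \<in> B. restrict f B b \<noteq> \<zero>}" unfolding s using vecD(2)[OF f(1)] .
      have "(\<Oplus>\<^bsub>M\<^esub>b\<in>{b. f b \<noteq> \<zero>}. restrict f B b \<odot>\<^bsub>M\<^esub> b) = comb f"
        unfolding comb_def using vecD(1,4)[OF f(1)] basis_carrier
        by (intro M.finsum_cong') (auto intro!: smult_closed)
      then show "x = (\<Oplus>\<^bsub>M\<^esub>b\<in>{b \<in> B. restrict f B b \<noteq> \<zero>}. restrict f B b \<odot>\<^bsub>M\<^esub> b)"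
        unfolding s using f(2) by simp
    qed (use vecD(1)[OF f(1)] in auto)
    have "restrict e B = restrict e' B" using ex1 P[OF e(1,2)] P[OF e(3,4)] by blast
    then have "e b = e' b" if "b \<in> B" for b using that by (metis restrict_apply')
    then show "e = e'" using vecD(3)[OF e(1)] vecD(3)[OF e(3)] by (metis ext)
  qed
  ultimately show ?thesis by blast
qed

definition coord :: "'m \<Rightarrow> 'm \<Rightarrow> 'a" where
  "coord x = (THE c. c \<in> vec N S B \<and> comb c = x)"

lemma coord_vec: "x \<in> carrier M \<Longrightarrow> coord x \<in> vec N S B"
  and comb_coord: "x \<in> carrier M \<Longrightarrow> comb (coord x) = x"
  using theI'[OF ex1_comb] unfolding coord_def by blast+

lemma coord_comb: "c \<in> vec N S B \<Longrightarrow> coord (comb c) = c"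
  using ex1_comb[OF comb_closed] coord_vec[OF comb_closed] comb_coord[OF comb_closed] by blast

lemma coord_closed: "x \<in> carrier M \<Longrightarrow> coord x b \<in> S"
  by (rule vecD(1)[OF coord_vec])

lemma comb_vadd:
  assumes c: "c \<in> vec N S B" and e: "e \<in> vec N S B"
  shows "comb (vadd N c e) = comb c \<oplus>\<^bsub>M\<^esub> comb e"
proof -
  let ?K = "{b. c b \<noteq> \<zero>} \<union> {b. e b \<noteq> \<zero>}"
  have K: "finite ?K" "?K \<subseteq> B" "{b. vadd N c e b \<noteq> \<zero>} \<subseteq> ?K"
    using vecD(2,4)[OF c] vecD(2,4)[OF e] by (auto simp: vadd_def)
  have cl: "c b \<in> S" "e b \<in> S" for b using vecD(1)[OF c] vecD(1)[OF e] .
  have "comb (vadd N c e) = (\<Oplus>\<^bsub>M\<^esub>b\<in>?K. vadd N c e b \<odot>\<^bsub>M\<^esub> b)"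
    by (rule comb_eq[OF vadd_vec[OF subring_S c e] K(1,3,2)])
  also have "\<dots> = (\<Oplus>\<^bsub>M\<^esub>b\<in>?K. c b \<odot>\<^bsub>M\<^esub> b \<oplus>\<^bsub>M\<^esub> e b \<odot>\<^bsub>M\<^esub> b)"
    using K(2) basis_carrier cl by (intro M.finsum_cong') (auto simp: vadd_def smult_add subset_eq intro!: M.a_closed smult_closed)
  also have "\<dots> = (\<Oplus>\<^bsub>M\<^esub>b\<in>?K. c b \<odot>\<^bsub>M\<^esub> b) \<oplus>\<^bsub>M\<^esub> (\<Oplus>\<^bsub>M\<^esub>b\<in>?K. e b \<odot>\<^bsub>M\<^esub> b)"
    using K(2) basis_carrier cl by (intro M.finsum_addf) (auto intro!: smult_closed)
  also have "\<dots> = comb c \<oplus>\<^bsub>M\<^esub> comb e"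
    using comb_eq[OF c K(1) _ K(2)] comb_eq[OF e K(1) _ K(2)] by simp
  finally show ?thesis .
qed

lemma vec_mult_right:
  assumes T: "subring T N" and c: "c \<in> vec N T B'" and a: "a \<in> T"
  shows "(\<lambda>b. c b \<otimes> a) \<in> vec N T B'"
proof (rule vecI)
  have "{b. c b \<otimes> a \<noteq> \<zero>} \<subseteq> {b. c b \<noteq> \<zero>}" using a subringE(1)[OF T] by auto
  then show "finite {b. c b \<otimes> a \<noteq> \<zero>}" using vecD(2)[OF c] by (rule finite_subset)
qed (use vecD(1,3)[OF c] subringE(1,6)[OF T] a in auto)

lemma comb_smult:
  assumes c: "c \<in> vec N S B" and a: "a \<in> S"
  shows "comb (\<lambda>b. c b \<otimes> a) = a \<odot>\<^bsub>M\<^esub> comb c"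
proof -
  let ?K = "{b. c b \<noteq> \<zero>}"
  have K: "finite ?K" "?K \<subseteq> B" "{b. c b \<otimes> a \<noteq> \<zero>} \<subseteq> ?K"
    using vecD(2,4)[OF c] S_carrier[OF a] by auto
  have "comb (\<lambda>b. c b \<otimes> a) = (\<Oplus>\<^bsub>M\<^esub>b\<in>?K. (c b \<otimes> a) \<odot>\<^bsub>M\<^esub> b)"
    by (rule comb_eq[OF vec_mult_right[OF subring_S c a] K(1,3,2)])
  also have "\<dots> = (\<Oplus>\<^bsub>M\<^esub>b\<in>?K. a \<odot>\<^bsub>M\<^esub> (c b \<odot>\<^bsub>M\<^esub> b))"
    using K(2) basis_carrier vecD(1)[OF c] a
    by (intro M.finsum_cong') (auto simp: smult_mult subset_eq intro!: smult_closed)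
  also have "\<dots> = a \<odot>\<^bsub>M\<^esub> comb c"
    unfolding comb_def using K(2) basis_carrier vecD(1)[OF c] a
    by (intro smult_finsum[symmetric]) (auto intro!: smult_closed)
  finally show ?thesis .
qed

lemma coord_add:
  assumes "x \<in> carrier M" "y \<in> carrier M"
  shows "coord (x \<oplus>\<^bsub>M\<^esub> y) = vadd N (coord x) (coord y)"
  using coord_comb[OF vadd_vec[OF subring_S coord_vec[OF assms(1)] coord_vec[OF assms(2)]]]
    comb_vadd[OF coord_vec[OF assms(1)] coord_vec[OF assms(2)]] comb_coord assms by simp

lemma coord_smult:
  assumes "x \<in> carrier M" "a \<in> S"
  shows "coord (a \<odot>\<^bsub>M\<^esub> x) = (\<lambda>b. coord x b \<otimes> a)"
  using coord_comb[OF vec_mult_right[OF subring_S coord_vec[OF assms(1)] assms(2)]]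
    comb_smult[OF coord_vec[OF assms(1)] assms(2)] comb_coord[OF assms(1)] by simp

lemma coord_zero: "coord \<zero>\<^bsub>M\<^esub> = (\<lambda>_. \<zero>)"
proof -
  have "comb (\<lambda>_. \<zero>) = \<zero>\<^bsub>M\<^esub>" by (simp add: comb_def)
  with coord_comb[OF zero_vec[OF subring_S]] show ?thesis by simp
qed

lemma coord_finsum:
  assumes "\<And>b. b \<in> K \<Longrightarrow> g b \<in> carrier M"
  shows "coord (\<Oplus>\<^bsub>M\<^esub>b\<in>K. g b) i = (\<Oplus>b\<in>K. coord (g b) i)"
  using assms
proof (induction K rule: infinite_finite_induct)
  case (insert x K)
  then have "g x \<in> carrier M" "\<And>b. b \<in> K \<Longrightarrow> g b \<in> carrier M" by auto
  with insert show ?case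
    by (simp add: M.finsum_insert finsum_insert Pi_def coord_add vadd_def coord_closed S_carrier M.finsum_closed)
qed (simp_all add: coord_zero)

lemma coord_basis:
  assumes "b \<in> B"
  shows "coord b = unit_vec N b"
proof -
  have u: "unit_vec N b \<in> vec N S B" by (rule unit_vec_vec[OF subring_S assms])
  have "comb (unit_vec N b) = (\<Oplus>\<^bsub>M\<^esub>c\<in>{b}. unit_vec N b c \<odot>\<^bsub>M\<^esub> c)"
    by (rule comb_eq[OF u]) (use assms in \<open>auto simp: unit_vec_def\<close>)
  also have "\<dots> = b" using assms basis_carrier by (auto simp: unit_vec_def one_smult subset_eq M.finsum_insert)
  finally show ?thesis using coord_comb[OF u] by simp
qed

text \<open>The finitely many generators involve only finitely many basis elements, and the coordinate of \<open>b\<close> at \<open>b\<close> is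
\<open>1\<close>, so every \<open>b\<close> is involved.  Over the zero ring the basis can only contain \<open>0\<close>.\<close>

lemma finite_basis:
  assumes "finitely_generated_module (N\<lparr>carrier := S\<rparr>) M"
  shows "finite B"
proof (cases "\<one> = \<zero>")
  case True
  have "x = \<zero>\<^bsub>M\<^esub>" if "x \<in> carrier M" for x
    using one_smult[OF that] zero_smult[OF that] True by simp
  then have "B \<subseteq> {\<zero>\<^bsub>M\<^esub>}" using basis_carrier by auto
  then show ?thesis by (rule finite_subset) simp
next
  case False
  obtain E where E: "finite E" "E \<subseteq> carrier M"
    and gen: "\<And>x. x \<in> carrier M \<Longrightarrow> \<exists>c\<in>E \<rightarrow> S. x = (\<Oplus>\<^bsub>M\<^esub>e\<in>E. c e \<odot>\<^bsub>M\<^esub> e)"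
    using assms by (auto simp: finitely_generated_module_def)
  have "b \<in> (\<Union>e\<in>E. {i. coord e i \<noteq> \<zero>})" if b: "b \<in> B" for b
  proof (rule ccontr)
    assume "b \<notin> (\<Union>e\<in>E. {i. coord e i \<noteq> \<zero>})"
    then have z: "coord e b = \<zero>" if "e \<in> E" for e using that by auto
    obtain c where c: "c \<in> E \<rightarrow> S" "b = (\<Oplus>\<^bsub>M\<^esub>e\<in>E. c e \<odot>\<^bsub>M\<^esub> e)"
      using gen[of b] b basis_carrier by auto
    have "coord b b = (\<Oplus>e\<in>E. coord (c e \<odot>\<^bsub>M\<^esub> e) b)"
      using c E(2) coord_finsum[of E "\<lambda>e. c e \<odot>\<^bsub>M\<^esub> e" b] smult_closed by (simp add: Pi_def subset_eq)
    also have "\<dots> = \<zero>"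
      using c(1) E(2) z S_carrier by (intro add.finprod_one_eqI) (auto simp: coord_smult Pi_def subset_eq)
    finally show False using coord_basis[OF b] False by (simp add: unit_vec_def)
  qed
  then have "B \<subseteq> (\<Union>e\<in>E. {i. coord e i \<noteq> \<zero>})" by blast
  then show ?thesis
    by (rule finite_subset) (use E vecD(2)[OF coord_vec] in auto)
qed

section \<open>Tensor products with a free module\<close>

abbreviation "rels T \<equiv> tensor_relation_subgroup (N\<lparr>carrier := S\<rparr>) M (left_regular (N\<lparr>carrier := T\<rparr>))"
abbreviation "gens T \<equiv> free_Abelian_group (carrier M \<times> T)"

text \<open>The homomorphism from the free abelian group on the pairs \<open>(x, a)\<close> that induces the coordinate isomorphism of the tensor product with
the vectors over \<open>T\<close>.  It exists by the universal property of the free abelian group and is determined on the elements of that group.\<close>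

definition tcoord :: "'a set \<Rightarrow> ('m \<times> 'a \<Rightarrow>\<^sub>0 int) \<Rightarrow> 'm \<Rightarrow> 'a" where
  "tcoord T = (SOME h. h \<in> hom (gens T) (vec_group N T B) \<and>
     (\<forall>x\<in>carrier M. \<forall>a\<in>T. h (frag_of (x, a)) = (\<lambda>b. coord x b \<otimes> a)))"

end

locale based_module_extension = based_module N S M B
  for N :: "'a ring" (structure) and S and M :: "('a, 'm, 'z) module_scheme" and B +
  fixes T :: "'a set"
  assumes subring_T: "subring T N" and S_subset_T: "S \<subseteq> T"
begin

lemma T_carrier: "a \<in> T \<Longrightarrow> a \<in> carrier N"
  using subringE(1)[OF subring_T] by auto

lemma coord_mult_vec: "\<lbrakk>x \<in> carrier M; a \<in> T\<rbrakk> \<Longrightarrow> (\<lambda>b. coord x b \<otimes> a) \<in> vec N T B"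
  by (rule vec_mult_right[OF subring_T vec_mono[OF coord_vec S_subset_T]]) auto

lemma tcoord_hom: "tcoord T \<in> hom (gens T) (vec_group N T B)"
  and tcoord_of: "\<lbrakk>x \<in> carrier M; a \<in> T\<rbrakk> \<Longrightarrow> tcoord T (frag_of (x, a)) = (\<lambda>b. coord x b \<otimes> a)"
proof -
  interpret V: comm_group "vec_group N T B" by (rule vec_group_comm_group[OF subring_T])
  have "(\<lambda>(x, a) b. coord x b \<otimes> a) ` (carrier M \<times> T) \<subseteq> carrier (vec_group N T B)"
    using coord_mult_vec by (auto simp: vec_group_def)
  then obtain h where h: "h \<in> hom (gens T) (vec_group N T B)"
    "\<And>p. p \<in> carrier M \<times> T \<Longrightarrow> h (frag_of p) = (\<lambda>(x, a) b. coord x b \<otimes> a) p"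
    by (rule V.free_Abelian_group_universal) blast
  then have "\<exists>h. h \<in> hom (gens T) (vec_group N T B) \<and>
     (\<forall>x\<in>carrier M. \<forall>a\<in>T. h (frag_of (x, a)) = (\<lambda>b. coord x b \<otimes> a))" by (intro exI[of _ h]) auto
  from someI_ex[OF this] show "tcoord T \<in> hom (gens T) (vec_group N T B)"
    "\<lbrakk>x \<in> carrier M; a \<in> T\<rbrakk> \<Longrightarrow> tcoord T (frag_of (x, a)) = (\<lambda>b. coord x b \<otimes> a)"
    unfolding tcoord_def by blast+
qed

abbreviation "Fr \<equiv> carrier (gens T)"

lemma tcoord_vec: "u \<in> Fr \<Longrightarrow> tcoord T u \<in> vec N T B"
  using hom_in_carrier[OF tcoord_hom] by (simp add: vec_group_def)

lemma Fr_add: "\<lbrakk>u \<in> Fr; v \<in> Fr\<rbrakk> \<Longrightarrow> u + v \<in> Fr"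
  using keys_add[of u v] by auto

lemma Fr_diff: "\<lbrakk>u \<in> Fr; v \<in> Fr\<rbrakk> \<Longrightarrow> u - v \<in> Fr"
  using keys_diff[of u v] by auto

lemma Fr_zero: "0 \<in> Fr" by simp

lemma Fr_of: "\<lbrakk>x \<in> carrier M; a \<in> T\<rbrakk> \<Longrightarrow> frag_of (x, a) \<in> Fr" by simp

lemma tcoord_add: "\<lbrakk>u \<in> Fr; v \<in> Fr\<rbrakk> \<Longrightarrow> tcoord T (u + v) = vadd N (tcoord T u) (tcoord T v)"
  using hom_mult[OF tcoord_hom, of u v] by (simp add: vec_group_def)

lemma tcoord_diff:
  assumes "u \<in> Fr" "v \<in> Fr"
  shows "tcoord T (u - v) = vdiff N (tcoord T u) (tcoord T v)"
proof -
  have car: "w \<in> Fr \<Longrightarrow> tcoord T w \<in> vec N (carrier N) B" for w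
    using vec_mono[OF tcoord_vec subringE(1)[OF subring_T]] by blast
  have "tcoord T u = vadd N (tcoord T (u - v)) (tcoord T v)"
    using tcoord_add[OF Fr_diff[OF assms] assms(2)] by simp
  then show ?thesis using vadd_vdiff_cancel(2)[OF car[OF Fr_diff[OF assms]] car[OF assms(2)]] by simp
qed

lemma tcoord_zero: "tcoord T 0 = (\<lambda>_. \<zero>)"
  using tcoord_diff[OF Fr_zero Fr_zero] vecD(1)[OF tcoord_vec[OF Fr_zero]] T_carrier
  by (auto simp: vdiff_def a_minus_def r_neg)

lemma relations_subset:
  "tensor_relations (N\<lparr>carrier := S\<rparr>) M (left_regular (N\<lparr>carrier := T\<rparr>)) \<subseteq> Fr"
  unfolding tensor_relations_def
  using subringE(6,7)[OF subring_T] S_subset_T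
  by (auto simp: left_regular_def smult_closed simp del: carrier_free_Abelian_group_iff
      intro!: Fr_diff Fr_of smult_closed)

lemma carrier_left_regular: "carrier (left_regular (N\<lparr>carrier := T\<rparr>)) = T"
  by (simp add: left_regular_def)

lemma rels_subgroup: "subgroup (rels T) (gens T)"
  unfolding tensor_relation_subgroup_def carrier_left_regular
  by (intro group.generate_is_subgroup group_free_Abelian_group relations_subset)

lemma rels_Fr: "u \<in> rels T \<Longrightarrow> u \<in> Fr"
  using subgroup.subset[OF rels_subgroup] by blast

lemma rels_add: "\<lbrakk>u \<in> rels T; v \<in> rels T\<rbrakk> \<Longrightarrow> u + v \<in> rels T"
  using subgroup.m_closed[OF rels_subgroup] by simp

lemma rels_zero: "0 \<in> rels T"
  using subgroup.one_closed[OF rels_subgroup] by simp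

lemma rels_minus: "u \<in> rels T \<Longrightarrow> - u \<in> rels T"
  using subgroup.m_inv_closed[OF rels_subgroup, of u] rels_Fr[of u] by simp

lemma rels_diff: "\<lbrakk>u \<in> rels T; v \<in> rels T\<rbrakk> \<Longrightarrow> u - v \<in> rels T"
  using rels_add[OF _ rels_minus, of u v] by simp

lemma rels_relations:
  "\<lbrakk>x \<in> carrier M; x' \<in> carrier M; a \<in> T\<rbrakk> \<Longrightarrow>
     frag_of (x \<oplus>\<^bsub>M\<^esub> x', a) - frag_of (x, a) - frag_of (x', a) \<in> rels T"
  "\<lbrakk>x \<in> carrier M; a \<in> T; a' \<in> T\<rbrakk> \<Longrightarrow>
     frag_of (x, a \<oplus> a') - frag_of (x, a) - frag_of (x, a') \<in> rels T"
  "\<lbrakk>s \<in> S; x \<in> carrier M; a \<in> T\<rbrakk> \<Longrightarrow>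
     frag_of (s \<odot>\<^bsub>M\<^esub> x, a) - frag_of (x, s \<otimes> a) \<in> rels T"
proof -
  note incl = generate.incl[of _ "tensor_relations (N\<lparr>carrier := S\<rparr>) M (left_regular (N\<lparr>carrier := T\<rparr>))"]
  show "\<lbrakk>x \<in> carrier M; x' \<in> carrier M; a \<in> T\<rbrakk> \<Longrightarrow>
     frag_of (x \<oplus>\<^bsub>M\<^esub> x', a) - frag_of (x, a) - frag_of (x', a) \<in> rels T"
    unfolding tensor_relation_subgroup_def
    by (rule incl) (auto simp: tensor_relations_def left_regular_def)
  show "\<lbrakk>x \<in> carrier M; a \<in> T; a' \<in> T\<rbrakk> \<Longrightarrow>
     frag_of (x, a \<oplus> a') - frag_of (x, a) - frag_of (x, a') \<in> rels T"
    unfolding tensor_relation_subgroup_def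
    by (rule incl) (force simp: tensor_relations_def left_regular_def)
  show "\<lbrakk>s \<in> S; x \<in> carrier M; a \<in> T\<rbrakk> \<Longrightarrow>
     frag_of (s \<odot>\<^bsub>M\<^esub> x, a) - frag_of (x, s \<otimes> a) \<in> rels T"
    unfolding tensor_relation_subgroup_def
    by (rule incl) (force simp: tensor_relations_def left_regular_def)
qed

lemma tcoord_relations:
  assumes "u \<in> tensor_relations (N\<lparr>carrier := S\<rparr>) M (left_regular (N\<lparr>carrier := T\<rparr>))"
  shows "tcoord T u = (\<lambda>_. \<zero>)"
proof -
  have cc: "coord x b \<in> carrier N" if "x \<in> carrier M" for x b
    using coord_closed[OF that] by (rule S_carrier)
  have z: "\<zero> = y \<oplus> z \<oplus> \<ominus> y \<oplus> \<ominus> z" if "y \<in> carrier N" "z \<in> carrier N" for y z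
  proof -
    have "y \<oplus> z \<oplus> \<ominus> y \<oplus> \<ominus> z = (y \<oplus> z) \<oplus> \<ominus> (y \<oplus> z)"
      using that by (simp add: minus_add a_assoc)
    then show ?thesis using that by (simp add: r_neg)
  qed
  from assms consider
    (add_left) x x' a where "x \<in> carrier M" "x' \<in> carrier M" "a \<in> T"
      "u = frag_of (x \<oplus>\<^bsub>M\<^esub> x', a) - frag_of (x, a) - frag_of (x', a)"
  | (add_right) x a a' where "x \<in> carrier M" "a \<in> T" "a' \<in> T"
      "u = frag_of (x, a \<oplus> a') - frag_of (x, a) - frag_of (x, a')"
  | (balanced) s x a where "s \<in> S" "x \<in> carrier M" "a \<in> T"
      "u = frag_of (s \<odot>\<^bsub>M\<^esub> x, a) - frag_of (x, s \<otimes> a)"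
    unfolding tensor_relations_def left_regular_def by auto
  then show ?thesis
  proof cases
    case add_left
    then show ?thesis
      using T_carrier cc
      by (auto simp: tcoord_diff tcoord_of Fr_diff Fr_of coord_add vadd_def vdiff_def a_minus_def l_distr z[symmetric]
          simp del: carrier_free_Abelian_group_iff)
  next
    case add_right
    then show ?thesis
      using T_carrier cc subringE(7)[OF subring_T]
      by (auto simp: tcoord_diff tcoord_of Fr_diff Fr_of vdiff_def a_minus_def r_distr z[symmetric]
          simp del: carrier_free_Abelian_group_iff)
  next
    case balanced
    then show ?thesis
      using T_carrier S_carrier cc subringE(6)[OF subring_T] S_subset_T
      by (auto simp: tcoord_diff tcoord_of Fr_diff Fr_of vdiff_def a_minus_def coord_smult smult_closed
          m_assoc r_neg subset_eq simp del: carrier_free_Abelian_group_iff)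
  qed
qed

lemma tcoord_rels:
  assumes "u \<in> rels T"
  shows "tcoord T u = (\<lambda>_. \<zero>)"
proof -
  interpret V: comm_group "vec_group N T B" by (rule vec_group_comm_group[OF subring_T])
  interpret h: group_hom "gens T" "vec_group N T B" "tcoord T"
    by (simp add: group_hom_def group_hom_axioms_def tcoord_hom V.group_axioms)
  have "rels T \<subseteq> kernel (gens T) (vec_group N T B) (tcoord T)"
    unfolding tensor_relation_subgroup_def carrier_left_regular
    using relations_subset tcoord_relations
    by (intro h.G.generate_subgroup_incl h.subgroup_kernel) (auto simp: kernel_def vec_group_def simp del: carrier_free_Abelian_group_iff)
  then show ?thesis using assms by (auto simp: kernel_def vec_group_def)
qed

text \<open>The inverse of the coordinate isomorphism: with \<open>K\<close> containing the support of \<open>c\<close>, it represents the tensor with coordinates \<open>c\<close>.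
Up to the tensor relations the choice of \<open>K\<close> does not matter.\<close>

definition section_sum :: "'m set \<Rightarrow> ('m \<Rightarrow> 'a) \<Rightarrow> ('m \<times> 'a \<Rightarrow>\<^sub>0 int)" where
  "section_sum K c = (\<Sum>b\<in>K. frag_of (b, c b))"

lemma section_sum_Fr:
  assumes "K \<subseteq> B" "\<And>b. b \<in> K \<Longrightarrow> c b \<in> T"
  shows "section_sum K c \<in> Fr"
  unfolding section_sum_def
  using assms basis_carrier by (intro sum_closed_free_Abelian_group) auto

lemma zero_rels: "x \<in> carrier M \<Longrightarrow> frag_of (x, \<zero>) \<in> rels T" "a \<in> T \<Longrightarrow> frag_of (\<zero>\<^bsub>M\<^esub>, a) \<in> rels T"
  using rels_minus[OF rels_relations(2)[of x \<zero> \<zero>]] subringE(2)[OF subring_T]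
    rels_minus[OF rels_relations(1)[of "\<zero>\<^bsub>M\<^esub>" "\<zero>\<^bsub>M\<^esub>" a]] by simp_all

lemma section_sum_cong:
  assumes "finite K" "L \<subseteq> K" "K \<subseteq> B" "\<And>b. b \<in> K - L \<Longrightarrow> c b = \<zero>"
  shows "section_sum K c - section_sum L c \<in> rels T"
proof -
  have "section_sum K c - section_sum L c = section_sum (K - L) c"
    unfolding section_sum_def by (rule sum_diff[OF assms(1,2), symmetric])
  moreover have "section_sum J c \<in> rels T" if "finite J" "J \<subseteq> K - L" for J
    using that
  proof (induction J rule: finite_induct)
    case (insert b J)
    then have "frag_of (b, c b) \<in> rels T" using assms basis_carrier zero_rels(1)[of b] by auto
    with insert show ?case by (simp add: section_sum_def rels_add)
  qed (simp add: section_sum_def rels_zero)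
  ultimately show ?thesis using assms(1) by simp
qed

lemma section_sum_diff:
  assumes "finite K" "K \<subseteq> B" "\<And>b. b \<in> K \<Longrightarrow> c b \<in> T" "\<And>b. b \<in> K \<Longrightarrow> e b \<in> T"
  shows "section_sum K c - section_sum K e - section_sum K (vdiff N c e) \<in> rels T"
  using assms
proof (induction K rule: finite_induct)
  case (insert b K)
  have bT: "c b \<in> T" "e b \<in> T" "vdiff N c e b \<in> T" "b \<in> carrier M"
    using insert.prems basis_carrier subringE(5,7)[OF subring_T] by (auto simp: vdiff_def a_minus_def)
  have "c b = vdiff N c e b \<oplus> e b"
    using bT T_carrier by (simp add: vdiff_def a_minus_def a_assoc l_neg)
  then have "frag_of (b, c b) - frag_of (b, vdiff N c e b) - frag_of (b, e b) \<in> rels T"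
    using rels_relations(2)[of b "vdiff N c e b" "e b"] bT by simp
  from rels_add[OF insert.IH this] insert show ?case by (simp add: section_sum_def algebra_simps)
qed (simp add: section_sum_def rels_zero)

lemma section_sum_finsum:
  assumes "finite K" "\<And>b. b \<in> K \<Longrightarrow> g b \<in> carrier M" "a \<in> T"
  shows "frag_of (\<Oplus>\<^bsub>M\<^esub>b\<in>K. g b, a) - (\<Sum>b\<in>K. frag_of (g b, a)) \<in> rels T"
  using assms(1,2)
proof (induction K rule: finite_induct)
  case empty
  show ?case using zero_rels(2)[OF assms(3)] by simp
next
  case (insert b K)
  then have g: "g b \<in> carrier M" "\<And>b. b \<in> K \<Longrightarrow> g b \<in> carrier M" by auto
  have "frag_of (g b \<oplus>\<^bsub>M\<^esub> (\<Oplus>\<^bsub>M\<^esub>b\<in>K. g b), a) - frag_of (g b, a) - frag_of (\<Oplus>\<^bsub>M\<^esub>b\<in>K. g b, a) \<in> rels T"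
    using g assms(3) by (intro rels_relations(1) M.finsum_closed) auto
  from rels_add[OF this insert.IH] insert g show ?case
    by (simp add: M.finsum_insert Pi_def algebra_simps)
qed

text \<open>For a generator \<open>(x, a)\<close> expand \<open>x\<close> in the basis, split the sum and move the coefficients across the tensor sign.  The general
case follows because both sides are additive modulo the relations.\<close>

lemma equivalent_to_section:
  assumes "u \<in> Fr"
  shows "u - section_sum {b. tcoord T u b \<noteq> \<zero>} (tcoord T u) \<in> rels T"
proof -
  have "Poly_Mapping.keys u \<subseteq> carrier M \<times> T" using assms by simp
  then show ?thesis
  proof (induction u rule: free_Abelian_group_induct[consumes 1, case_names zero diff one])
    case zero
    show ?case by (simp add: tcoord_zero section_sum_def rels_zero)
  next
    case (diff u v)
    then have uv: "u \<in> Fr" "v \<in> Fr" by auto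
    let ?s = "\<lambda>w. {b. tcoord T w b \<noteq> \<zero>}"
    let ?K = "?s u \<union> ?s v"
    have K: "finite ?K" "?K \<subseteq> B" using vecD(2,4)[OF tcoord_vec[OF uv(1)]] vecD(2,4)[OF tcoord_vec[OF uv(2)]] by auto
    have sub: "?s (u - v) \<subseteq> ?K" by (auto simp: tcoord_diff[OF uv] vdiff_def a_minus_def)
    have m: "section_sum ?K (tcoord T w) - section_sum (?s w) (tcoord T w) \<in> rels T" if "?s w \<subseteq> ?K" for w
      using that by (intro section_sum_cong K) auto
    have d: "section_sum ?K (tcoord T u) - section_sum ?K (tcoord T v) - section_sum ?K (tcoord T (u - v)) \<in> rels T"
      unfolding tcoord_diff[OF uv]
      using vecD(1)[OF tcoord_vec[OF uv(1)]] vecD(1)[OF tcoord_vec[OF uv(2)]] by (intro section_sum_diff K)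
    have "u - v - section_sum (?s (u - v)) (tcoord T (u - v)) =
      (u - section_sum (?s u) (tcoord T u)) - (v - section_sum (?s v) (tcoord T v))
      - (section_sum ?K (tcoord T u) - section_sum (?s u) (tcoord T u))
      + (section_sum ?K (tcoord T v) - section_sum (?s v) (tcoord T v))
      + (section_sum ?K (tcoord T u) - section_sum ?K (tcoord T v) - section_sum ?K (tcoord T (u - v)))
      + (section_sum ?K (tcoord T (u - v)) - section_sum (?s (u - v)) (tcoord T (u - v)))"
      by simp
    also have "\<dots> \<in> rels T"
      by (intro rels_add rels_diff diff(3,4) m d sub) auto
    finally show ?case .
  next
    case (one p)
    obtain x a where p: "p = (x, a)" by (cases p)
    with one have x: "x \<in> carrier M" and a: "a \<in> T" by auto
    let ?K = "{b. coord x b \<noteq> \<zero>}"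
    have K: "finite ?K" "?K \<subseteq> B" using vecD(2,4)[OF coord_vec[OF x]] by auto
    have cS: "coord x b \<in> S" for b by (rule coord_closed[OF x])
    define t where "t = tcoord T (frag_of p)"
    have t: "t = (\<lambda>b. coord x b \<otimes> a)" unfolding t_def p by (rule tcoord_of[OF x a])
    have g: "coord x b \<odot>\<^bsub>M\<^esub> b \<in> carrier M" if "b \<in> ?K" for b
      using that K(2) basis_carrier cS by (auto intro!: smult_closed)
    have sum_x: "(\<Oplus>\<^bsub>M\<^esub>b\<in>?K. coord x b \<odot>\<^bsub>M\<^esub> b) = x" using comb_coord[OF x] by (simp add: comb_def)
    have 1: "frag_of (x, a) - (\<Sum>b\<in>?K. frag_of (coord x b \<odot>\<^bsub>M\<^esub> b, a)) \<in> rels T"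
      using section_sum_finsum[where g = "\<lambda>b. coord x b \<odot>\<^bsub>M\<^esub> b", OF K(1) g a] by (simp only: sum_x)
    have 2: "(\<Sum>b\<in>J. frag_of (coord x b \<odot>\<^bsub>M\<^esub> b, a)) - section_sum J t \<in> rels T" if "finite J" "J \<subseteq> B" for J
      using that
    proof (induction J rule: finite_induct)
      case (insert b J)
      then have "frag_of (coord x b \<odot>\<^bsub>M\<^esub> b, a) - frag_of (b, coord x b \<otimes> a) \<in> rels T"
        using basis_carrier cS a by (intro rels_relations(3)) auto
      with insert have "((\<Sum>b\<in>J. frag_of (coord x b \<odot>\<^bsub>M\<^esub> b, a)) - section_sum J t) +
        (frag_of (coord x b \<odot>\<^bsub>M\<^esub> b, a) - frag_of (b, t b)) \<in> rels T"
        by (intro rels_add) (auto simp: t)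
      with insert show ?case by (simp add: section_sum_def algebra_simps)
    qed (simp add: section_sum_def rels_zero)
    have 3: "section_sum ?K t - section_sum {b. t b \<noteq> \<zero>} t \<in> rels T"
      using K T_carrier[OF a] by (intro section_sum_cong) (auto simp: t)
    have "frag_of (x, a) - section_sum {b. t b \<noteq> \<zero>} t =
      (frag_of (x, a) - (\<Sum>b\<in>?K. frag_of (coord x b \<odot>\<^bsub>M\<^esub> b, a)))
      + ((\<Sum>b\<in>?K. frag_of (coord x b \<odot>\<^bsub>M\<^esub> b, a)) - section_sum ?K t)
      + (section_sum ?K t - section_sum {b. t b \<noteq> \<zero>} t)" by simp
    also have "\<dots> \<in> rels T" by (intro rels_add 1 2 3 K)
    finally show ?case using p by (simp add: t_def)
  qed
qed

text \<open>Thus the tensor coordinates are injective on the tensor product; they are surjective by the lemma \<open>tcoord_surj\<close> below.\<close>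

theorem tcoord_kernel:
  assumes "u \<in> Fr"
  shows "u \<in> rels T \<longleftrightarrow> tcoord T u = (\<lambda>_. \<zero>)"
proof
  assume "tcoord T u = (\<lambda>_. \<zero>)"
  with equivalent_to_section[OF assms] show "u \<in> rels T" by (simp add: section_sum_def)
qed (rule tcoord_rels)

lemma tcoord_section_sum:
  assumes "finite K" "K \<subseteq> B" "\<And>b. b \<in> K \<Longrightarrow> c b \<in> T"
  shows "tcoord T (section_sum K c) = (\<lambda>i. if i \<in> K then c i else \<zero>)"
  using assms
proof (induction K rule: finite_induct)
  case empty
  show ?case by (simp add: section_sum_def tcoord_zero)
next
  case (insert b K)
  then have b: "b \<in> carrier M" "c b \<in> T" "b \<in> B" using basis_carrier by auto
  have "tcoord T (section_sum (insert b K) c) = vadd N (tcoord T (frag_of (b, c b))) (tcoord T (section_sum K c))"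
    using insert b section_sum_Fr[of K c] tcoord_add[OF Fr_of[OF b(1,2)]] by (simp add: section_sum_def)
  also have "\<dots> = (\<lambda>i. if i \<in> insert b K then c i else \<zero>)"
    using insert b T_carrier by (auto simp: vadd_def tcoord_of coord_basis unit_vec_def)
  finally show ?case .
qed

lemma tcoord_surj:
  assumes "c \<in> vec N T B"
  shows "\<exists>u\<in>Fr. tcoord T u = c"
proof
  let ?K = "{b. c b \<noteq> \<zero>}"
  have K: "finite ?K" "?K \<subseteq> B" using vecD(2,4)[OF assms] by auto
  show "section_sum ?K c \<in> Fr" using vecD(1)[OF assms] by (intro section_sum_Fr K)
  show "tcoord T (section_sum ?K c) = c"
    using tcoord_section_sum[OF K vecD(1)[OF assms]] by auto
qed

lemma tensor_product_gens: "tensor_product (N\<lparr>carrier := S\<rparr>) M (left_regular (N\<lparr>carrier := T\<rparr>)) = gens T Mod rels T"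
  by (simp add: tensor_product_def carrier_left_regular)

lemma tensor_product_comm_group:
  "comm_group (tensor_product (N\<lparr>carrier := S\<rparr>) M (left_regular (N\<lparr>carrier := T\<rparr>)))"
  unfolding tensor_product_gens
  by (rule comm_group.abelian_FactGroup[OF abelian_free_Abelian_group rels_subgroup])

lemma coset_eq_iff:
  assumes "u \<in> Fr" "v \<in> Fr"
  shows "rels T #>\<^bsub>gens T\<^esub> u = rels T #>\<^bsub>gens T\<^esub> v \<longleftrightarrow> u - v \<in> rels T"
proof
  assume "rels T #>\<^bsub>gens T\<^esub> u = rels T #>\<^bsub>gens T\<^esub> v"
  moreover have "u \<in> rels T #>\<^bsub>gens T\<^esub> u" using rels_zero by (force simp: r_coset_def)
  ultimately obtain h where "h \<in> rels T" "u = h + v" by (auto simp: r_coset_def)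
  then show "u - v \<in> rels T" by simp
next
  assume "u - v \<in> rels T"
  then have "u \<in> rels T #>\<^bsub>gens T\<^esub> v" by (force simp: r_coset_def)
  then show "rels T #>\<^bsub>gens T\<^esub> u = rels T #>\<^bsub>gens T\<^esub> v"
    using group.repr_independence[OF group_free_Abelian_group _ assms(2) rels_subgroup] by simp
qed

end

lemma coord_linear:
  fixes N :: "'a ring"
  assumes M: "based_module N S M B" and M': "based_module N S M' B'"
    and f: "f \<in> linear_hom (N\<lparr>carrier := S\<rparr>) M M'" and x: "x \<in> carrier M"
  shows "based_module.coord N S M' B' (f x) =
    lin N (\<lambda>b. based_module.coord N S M' B' (f b)) (based_module.coord N S M B x)"
proof
  fix i
  interpret A: based_module N S M B by (rule M)
  interpret A': based_module N S M' B' by (rule M')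
  have fadd: "f (y \<oplus>\<^bsub>M\<^esub> z) = f y \<oplus>\<^bsub>M'\<^esub> f z" if "y \<in> carrier M" "z \<in> carrier M" for y z
    using f hom_mult[of f "add_monoid M" "add_monoid M'" y z] that by (simp add: linear_hom_def)
  have fcl: "f y \<in> carrier M'" if "y \<in> carrier M" for y
    using f hom_in_carrier[of f "add_monoid M" "add_monoid M'" y] that by (simp add: linear_hom_def)
  have fsm: "f (a \<odot>\<^bsub>M\<^esub> y) = a \<odot>\<^bsub>M'\<^esub> f y" if "a \<in> S" "y \<in> carrier M" for a y
    using f that by (simp add: linear_hom_def)
  have f0: "f \<zero>\<^bsub>M\<^esub> = \<zero>\<^bsub>M'\<^esub>"
    using fadd[of "\<zero>\<^bsub>M\<^esub>" "\<zero>\<^bsub>M\<^esub>"] fcl[of "\<zero>\<^bsub>M\<^esub>"] by simp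
  let ?K = "{b. A.coord x b \<noteq> \<zero>\<^bsub>N\<^esub>}"
  have K: "finite ?K" "?K \<subseteq> B" using vecD(2,4)[OF A.coord_vec[OF x]] by auto
  have cS: "A.coord x b \<in> S" for b by (rule A.coord_closed[OF x])
  have fsum: "f (\<Oplus>\<^bsub>M\<^esub>b\<in>J. g b) = (\<Oplus>\<^bsub>M'\<^esub>b\<in>J. f (g b))" if "finite J" "\<And>b. b \<in> J \<Longrightarrow> g b \<in> carrier M" for J g
    using that
  proof (induction J rule: finite_induct)
    case (insert b J)
    then have "g b \<in> carrier M" "\<And>b. b \<in> J \<Longrightarrow> g b \<in> carrier M" by auto
    with insert show ?case
      by (simp add: A.M.finsum_insert A'.M.finsum_insert Pi_def fadd fcl A.M.finsum_closed)
  qed (simp add: f0)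
  have B: "b \<in> carrier M" if "b \<in> ?K" for b using that K(2) A.basis_carrier by auto
  have "f x = f (A.comb (A.coord x))" using A.comb_coord[OF x] by simp
  also have "\<dots> = (\<Oplus>\<^bsub>M'\<^esub>b\<in>?K. f (A.coord x b \<odot>\<^bsub>M\<^esub> b))"
    unfolding A.comb_def using B cS by (intro fsum K(1) A.smult_closed)
  also have "\<dots> = (\<Oplus>\<^bsub>M'\<^esub>b\<in>?K. A.coord x b \<odot>\<^bsub>M'\<^esub> f b)"
    using B cS fsm fcl by (intro A'.M.finsum_cong') (auto intro!: A'.smult_closed)
  finally have "A'.coord (f x) i = (\<Oplus>\<^bsub>N\<^esub>b\<in>?K. A'.coord (A.coord x b \<odot>\<^bsub>M'\<^esub> f b) i)"
    using B cS fcl A'.coord_finsum[of ?K "\<lambda>b. A.coord x b \<odot>\<^bsub>M'\<^esub> f b" i] A'.smult_closed by simp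
  also have "\<dots> = (\<Oplus>\<^bsub>N\<^esub>b\<in>?K. A'.coord (f b) i \<otimes>\<^bsub>N\<^esub> A.coord x b)"
    using B cS fcl A'.coord_closed A.S_carrier
    by (intro A.finsum_cong') (auto simp: A'.coord_smult)
  finally show "A'.coord (f x) i = lin N (\<lambda>b. A'.coord (f b)) (A.coord x) i" by (simp add: lin_def)
qed

lemma tcoord_frag_extend:
  fixes N :: "'a ring"
  assumes M: "based_module_extension N S M B T" and M': "based_module_extension N S M' B' T"
    and f: "f \<in> linear_hom (N\<lparr>carrier := S\<rparr>) M M'"
    and u: "u \<in> carrier (free_Abelian_group (carrier M \<times> T))"
  shows "frag_extend (\<lambda>(x, y). frag_of (f x, y)) u \<in> carrier (free_Abelian_group (carrier M' \<times> T))"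
    and "based_module.tcoord N S M' B' T (frag_extend (\<lambda>(x, y). frag_of (f x, y)) u) =
      lin N (\<lambda>b. based_module.coord N S M' B' (f b)) (based_module.tcoord N S M B T u)"
proof -
  interpret A: based_module_extension N S M B T by (rule M)
  interpret A': based_module_extension N S M' B' T by (rule M')
  have fcl: "f y \<in> carrier M'" if "y \<in> carrier M" for y
    using f hom_in_carrier[of f "add_monoid M" "add_monoid M'" y] that by (simp add: linear_hom_def)
  let ?F = "frag_extend (\<lambda>(x, y). frag_of (f x, y))"
  let ?m = "\<lambda>b. A'.coord (f b)"
  have m: "?m b \<in> vec N (carrier N) B'" if "b \<in> B" for b
    using A.basis_carrier that fcl A.S_carrier by (intro vec_mono[OF A'.coord_vec]) auto
  have car: "w \<in> A.Fr \<Longrightarrow> A.tcoord T w \<in> vec N (carrier N) B" for w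
    using A.tcoord_vec A.T_carrier by (blast intro: vec_mono)
  have "?F u \<in> A'.Fr \<and> A'.tcoord T (?F u) = lin N ?m (A.tcoord T u)"
    using u[unfolded carrier_free_Abelian_group_iff]
  proof (induction u rule: free_Abelian_group_induct[consumes 1, case_names zero diff one])
    case zero
    show ?case by (simp add: A.tcoord_zero A'.tcoord_zero lin_def)
  next
    case (diff u v)
    then have uv: "u \<in> A.Fr" "v \<in> A.Fr" "?F u \<in> A'.Fr" "?F v \<in> A'.Fr" by auto
    then show ?case
      using diff(3,4) A'.Fr_diff[OF uv(3,4)] A.lin_vdiff[OF car[OF uv(1)] car[OF uv(2)] m]
      by (simp add: frag_extend_diff A.tcoord_diff[OF uv(1,2)] A'.tcoord_diff[OF uv(3,4)]
          del: carrier_free_Abelian_group_iff)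
  next
    case (one p)
    obtain x a where p: "p = (x, a)" by (cases p)
    with one have x: "x \<in> carrier M" and a: "a \<in> T" by auto
    have "lin N ?m (\<lambda>b. A.coord x b \<otimes>\<^bsub>N\<^esub> a) i = lin N ?m (A.coord x) i \<otimes>\<^bsub>N\<^esub> a" for i
    proof -
      let ?K = "{b. A.coord x b \<noteq> \<zero>\<^bsub>N\<^esub>}"
      have K: "finite ?K" "?K \<subseteq> B" using vecD(2,4)[OF A.coord_vec[OF x]] by auto
      have cc: "A.coord x b \<in> carrier N" for b using A.coord_closed[OF x] A.S_carrier by blast
      have mc: "?m b i \<in> carrier N" if "b \<in> ?K" for b using vecD(1)[OF m] that K(2) by blast
      have "lin N ?m (\<lambda>b. A.coord x b \<otimes>\<^bsub>N\<^esub> a) i = (\<Oplus>\<^bsub>N\<^esub>b\<in>?K. ?m b i \<otimes>\<^bsub>N\<^esub> (A.coord x b \<otimes>\<^bsub>N\<^esub> a))"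
        using K cc mc A.T_carrier[OF a] by (intro A.lin_eq) auto
      also have "\<dots> = (\<Oplus>\<^bsub>N\<^esub>b\<in>?K. ?m b i \<otimes>\<^bsub>N\<^esub> A.coord x b \<otimes>\<^bsub>N\<^esub> a)"
        using cc mc A.T_carrier[OF a] by (intro A.finsum_cong') (auto simp: A.m_assoc)
      also have "\<dots> = lin N ?m (A.coord x) i \<otimes>\<^bsub>N\<^esub> a"
        unfolding lin_def using K cc mc A.T_carrier[OF a] by (intro A.finsum_ldistr[symmetric]) auto
      finally show ?thesis .
    qed
    then show ?case
      using p x a fcl[OF x] coord_linear[OF A.based_module_axioms A'.based_module_axioms f x]
      by (simp add: A.tcoord_of A'.tcoord_of fun_eq_iff)
  qed
  then show "?F u \<in> A'.Fr" "A'.tcoord T (?F u) = lin N ?m (A.tcoord T u)" by blast+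
qed

text \<open>The map on generators sends relations to relations: their coordinates vanish, hence so do those of their images, and
the kernel of the coordinates consists of relations.\<close>

lemma tensor_map_coset:
  fixes N :: "'a ring"
  assumes M: "based_module_extension N S M B T" and M': "based_module_extension N S M' B' T"
    and f: "f \<in> linear_hom (N\<lparr>carrier := S\<rparr>) M M'"
    and u: "u \<in> carrier (free_Abelian_group (carrier M \<times> T))"
  shows "tensor_map (N\<lparr>carrier := S\<rparr>) M M' (left_regular (N\<lparr>carrier := T\<rparr>)) f
      (based_module.rels N S M T #>\<^bsub>free_Abelian_group (carrier M \<times> T)\<^esub> u) =
    based_module.rels N S M' T #>\<^bsub>free_Abelian_group (carrier M' \<times> T)\<^esub>
      frag_extend (\<lambda>(x, y). frag_of (f x, y)) u"
proof -
  interpret A: based_module_extension N S M B T by (rule M)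
  interpret A': based_module_extension N S M' B' T by (rule M')
  let ?F = "frag_extend (\<lambda>(x, y). frag_of (f x, y))"
  have F: "?F r \<in> A'.rels T" if "r \<in> A.rels T" for r
    using tcoord_frag_extend[OF M M' f A.rels_Fr[OF that]] A.tcoord_rels[OF that] A'.tcoord_kernel
    by (simp add: lin_def)
  show ?thesis
    unfolding tensor_map_def A.carrier_left_regular
  proof (intro equalityI subsetI)
    fix w assume "w \<in> A'.rels T <#>\<^bsub>A'.gens T\<^esub> ?F ` (A.rels T #>\<^bsub>A.gens T\<^esub> u)"
    then obtain r r' where r: "r \<in> A.rels T" "r' \<in> A'.rels T" "w = r' + ?F (r + u)"
      by (auto simp: set_mult_def r_coset_def)
    then have "w = (r' + ?F r) + ?F u" by (simp add: frag_extend_add)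
    then show "w \<in> A'.rels T #>\<^bsub>A'.gens T\<^esub> ?F u"
      using A'.rels_add[OF r(2) F[OF r(1)]] by (auto simp: r_coset_def)
  next
    fix w assume "w \<in> A'.rels T #>\<^bsub>A'.gens T\<^esub> ?F u"
    then obtain r' where r': "r' \<in> A'.rels T" "w = r' + ?F u" by (auto simp: r_coset_def)
    have "u \<in> A.rels T #>\<^bsub>A.gens T\<^esub> u" using A.rels_zero by (force simp: r_coset_def)
    then show "w \<in> A'.rels T <#>\<^bsub>A'.gens T\<^esub> ?F ` (A.rels T #>\<^bsub>A.gens T\<^esub> u)"
      using r' by (force simp: set_mult_def)
  qed
qed

section \<open>Tensor homology in coordinates\<close>

locale free_chain_complex = ring N
  for N :: "'a ring" (structure) +
  fixes S :: "'a set" and C :: "int \<Rightarrow> ('a, 'm, 'z) module_scheme" and d :: "int \<Rightarrow> 'm \<Rightarrow> 'm"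
    and B :: "int \<Rightarrow> 'm set"
  assumes subring: "subring S N"
    and complex: "chain_complex (N\<lparr>carrier := S\<rparr>) C d"
    and bases: "is_basis (N\<lparr>carrier := S\<rparr>) (C k) (B k)"
    and no_basis_below: "k < 0 \<Longrightarrow> B k = {}"
begin

lemma based_module: "based_module N S (C k) (B k)"
  using subring complex bases by (simp add: based_module_def based_module_axioms_def ring_axioms chain_complex_def)

abbreviation "crd k \<equiv> based_module.coord N S (C k) (B k)"

definition boundary_matrix :: "int \<Rightarrow> 'm \<Rightarrow> 'm \<Rightarrow> 'a" where
  "boundary_matrix k b = crd (k - 1) (d k b)"

lemma boundary_linear: "d k \<in> linear_hom (N\<lparr>carrier := S\<rparr>) (C k) (C (k - 1))"
  using complex by (simp add: chain_complex_def)

lemma boundary_closed: "x \<in> carrier (C k) \<Longrightarrow> d k x \<in> carrier (C (k - 1))"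
  using boundary_linear[of k] hom_in_carrier[of "d k" "add_monoid (C k)" "add_monoid (C (k - 1))" x]
  by (simp add: linear_hom_def)

lemma coord_boundary: "x \<in> carrier (C k) \<Longrightarrow> crd (k - 1) (d k x) = lin N (boundary_matrix k) (crd k x)"
  using coord_linear[OF based_module based_module boundary_linear]
  by (simp add: boundary_matrix_def[abs_def])

lemma basis_subset: "b \<in> B k \<Longrightarrow> b \<in> carrier (C k)"
  using based_module.basis_carrier[OF based_module] by blast

sublocale matrix_complex N S B boundary_matrix
proof (intro matrix_complex.intro matrix_complex_axioms.intro ring_axioms subring no_basis_below)
  fix b k assume b: "b \<in> B k"
  show "boundary_matrix k b \<in> vec N S (B (k - 1))"
    unfolding boundary_matrix_def
    by (intro based_module.coord_vec[OF based_module] boundary_closed basis_subset b)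
  have "lin N (boundary_matrix (k - 1)) (boundary_matrix k b) = crd (k - 1 - 1) (d (k - 1) (d k b))"
    using coord_boundary[OF boundary_closed[OF basis_subset[OF b]]] by (simp add: boundary_matrix_def[of k])
  also have "d (k - 1) (d k b) = \<zero>\<^bsub>C (k - 2)\<^esub>"
    using complex basis_subset[OF b] by (simp add: chain_complex_def)
  finally show "lin N (boundary_matrix (k - 1)) (boundary_matrix k b) = (\<lambda>_. \<zero>)"
    using based_module.coord_zero[OF based_module, of "k - 2"] by simp
qed

text \<open>The tensor coordinates form an isomorphism from the tensored complex to the matrix complex over \<open>T\<close>: they are injective by
\<open>tcoord_kernel\<close>, surjective by \<open>tcoord_surj\<close> and compatible with the boundary maps by \<open>tcoord_frag_extend\<close>.\<close>

theorem tensor_homology_trivial_iff: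
  assumes T: "subring T N" "S \<subseteq> T"
  shows "trivial_group (tensor_homology (N\<lparr>carrier := S\<rparr>) C d (N\<lparr>carrier := T\<rparr>) j) \<longleftrightarrow>
    exact_at N T B boundary_matrix j"
proof -
  have ext: "based_module_extension N S (C k) (B k) T" for k
    using based_module T by (simp add: based_module_extension_def based_module_extension_axioms_def)
  interpret X: based_module_extension N S "C k" "B k" T for k by (rule ext)
  let ?T = "\<lambda>k. tensor_product (N\<lparr>carrier := S\<rparr>) (C k) (left_regular (N\<lparr>carrier := T\<rparr>))"
  let ?D = "\<lambda>k. tensor_map (N\<lparr>carrier := S\<rparr>) (C k) (C (k - 1)) (left_regular (N\<lparr>carrier := T\<rparr>)) (d k)"
  let ?F = "\<lambda>k. frag_extend (\<lambda>(x, y). frag_of (d k x, y))"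
  let ?c = "\<lambda>k u. X.rels k T #>\<^bsub>X.gens k T\<^esub> u"
  have carT: "carrier (?T k) = ?c k ` X.Fr k" for k
    unfolding X.tensor_product_gens by (rule carrier_FactGroup)
  have oneT: "\<one>\<^bsub>?T k\<^esub> = ?c k 0" for k
    unfolding X.tensor_product_gens
    using group.coset_join2[OF group_free_Abelian_group _ X.rels_subgroup X.rels_zero] by simp
  have D: "?D k (?c k u) = ?c (k - 1) (?F k u)" if "u \<in> X.Fr k" for k u
    by (rule tensor_map_coset[OF ext ext boundary_linear that])
  have FF: "?F k u \<in> X.Fr (k - 1)"
      "X.tcoord (k - 1) T (?F k u) = lin N (boundary_matrix k) (X.tcoord k T u)"
    if "u \<in> X.Fr k" for k u
    using tcoord_frag_extend[OF ext ext boundary_linear that] by (simp_all add: boundary_matrix_def[abs_def])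
  have normal: "normal (X.rels k T) (X.gens k T)" for k
    using X.rels_subgroup comm_group.normal_iff_subgroup[OF abelian_free_Abelian_group] by blast
  have multT: "?c k u \<otimes>\<^bsub>?T k\<^esub> ?c k v = ?c k (u + v)" if "u \<in> X.Fr k" "v \<in> X.Fr k" for k u v
    unfolding X.tensor_product_gens using normal.rcos_sum[OF normal that] by simp
  have ceq: "?c k u = ?c k v \<longleftrightarrow> X.tcoord k T u = X.tcoord k T v" if "u \<in> X.Fr k" "v \<in> X.Fr k" for k u v
  proof -
    have "X.tcoord k T u i \<in> carrier N" "X.tcoord k T v i \<in> carrier N" for i
      using vecD(1)[OF X.tcoord_vec] that X.T_carrier by blast+
    then show ?thesis
      using X.coset_eq_iff[OF that] X.tcoord_kernel[OF X.Fr_diff[OF that]] X.tcoord_diff[OF that]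
      by (simp add: fun_eq_iff vdiff_def)
  qed
  have hom: "?D k \<in> hom (?T k) (?T (k - 1))" for k
  proof (rule homI)
    fix x assume "x \<in> carrier (?T k)"
    then show "?D k x \<in> carrier (?T (k - 1))" using FF(1) D by (auto simp only: carT)
    fix y assume "y \<in> carrier (?T k)"
    then obtain u v where "u \<in> X.Fr k" "x = ?c k u" "v \<in> X.Fr k" "y = ?c k v"
      using \<open>x \<in> carrier (?T k)\<close> unfolding carT by blast
    then show "?D k (x \<otimes>\<^bsub>?T k\<^esub> y) = ?D k x \<otimes>\<^bsub>?T (k - 1)\<^esub> ?D k y"
      by (simp only: multT D X.Fr_add FF(1) frag_extend_add)
  qed
  have dd: "?D (k - 1) (?D k x) = \<one>\<^bsub>?T (k - 2)\<^esub>" if x: "x \<in> carrier (?T k)" for k x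
  proof -
    obtain u where u: "u \<in> X.Fr k" "x = ?c k u" using x unfolding carT by blast
    have Du: "?D (k - 1) (?D k x) = ?c (k - 1 - 1) (?F (k - 1) (?F k u))"
      unfolding u(2) D[OF u(1)] D[OF FF(1)[OF u(1)]] ..
    have "X.tcoord k T u \<in> vec N (carrier N) (B k)"
      using X.tcoord_vec[OF u(1)] X.T_carrier by (blast intro: vec_mono)
    from lin_boundary_boundary[OF this]
    have "X.tcoord (k - 1 - 1) T (?F (k - 1) (?F k u)) = X.tcoord (k - 1 - 1) T 0"
      unfolding FF(2)[OF FF(1)[OF u(1)]] FF(2)[OF u(1)] X.tcoord_zero .
    then have "?c (k - 1 - 1) (?F (k - 1) (?F k u)) = ?c (k - 1 - 1) 0"
      using ceq[OF FF(1)[OF FF(1)[OF u(1)]] X.Fr_zero] by blast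
    then show ?thesis unfolding Du oneT by simp
  qed
  have "trivial_group (tensor_homology (N\<lparr>carrier := S\<rparr>) C d (N\<lparr>carrier := T\<rparr>) j) \<longleftrightarrow>
    (\<forall>x\<in>carrier (?T j). ?D j x = \<one>\<^bsub>?T (j - 1)\<^esub> \<longrightarrow> x \<in> ?D (j + 1) ` carrier (?T (j + 1)))"
    unfolding tensor_homology_def
    by (rule trivial_homology_iff[OF X.tensor_product_comm_group hom dd])
  also have "\<dots> \<longleftrightarrow> (\<forall>u\<in>X.Fr j. lin N (boundary_matrix j) (X.tcoord j T u) = (\<lambda>_. \<zero>) \<longrightarrow>
      (\<exists>v\<in>X.Fr (j + 1). X.tcoord j T u = lin N (boundary_matrix (j + 1)) (X.tcoord (j + 1) T v)))"
  proof -
    have 1: "?D j (?c j u) = \<one>\<^bsub>?T (j - 1)\<^esub> \<longleftrightarrow> lin N (boundary_matrix j) (X.tcoord j T u) = (\<lambda>_. \<zero>)"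
      if "u \<in> X.Fr j" for u
      unfolding D[OF that] oneT ceq[OF FF(1)[OF that] X.Fr_zero] FF(2)[OF that] X.tcoord_zero ..
    have 2: "?c j u \<in> ?D (j + 1) ` carrier (?T (j + 1)) \<longleftrightarrow>
      (\<exists>v\<in>X.Fr (j + 1). X.tcoord j T u = lin N (boundary_matrix (j + 1)) (X.tcoord (j + 1) T v))"
      if u: "u \<in> X.Fr j" for u
    proof -
      have "?c j u = ?D (j + 1) (?c (j + 1) v) \<longleftrightarrow>
          X.tcoord j T u = lin N (boundary_matrix (j + 1)) (X.tcoord (j + 1) T v)"
        if v: "v \<in> X.Fr (j + 1)" for v
        using D[OF v] FF[OF v] ceq[OF u, of "?F (j + 1) v"] by simp
      then show ?thesis unfolding carT image_image by (simp only: image_iff) blast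
    qed
    show ?thesis unfolding carT[of j] ball_simps by (rule ball_cong[OF refl]) (simp only: 1 2)
  qed
  also have "\<dots> \<longleftrightarrow> exact_at N T B boundary_matrix j"
  proof -
    have im: "X.tcoord k T ` X.Fr k = vec N T (B k)" for k
      using X.tcoord_vec X.tcoord_surj by blast
    show ?thesis unfolding exact_at_def im[symmetric] by (simp only: ball_simps bex_simps) metis
  qed
  finally show ?thesis .
qed

end

section \<open>Vanishing over the Novikov ring and over the division closure\<close>

theorem proposition3p6:
  fixes R :: "('r, 'x) ring_scheme"
    and G :: "('g, 'y) monoid_scheme"
    and \<phi> :: "'g \<Rightarrow> real"
    and C :: "int \<Rightarrow> ('g \<Rightarrow> 'r, 'c, 'z) module_scheme"
    and d :: "int \<Rightarrow> 'c \<Rightarrow> 'c"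
    and n :: nat
  assumes "ring R"
    and "finitely_generated_group G"
    and "\<phi> \<in> nonzero_characters G"
    and "chain_complex (group_ring R G) C d"
    and "\<And>k. free_module (group_ring R G) (C k)"
    and "\<And>k. k \<le> int n \<Longrightarrow> finitely_generated_module (group_ring R G) (C k)"
    and "\<And>k. k < 0 \<Longrightarrow> carrier (C k) = {\<zero>\<^bsub>C k\<^esub>}"
  shows "(\<forall>j \<le> int n.
            trivial_group (tensor_homology (group_ring R G) C d (novikov_ring R G \<phi>) j)) \<longleftrightarrow>
         (\<forall>j \<le> int n.
            trivial_group (tensor_homology (group_ring R G) C d
              (division_closure_ring (carrier (group_ring R G)) (novikov_ring R G \<phi>)) j))"
proof -
  interpret group_character R G \<phi>
    using assms(1-3)
    by (simp add: group_character_def group_character_axioms_def finitely_generated_group_def nonzero_characters_def)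
  let ?S = "carrier (group_ring R G)"
  let ?D = "division_closure ?S N"
  have mod: "right_module (group_ring R G) (C k)" for k
    using assms(4) by (simp add: chain_complex_def)
  have S: "subring ?S N"
    using group_ring_subring right_module.axioms(1)[OF mod] .
  have D: "subring ?D N" "?S \<subseteq> ?D"
    using nov.subring_division_closure[OF group_ring_subset] .
  have zero_basis: "is_basis (group_ring R G) (C k) {}" if "k < 0" for k
  proof -
    interpret Ck: abelian_group "C k" using right_module.axioms(2)[OF mod] .
    show ?thesis using assms(7)[OF that] by (auto simp: is_basis_def)
  qed
  \<comment> \<open>In negative degrees the module is zero, but over the zero ring it also has the basis \<open>{0}\<close>;
      the empty basis is the one that makes the matrix complex vanish there.\<close>
  define B where "B k = (if k < 0 then {} else SOME B. is_basis (group_ring R G) (C k) B)" for k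
  have B: "is_basis (group_ring R G) (C k) (B k)" for k
    using assms(5)[of k] zero_basis[of k] someI_ex[of "is_basis (group_ring R G) (C k)"]
    by (auto simp: B_def free_module_def)
  interpret free_chain_complex N ?S C d B
  proof (intro free_chain_complex.intro free_chain_complex_axioms.intro nov.ring_axioms S)
    show "chain_complex (N\<lparr>carrier := ?S\<rparr>) C d"
      unfolding group_ring_novikov[symmetric] by (rule assms(4))
    show "is_basis (N\<lparr>carrier := ?S\<rparr>) (C k) (B k)" for k
      unfolding group_ring_novikov[symmetric] by (rule B)
    show "B k = {}" if "k < 0" for k using that by (simp add: B_def)
  qed
  have fin: "finite (B k)" if "k \<le> int n" for k
    using based_module.finite_basis[OF based_module] assms(6)[OF that]
    by (simp add: group_ring_novikov[symmetric])
  interpret filtered_matrix_complex N nov_filt ?S B boundary_matrix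
    by (intro filtered_matrix_complex.intro filtered_matrix_complex_axioms.intro
        nov.complete_filtered_ring_axioms matrix_complex_axioms group_ring_dense)
  have nov_iff: "trivial_group (tensor_homology (group_ring R G) C d N j) \<longleftrightarrow>
      exact_at N (carrier N) B boundary_matrix j" for j
    using tensor_homology_trivial_iff[OF nov.carrier_is_subring group_ring_subset, of j]
    by (simp add: group_ring_novikov[symmetric])
  have D_iff: "trivial_group (tensor_homology (group_ring R G) C d (division_closure_ring ?S N) j) \<longleftrightarrow>
      exact_at N ?D B boundary_matrix j" for j
    using tensor_homology_trivial_iff[OF D, of j]
    by (simp add: group_ring_novikov[symmetric] division_closure_ring_def)
  have "\<forall>j\<le>int n. exact_at N ?D B boundary_matrix j" if "\<forall>j\<le>int n. exact_at N (carrier N) B boundary_matrix j"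
    using exact_at_division_closed[OF D nov.inv_in_division_closure fin] that by blast
  moreover have "\<forall>j\<le>int n. exact_at N (carrier N) B boundary_matrix j" if ex: "\<forall>j\<le>int n. exact_at N ?D B boundary_matrix j"
  proof (intro allI impI)
    fix j assume j: "j \<le> int n"
    obtain s where "\<forall>k\<le>int n. contracting N ?D B boundary_matrix s k"
      using contraction_exists[OF D] ex by blast
    then show "exact_at N (carrier N) B boundary_matrix j"
      using j by (intro contracting_imp_exact_at[OF _ _ subringE(1)[OF D(1)] nov.carrier_is_subring group_ring_subset]) auto
  qed
  ultimately show ?thesis unfolding nov_iff D_iff by blast
qed

end
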